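(* The hierarchy of injectively $\omega^n$-automatic structures, $n\ge 1$, is strict: for every integer $n\ge 1$, the class of injectively $\omega^n$-automatic structures is properly contained in the class of injectively $\omega^{n+1}$-automatic structures.
   Context: Words: for an ordinal $\alpha$ and a finite alphabet $\Sigma$, a word of length $\alpha$ over $\Sigma$ is a sequence $(\sigma(\beta))_{\beta<\alpha}$ of letters of $\Sigma$; the set of these is $\Sigma^\alpha$. A tuple of words $(\sigma_1,\ldots,\sigma_k)\in\Sigma_1^\alpha\times\cdots\times\Sigma_k^\alpha$ is identified with the word $\beta\mapsto(\sigma_1(\beta),\ldots,\sigma_k(\beta))$ over the product alphabet, so relations between words of length $\alpha$ are regarded as languages over the product alphabet. Automata: an ordinal Büchi automaton is a sextuple $(\Sigma,Q,q_0,\Delta,\gamma,F)$ with $\Sigma$ a finite alphabet, $Q$ a finite set of states, $q_0\in Q$ the initial state, $\Delta\subseteq Q\times\Sigma\times Q$ (successor transitions), $\gamma\subseteq P(Q)\times Q$ (limit transitions; $P(Q)$ is the powerset of $Q$), and $F\subseteq Q$. A run on a word $\sigma$ of length $\alpha$ is an $(\alpha+1)$-sequence of states $x$ with $x(0)=q_0$; $(x(i),\sigma(i),x(i+1))\in\Delta$ for $i<\alpha$; and $(\mathrm{Inf}(x,i),x(i))\in\gamma$ for every limit ordinal $i\le\alpha$, where $\mathrm{Inf}(x,i)=\{q\in Q\mid\forall\mu<i\ \exists\nu<i\ (\mu<\nu\text{ and }x(\nu)=q)\}$. The run is successful if $x(\alpha)\in F$, and a word is accepted if it has a successful run. An $\omega^n$-automaton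 is an ordinal Büchi automaton reading only words of length $\omega^n$ ($n\ge1$ an integer, ordinal exponentiation); $L(\mathcal{A})$ denotes the set of words of length $\omega^n$ accepted by $\mathcal{A}$. Injectively $\omega^n$-automatic: a relational structure $\mathcal{M}=(M,(R_i)_{1\le i\le k})$ with finitely many relations, $R_i$ of finite arity $n_i$, is injectively $\omega^n$-automatic if there are a finite alphabet $\Sigma$, an $\omega^n$-automaton $\mathcal{A}$ over $\Sigma$, and $\omega^n$-automata $\mathcal{A}_i$ over $\Sigma^{n_i}$ accepting relations $R_i'\subseteq L(\mathcal{A})^{n_i}$ ($1\le i\le k$), together with an isomorphism $h$ from $(L(\mathcal{A}),(R_i')_{1\le i\le k})$ onto $\mathcal{M}$. *)

theory Defs
  imports "HOL-Library.Multiset_Order" "HOL-Library.FuncSet" "HOL-Library.Countable"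
begin

section \<open>Ordinals\<close>

text \<open>
  All ordinals that occur are at most \<open>\<omega>\<^sup>n\<close> for a natural number \<open>n\<close>.  The ordinals below
  \<open>\<omega>\<^sup>\<omega>\<close> are represented by \<^typ>\<open>nat multiset\<close> with its (well-founded) multiset order: the
  multiset with elements \<open>a\<^sub>1 \<ge> \<dots> \<ge> a\<^sub>k\<close> is the ordinal with Cantor normal form
  \<open>\<omega>\<^bsup>a\<^sub>1\<^esup> + \<dots> + \<omega>\<^bsup>a\<^sub>k\<^esup>\<close>.  An ordinal is the order type of the set of its predecessors, so that
  the lemmas \<open>omega_pow_0\<close>, \<open>omega_pow_times_block\<close> and \<open>omega_pow_Suc\<close> below amount to
  \<open>\<omega>\<^sup>0 = 1\<close>, \<open>\<omega>\<^sup>n \<sqdot> (k + 1) = \<omega>\<^sup>n \<sqdot> k + \<omega>\<^sup>n\<close> and \<open>\<omega>\<^bsup>n + 1\<^esup> = sup\<^sub>k \<omega>\<^sup>n \<sqdot> k\<close>, where \<open>\<omega>\<^sup>n \<sqdot> k\<close> is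
  \<^term>\<open>replicate_mset k n\<close>.
\<close>

definition omega_pow :: "nat \<Rightarrow> nat multiset" where
  "omega_pow n = {#n#}"

definition ord_succ :: "'o::wellorder \<Rightarrow> 'o" where
  "ord_succ \<beta> = (LEAST \<gamma>. \<beta> < \<gamma>)"

definition limit_ord :: "'o::{wellorder, order_bot} \<Rightarrow> bool" where
  "limit_ord \<beta> \<longleftrightarrow> \<beta> \<noteq> bot \<and> (\<forall>\<mu><\<beta>. \<exists>\<nu><\<beta>. \<mu> < \<nu>)"

lemma less_omega_pow_iff: "\<beta> < omega_pow n \<longleftrightarrow> (\<forall>a\<in>#\<beta>. a < n)"
proof
  assume *: "\<beta> < omega_pow n"
  show "\<forall>a\<in>#\<beta>. a < n"
  proof (rule ccontr)
    assume "\<not> (\<forall>a\<in>#\<beta>. a < n)"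
    then obtain a where a: "a \<in># \<beta>" "n \<le> a" by (auto simp: not_less)
    have "{#n#} \<le> {#a#}" using a(2) by (cases "n = a") (auto intro!: less_imp_le)
    also have "{#a#} \<le> \<beta>" using a(1) by (simp add: subset_eq_imp_le_multiset)
    finally show False using * unfolding omega_pow_def by (rule notE[OF leD])
  qed
next
  assume "\<forall>a\<in>#\<beta>. a < n"
  then show "\<beta> < omega_pow n"
    unfolding omega_pow_def by (intro ex_gt_imp_less_multiset) auto
qed

lemma less_multiset_count_max:
  fixes \<beta> \<gamma> :: "nat multiset"
  assumes "count \<beta> n < count \<gamma> n" "\<forall>a\<in>#\<beta>. a \<le> n"
  shows "\<beta> < \<gamma>"
  unfolding less_multiset\<^sub>H\<^sub>O
proof (intro conjI allI impI)
  show "\<beta> \<noteq> \<gamma>" using assms(1) by auto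
  fix y assume y: "count \<gamma> y < count \<beta> y"
  then have "y \<in># \<beta>" by (metis count_greater_zero_iff gr_implies_not_zero gr0I)
  then have "y < n" using assms y by (metis le_neq_implies_less not_less_iff_gr_or_eq)
  then show "\<exists>x>y. count \<beta> x < count \<gamma> x" using assms(1) by blast
qed

lemma omega_pow_0: "{..<omega_pow 0} = {bot}"
proof -
  have "\<beta> < omega_pow 0 \<longleftrightarrow> \<beta> = bot" for \<beta>
    using multiset_eq_iff less_omega_pow_iff[of \<beta> 0] by (cases \<beta>) (auto simp: bot_multiset_def)
  then show ?thesis by auto
qed

lemma omega_pow_times_block:
  "strict_mono_on {..<omega_pow n} (\<lambda>\<beta>. replicate_mset k n + \<beta>)"
  "bij_betw (\<lambda>\<beta>. replicate_mset k n + \<beta>) {..<omega_pow n}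
     {replicate_mset k n..<replicate_mset (Suc k) n}"
proof -
  show "strict_mono_on {..<omega_pow n} (\<lambda>\<beta>. replicate_mset k n + \<beta>)"
    by (auto intro!: strict_mono_onI)
  have S: "replicate_mset (Suc k) n = replicate_mset k n + omega_pow n"
    by (simp add: omega_pow_def)
  have sub: "replicate_mset j n \<subseteq># \<gamma>" if "replicate_mset j n \<le> \<gamma>" "\<forall>a\<in>#\<gamma>. a \<le> n" for j \<gamma>
  proof (rule ccontr)
    assume "\<not> replicate_mset j n \<subseteq># \<gamma>"
    then have c: "count \<gamma> n < j"
      by (auto simp: subseteq_mset_def count_replicate_mset not_le split: if_splits)
    then have "\<gamma> < replicate_mset j n"
      using that(2) by (intro less_multiset_count_max[of _ n]) auto
    then show False using that(1) by auto
  qed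
  have "\<exists>\<beta><omega_pow n. \<gamma> = replicate_mset k n + \<beta>"
    if g: "replicate_mset k n \<le> \<gamma>" "\<gamma> < replicate_mset k n + omega_pow n" for \<gamma>
  proof -
    have "\<gamma> < {#Suc n#}"
    proof (rule order.strict_trans[OF g(2)])
      show "replicate_mset k n + omega_pow n < {#Suc n#}"
        by (rule ex_gt_imp_less_multiset) (auto simp: omega_pow_def)
    qed
    then have "\<forall>a\<in>#\<gamma>. a \<le> n" using less_omega_pow_iff[of \<gamma> "Suc n"] by (auto simp: omega_pow_def)
    then have "\<gamma> = replicate_mset k n + (\<gamma> - replicate_mset k n)"
      using sub[OF g(1)] by simp
    then show ?thesis using g(2) by (metis add_less_cancel_left)
  qed
  then show "bij_betw (\<lambda>\<beta>. replicate_mset k n + \<beta>) {..<omega_pow n}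
     {replicate_mset k n..<replicate_mset (Suc k) n}"
    unfolding S bij_betw_def by (auto simp: inj_on_def image_iff Bex_def)
qed

lemma omega_pow_Suc: "{..<omega_pow (Suc n)} = (\<Union>k. {..<replicate_mset k n})"
proof -
  have "\<beta> < omega_pow (Suc n) \<longleftrightarrow> (\<exists>k. \<beta> < replicate_mset k n)" for \<beta>
  proof
    assume "\<beta> < omega_pow (Suc n)"
    then have "\<forall>a\<in>#\<beta>. a \<le> n" by (auto simp: less_omega_pow_iff)
    then have "\<beta> < replicate_mset (Suc (count \<beta> n)) n"
      by (intro less_multiset_count_max[of _ n]) auto
    then show "\<exists>k. \<beta> < replicate_mset k n" ..
  next
    assume "\<exists>k. \<beta> < replicate_mset k n"
    then obtain k where "\<beta> < replicate_mset k n" ..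
    also have "replicate_mset k n < omega_pow (Suc n)" by (auto simp: less_omega_pow_iff)
    finally show "\<beta> < omega_pow (Suc n)" .
  qed
  then show ?thesis by auto
qed

lemma ord_succ_multiset: "ord_succ (\<beta> :: nat multiset) = add_mset 0 \<beta>"
  unfolding ord_succ_def
proof (rule Least_equality)
  fix \<gamma> assume *: "\<beta> < \<gamma>"
  then have lt: "\<exists>x>y. count \<beta> x < count \<gamma> x" if "count \<gamma> y < count \<beta> y" for y
    using that unfolding less_multiset\<^sub>H\<^sub>O by blast
  have "\<beta> \<noteq> \<gamma>" using * by (rule less_imp_neq)
  then obtain y where y: "count \<beta> y \<noteq> count \<gamma> y" 
    unfolding multiset_eq_iff by blast
  show "add_mset 0 \<beta> \<le> \<gamma>"
    unfolding less_eq_multiset\<^sub>H\<^sub>O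
  proof (intro allI impI)
    fix z assume z: "count \<gamma> z < count (add_mset 0 \<beta>) z"
    have "\<exists>x>z. count \<beta> x < count \<gamma> x"
    proof (cases "count \<gamma> z < count \<beta> z")
      case False
      then have z: "z = 0" "count \<gamma> 0 = count \<beta> 0" using z
        by (simp_all split: if_splits)
      then have "y > 0" using y by (intro gr0I) auto
      show ?thesis
      proof (cases "count \<gamma> y < count \<beta> y")
        case True
        then obtain x where "x > y" "count \<beta> x < count \<gamma> x" using lt by blast
        then show ?thesis using z(1) by (intro exI[of _ x]) auto
      next
        case False
        then show ?thesis using y z(1) \<open>y > 0\<close> by (intro exI[of _ y]) auto
      qed
    qed (rule lt)
    then obtain x where "x > z" "count \<beta> x < count \<gamma> x" by blast
    then show "\<exists>x>z. count (add_mset 0 \<beta>) x < count \<gamma> x"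
      by (intro exI[of _ x]) simp
  qed
qed simp


section \<open>Words and ordinal automata\<close>

text \<open>A word is \<^const>\<open>undefined\<close> outside its length, so that distinct words are distinct functions.\<close>

definition words :: "'o::wellorder \<Rightarrow> 'a set \<Rightarrow> ('o \<Rightarrow> 'a) set" where
  "words \<alpha> \<Sigma> = (\<Pi>\<^sub>E \<beta>\<in>{..<\<alpha>}. \<Sigma>)"

text \<open>The identification of a tuple of words with a word over the product alphabet.\<close>

definition convolution :: "'o::wellorder \<Rightarrow> ('o \<Rightarrow> 'a) list \<Rightarrow> 'o \<Rightarrow> 'a list" where
  "convolution \<alpha> ws = (\<lambda>\<beta>\<in>{..<\<alpha>}. map (\<lambda>w. w \<beta>) ws)"

definition tuples :: "nat \<Rightarrow> 'a set \<Rightarrow> 'a list set" where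
  "tuples k S = {xs. length xs = k \<and> set xs \<subseteq> S}"

record ('a, 'q) automaton =
  alphabet :: "'a set"
  states :: "'q set"
  initial :: 'q
  succ_trans :: "('q \<times> 'a \<times> 'q) set"
  lim_trans :: "('q set \<times> 'q) set"
  final :: "'q set"

definition ordinal_automaton :: "('a, 'q) automaton \<Rightarrow> bool" where
  "ordinal_automaton A \<longleftrightarrow>
     finite (alphabet A) \<and> finite (states A) \<and> initial A \<in> states A \<and>
     succ_trans A \<subseteq> states A \<times> alphabet A \<times> states A \<and>
     lim_trans A \<subseteq> Pow (states A) \<times> states A \<and>
     final A \<subseteq> states A"

definition Inf_states :: "('a, 'q) automaton \<Rightarrow> ('o::wellorder \<Rightarrow> 'q) \<Rightarrow> 'o \<Rightarrow> 'q set" where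
  "Inf_states A x i = {q \<in> states A. \<forall>\<mu><i. \<exists>\<nu><i. \<mu> < \<nu> \<and> x \<nu> = q}"

text \<open>Only the values of \<open>x\<close> at arguments \<open>\<le> \<alpha>\<close> matter: a run is an \<open>(\<alpha> + 1)\<close>-sequence.\<close>

definition run ::
  "'o::{wellorder, order_bot} \<Rightarrow> ('a, 'q) automaton \<Rightarrow> ('o \<Rightarrow> 'a) \<Rightarrow> ('o \<Rightarrow> 'q) \<Rightarrow> bool" where
  "run \<alpha> A w x \<longleftrightarrow>
     (\<forall>i\<le>\<alpha>. x i \<in> states A) \<and>
     x bot = initial A \<and>
     (\<forall>i<\<alpha>. (x i, w i, x (ord_succ i)) \<in> succ_trans A) \<and>
     (\<forall>i\<le>\<alpha>. limit_ord i \<longrightarrow> (Inf_states A x i, x i) \<in> lim_trans A)"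

definition language ::
  "'o::{wellorder, order_bot} \<Rightarrow> ('a, 'q) automaton \<Rightarrow> ('o \<Rightarrow> 'a) set" where
  "language \<alpha> A = {w \<in> words \<alpha> (alphabet A). \<exists>x. run \<alpha> A w x \<and> x \<alpha> \<in> final A}"


section \<open>Relational structures and automatic presentations\<close>

text \<open>The relations are given, in order, together with their arities.\<close>

record 'm rel_structure =
  universe :: "'m set"
  relations :: "(nat \<times> 'm list set) list"

definition is_structure :: "'m rel_structure \<Rightarrow> bool" where
  "is_structure M \<longleftrightarrow> (\<forall>(k, R) \<in> set (relations M). R \<subseteq> tuples k (universe M))"

definition isomorphism :: "('l \<Rightarrow> 'm) \<Rightarrow> 'l rel_structure \<Rightarrow> 'm rel_structure \<Rightarrow> bool" where
  "isomorphism h L M \<longleftrightarrow>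
     bij_betw h (universe L) (universe M) \<and>
     map fst (relations L) = map fst (relations M) \<and>
     (\<forall>i < length (relations L). \<forall>xs \<in> tuples (fst (relations L ! i)) (universe L).
        xs \<in> snd (relations L ! i) \<longleftrightarrow> map h xs \<in> snd (relations M ! i))"

definition tuple_relation ::
  "'o::{wellorder, order_bot} \<Rightarrow> 'a set \<Rightarrow> nat \<Rightarrow> ('a list, 'q) automaton \<Rightarrow> ('o \<Rightarrow> 'a) list set" where
  "tuple_relation \<alpha> \<Sigma> k B = {ws \<in> tuples k (words \<alpha> \<Sigma>). convolution \<alpha> ws \<in> language \<alpha> B}"

text \<open>\<open>(L(A), (R\<^sub>i')\<^sub>i)\<close>, where \<open>Bs\<close> lists the automata for the \<open>R\<^sub>i'\<close> with the arities.\<close>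

definition presented_structure ::
  "'o::{wellorder, order_bot} \<Rightarrow> ('a, 'q) automaton \<Rightarrow> (nat \<times> ('a list, 'q) automaton) list
    \<Rightarrow> ('o \<Rightarrow> 'a) rel_structure" where
  "presented_structure \<alpha> A Bs =
     \<lparr>universe = language \<alpha> A,
      relations = map (\<lambda>(k, B). (k, tuple_relation \<alpha> (alphabet A) k B)) Bs\<rparr>"

text \<open>
  Letters and states are natural numbers; as alphabets and state sets are finite, this is no
  restriction.  The condition that \<^const>\<open>presented_structure\<close> is a structure says
  \<open>R\<^sub>i' \<subseteq> L(A)\<^bsup>k\<^sub>i\<^esup>\<close>.
\<close>

definition injectively_automatic :: "nat \<Rightarrow> 'm rel_structure set" where
  "injectively_automatic n =
     {M. is_structure M \<and>
       (\<exists>(A :: (nat, nat) automaton) (Bs :: (nat \<times> (nat list, nat) automaton) list) h.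
          ordinal_automaton A \<and>
          (\<forall>(k, B) \<in> set Bs. ordinal_automaton B \<and> alphabet B = tuples k (alphabet A)) \<and>
          is_structure (presented_structure (omega_pow n) A Bs) \<and>
          isomorphism h (presented_structure (omega_pow n) A Bs) M)}"

text \<open>
  There are at most continuum many words of length \<open>\<omega>\<^sup>n\<close>.  Hence every structure in the class, over
  whatever type, has an isomorphic copy over \<^typ>\<open>nat set\<close>, and strictness of an inclusion between
  such classes can be expressed over this one type without loss of generality.
\<close>

lemma injectively_automatic_copy:
  assumes "M \<in> injectively_automatic n"
  obtains M' :: "nat set rel_structure" and g
    where "M' \<in> injectively_automatic n" "isomorphism g M' M"
proof -
  obtain A :: "(nat, nat) automaton" and Bs :: "(nat \<times> (nat list, nat) automaton) list" and h
    where P: "ordinal_automaton A"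
      "\<forall>(k, B) \<in> set Bs. ordinal_automaton B \<and> alphabet B = tuples k (alphabet A)"
      "is_structure (presented_structure (omega_pow n) A Bs)"
      "isomorphism h (presented_structure (omega_pow n) A Bs) M"
    using assms unfolding injectively_automatic_def by blast
  define N where "N = presented_structure (omega_pow n) A Bs"
  define f :: "(nat multiset \<Rightarrow> nat) \<Rightarrow> nat set" where
    "f w = range (\<lambda>\<beta>. to_nat (sorted_list_of_multiset \<beta>, w \<beta>))" for w
  have "inj f"
  proof (rule injI)
    fix v w assume "f v = f w"
    then have "to_nat (sorted_list_of_multiset \<beta>, v \<beta>) \<in> f w" for \<beta> by (auto simp: f_def)
    then have "v \<beta> = w \<beta>" for \<beta>
      unfolding f_def by (auto simp: image_iff) (metis mset_sorted_list_of_multiset)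
    then show "v = w" by auto
  qed
  then have inv: "the_inv f (f w) = w" for w by (simp add: the_inv_f_f)
  define M' where
    "M' = \<lparr>universe = f ` universe N, relations = map (\<lambda>(k, R). (k, map f ` R)) (relations N)\<rparr>"
  have arity: "map fst (relations N) = map fst (relations M')"
    by (auto simp: M'_def)
  have tup: "tuples k (f ` S) = map f ` tuples k S" for k S
  proof -
    have t: "tuples k T = {xs \<in> lists T. length xs = k}" for T :: "'z set"
      by (auto simp: tuples_def lists_eq_set)
    show ?thesis unfolding t by (auto simp: lists_image)
  qed
  have R: "i < length (relations N) \<Longrightarrow> snd (relations M' ! i) = map f ` snd (relations N ! i)" for i
    by (auto simp: M'_def case_prod_beta)
  have "is_structure M'"
    using P(3) unfolding is_structure_def N_def[symmetric]
    by (fastforce simp: M'_def tup)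
  moreover have "isomorphism f N M'"
    unfolding isomorphism_def
  proof (intro conjI arity allI impI ballI)
    show "bij_betw f (universe N) (universe M')"
      using \<open>inj f\<close> by (auto simp: M'_def bij_betw_def intro: inj_on_subset)
    show "xs \<in> snd (relations N ! i) \<longleftrightarrow> map f xs \<in> snd (relations M' ! i)"
      if "i < length (relations N)" for i xs
      using R[OF that] \<open>inj f\<close> by (simp add: inj_image_mem_iff)
  qed
  ultimately have 1: "M' \<in> injectively_automatic n"
    unfolding injectively_automatic_def using P N_def by blast
  have iso: "isomorphism h N M" using P(4) by (simp add: N_def)
  have 2: "isomorphism (h \<circ> the_inv f) M' M"
    unfolding isomorphism_def
  proof (intro conjI allI impI ballI)
    have "bij_betw (the_inv f) (universe M') (universe N)"
      using inv by (auto simp: M'_def bij_betw_def image_image intro!: inj_onI)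
    then show "bij_betw (h \<circ> the_inv f) (universe M') (universe M)"
      using iso by (auto simp: isomorphism_def intro: bij_betw_trans)
    show "map fst (relations M') = map fst (relations M)"
      using iso arity by (simp add: isomorphism_def)
    fix i xs assume i: "i < length (relations M')"
      and xs: "xs \<in> tuples (fst (relations M' ! i)) (universe M')"
    have iN: "i < length (relations N)" using i by (simp add: M'_def)
    have "fst (relations M' ! i) = fst (relations N ! i)" using iN by (simp add: M'_def case_prod_beta)
    then obtain ys where ys: "ys \<in> tuples (fst (relations N ! i)) (universe N)" "xs = map f ys"
      using xs tup by (auto simp: M'_def)
    have "xs \<in> snd (relations M' ! i) \<longleftrightarrow> ys \<in> snd (relations N ! i)"
      using R[OF iN] \<open>inj f\<close> ys(2) by (simp add: inj_image_mem_iff)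
    also have "\<dots> \<longleftrightarrow> map h ys \<in> snd (relations M ! i)"
      using iso iN ys(1) by (simp add: isomorphism_def)
    also have "map h ys = map (h \<circ> the_inv f) xs"
      using inv ys(2) by simp
    finally show "xs \<in> snd (relations M' ! i) \<longleftrightarrow> map (h \<circ> the_inv f) xs \<in> snd (relations M ! i)" .
  qed
  from 1 2 show thesis by (rule that)
qed

end

theory Submission
  imports Defs "HOL-Library.Infinite_Set" "HOL-Library.Countable_Set"
begin

text \<open>
  \<^emph>\<open>Inclusion.\<close>  Repeating every letter \<open>\<omega>\<close> times turns a word of length \<open>\<omega>\<^sup>n\<close> into one of length
  \<open>\<omega> \<sqdot> \<omega>\<^sup>n = \<omega>\<^bsup>n+1\<^esup>\<close>.  An automaton follows a run on the original word by guessing, at the start of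
  each repeated letter, the next state of that run and keeping it until the next limit.  As repetition
  acts letterwise, it also commutes with the coding of tuples, so a presentation can be stretched as a
  whole (\<open>injectively_automatic_Suc\<close>).

  \<^emph>\<open>Strictness.\<close>  The separating structure consists of the finite subsets of \<open>\<omega>\<^bsup>n+1\<^esup>\<close>, with the constant
  \<open>{0}\<close>, union, and for each \<open>j \<le> n\<close> a map that sends \<open>{\<beta>}\<close> to \<open>{\<beta> + \<omega>\<^sup>j}\<close>.  Let \<open>m\<close> be a power of 2.  Every
  ordinal \<open>\<omega>\<^sup>n a\<^sub>n + \<dots> + a\<^sub>0\<close> with coefficients below \<open>m\<close> is reached from \<open>0\<close> in \<open>a\<^sub>n + \<dots> + a\<^sub>0\<close> steps, and
  balanced unions produce all nonempty sets of such ordinals in \<open>O(log m)\<close> further steps.  The number of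
  sets generated within \<open>O(m)\<close> steps is thus at least \<open>2\<close> to the power \<open>m\<^bsup>n+1\<^esup>\<close>, minus 1.

  In a countable structure presented by words of length \<open>\<omega>\<^sup>n\<close> such growth is impossible
  (\<open>automatic_growth\<close>): within \<open>O(m)\<close> steps, finitely many functions generate at most \<open>2\<close> to the power
  \<open>O(m\<^sup>n)\<close> elements.  Two facts are behind this.

  First, a countable language has, up to initial segments, finitely many tails.  If two loops at a
  state \<open>r\<close>, through the same set of states and followed by a limit transition for this set, did not
  commute, then composing them in all infinite patterns would give uncountably many accepted words.
  Hence all these loops commute, every word that traverses such loops forever is eventually periodic,
  and its period is determined by \<open>r\<close> and the set of states
  (\<open>omega_tails\<close>).  This holds at each level: the letters in this argument may be words of length \<open>\<omega>\<^sup>j\<close>.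
  So a word can be measured by the least \<open>m\<close> such that at every level its blocks from number \<open>m\<close> on form
  one of finitely many tails; a word of size \<open>m\<close> is given by \<open>m\<^sup>n\<close> letters and by a choice of tails for
  its blocks (\<open>card_small\<close>).

  Second, if a relation recognised by an automaton is a partial function, then beyond the point where all
  its arguments follow tails, its value is determined by the state at that point and by these tails.
  There are finitely many possibilities, each of which reaches a tail after a bounded number of blocks.
  Therefore applying the function increases the size by at most a constant (\<open>growth\<close>).
\<close>

section \<open>Words of length \<open>\<omega>\<^sup>n\<close> as trees\<close>

datatype 'a wtree = Leaf 'a | Node "nat \<Rightarrow> 'a wtree"

text \<open>
  A word of length \<open>\<omega>\<^bsup>n+1\<^esup>\<close> is an \<open>\<omega>\<close>-sequence of words of length \<open>\<omega>\<^sup>n\<close>.  Iterating this replaces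
  ordinals by induction on \<open>n\<close>, and makes words of all levels elements of one type.
\<close>

primrec tree_of :: "nat \<Rightarrow> (nat multiset \<Rightarrow> 'a) \<Rightarrow> 'a wtree" where
  "tree_of 0 w = Leaf (w {#})"
| "tree_of (Suc n) w = Node (\<lambda>l. tree_of n (\<lambda>\<beta>. w (replicate_mset l n + \<beta>)))"

abbreviation recurring :: "(nat \<Rightarrow> 'q set) \<Rightarrow> 'q set" where
  "recurring Vs \<equiv> {r. \<exists>\<^sub>\<infinity>l. r \<in> Vs l}"

text \<open>
  The set \<open>V\<close> records the states visited before the end.  It is needed because the next limit transition
  depends on the states in all blocks, not only on those at block boundaries.
\<close>

definition omega_path ::
  "('q \<Rightarrow> 'b \<Rightarrow> 'q set \<Rightarrow> 'q \<Rightarrow> bool) \<Rightarrow> ('q set \<times> 'q) set \<Rightarrow> 'q \<Rightarrow> (nat \<Rightarrow> 'b) \<Rightarrow> 'q set \<Rightarrow> 'q \<Rightarrow> bool"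
  where
  "omega_path P G p u V q \<longleftrightarrow>
     (\<exists>s Vs. s 0 = p \<and> (\<forall>l. P (s l) (u l) (Vs l) (s (Suc l))) \<and> V = (\<Union>l. Vs l) \<and>
             (recurring Vs, q) \<in> G)"

primrec path ::
  "nat \<Rightarrow> ('a, 'q) automaton \<Rightarrow> 'q \<Rightarrow> 'a wtree \<Rightarrow> 'q set \<Rightarrow> 'q \<Rightarrow> bool" where
  "path 0 A = (\<lambda>p t V q. \<exists>a. t = Leaf a \<and> (p, a, q) \<in> succ_trans A \<and> V = {p})"
| "path (Suc n) A = (\<lambda>p t V q. \<exists>u. t = Node u \<and> omega_path (path n A) (lim_trans A) p u V q)"

text \<open>
  A run without conditions on its first and last state, so that it can be cut into blocks.
\<close>

definition run_between ::
  "nat \<Rightarrow> ('a, 'q) automaton \<Rightarrow> (nat multiset \<Rightarrow> 'a) \<Rightarrow> (nat multiset \<Rightarrow> 'q) \<Rightarrow> bool" where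
  "run_between n A w x \<longleftrightarrow>
     (\<forall>i\<le>omega_pow n. x i \<in> states A) \<and>
     (\<forall>i<omega_pow n. (x i, w i, x (ord_succ i)) \<in> succ_trans A) \<and>
     (\<forall>i\<le>omega_pow n. limit_ord i \<longrightarrow> (Inf_states A x i, x i) \<in> lim_trans A)"

lemma bot_mset: "(bot :: nat multiset) = {#}"
  by (simp add: bot_multiset_def)

lemma shift_decomp:
  assumes "replicate_mset l n \<le> \<nu>" "\<nu> < replicate_mset l n + \<beta>" "\<beta> \<le> omega_pow n"
  obtains \<nu>' where "\<nu> = replicate_mset l n + \<nu>'" "\<nu>' < \<beta>"
proof -
  have "replicate_mset l n + \<beta> \<le> replicate_mset l n + omega_pow n" using assms(3) by simp
  also have "\<dots> = replicate_mset (Suc l) n" by (simp add: omega_pow_def)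
  finally have "\<nu> < replicate_mset (Suc l) n" using assms(2) by (rule order.strict_trans2[rotated])
  then have "\<nu> \<in> {replicate_mset l n..<replicate_mset (Suc l) n}" using assms(1) by simp
  then obtain \<nu>' where "\<nu> = replicate_mset l n + \<nu>'"
    using omega_pow_times_block(2)[of l n] unfolding bij_betw_def by blast
  with assms(2) that show thesis by auto
qed

lemma below_omega_pow_Suc:
  assumes "\<gamma> < omega_pow (Suc n)"
  obtains l \<beta> where "\<gamma> = replicate_mset l n + \<beta>" "\<beta> < omega_pow n"
proof
  show "\<gamma> = replicate_mset (count \<gamma> n) n + (\<gamma> - replicate_mset (count \<gamma> n) n)"
    by (rule multiset_eqI) (simp add: count_replicate_mset)
  have "a < n" if a: "a \<in># \<gamma> - replicate_mset (count \<gamma> n) n" for a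
  proof -
    have "a \<noteq> n" using a by (auto simp: in_diff_count)
    moreover have "a < Suc n" using a assms by (auto simp: less_omega_pow_iff dest: in_diffD)
    ultimately show ?thesis by simp
  qed
  then show "\<gamma> - replicate_mset (count \<gamma> n) n < omega_pow n" by (simp add: less_omega_pow_iff)
qed

lemma count_block: "\<beta> < omega_pow n \<Longrightarrow> count (replicate_mset l n + \<beta>) n = l"
  by (auto simp: less_omega_pow_iff count_replicate_mset not_in_iff[symmetric])

lemma block_less: "\<beta> \<le> omega_pow n \<Longrightarrow> replicate_mset l n + \<beta> < omega_pow (Suc n)"
proof -
  assume "\<beta> \<le> omega_pow n"
  then have "\<beta> < omega_pow (Suc n)"
    by (rule order.strict_trans1) (simp add: less_omega_pow_iff, simp add: omega_pow_def)
  then show ?thesis by (auto simp: less_omega_pow_iff split: if_splits)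
qed

lemma lessThan_omega_pow_Suc:
  "{..<omega_pow (Suc n)} = (\<Union>l. (\<lambda>\<beta>. replicate_mset l n + \<beta>) ` {..<omega_pow n})" (is "?A = ?B")
proof
  show "?A \<subseteq> ?B" by (auto intro: below_omega_pow_Suc)
  show "?B \<subseteq> ?A" using block_less less_imp_le by blast
qed

lemma bot_less_omega_pow [simp]: "{#} < omega_pow n" by (simp add: omega_pow_def)

lemma replicate_less: "l < l' \<Longrightarrow> \<beta> < omega_pow n \<Longrightarrow> replicate_mset l n + \<beta> < replicate_mset l' n"
proof -
  assume *: "l < l'" "\<beta> < omega_pow n"
  have "replicate_mset l n + \<beta> < replicate_mset l n + omega_pow n" using *(2) by simp
  also have "\<dots> = replicate_mset (Suc l) n" by (simp add: omega_pow_def)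
  also have "\<dots> \<le> replicate_mset l' n"
    using *(1) by (intro subset_eq_imp_le_multiset) (auto simp: subseteq_mset_def count_replicate_mset)
  finally show ?thesis .
qed

text \<open>
  Both being a limit and the set of states that recur below a limit are properties of final segments, so
  that they do not change when an initial segment \<open>\<omega>\<^sup>n \<sqdot> l\<close> is cut off.
\<close>

lemma cofinal_shift:
  assumes "\<beta> \<noteq> {#}" "\<beta> \<le> omega_pow n"
  shows "(\<forall>\<mu><replicate_mset l n + \<beta>. \<exists>\<nu><replicate_mset l n + \<beta>. \<mu> < \<nu> \<and> P \<nu>) \<longleftrightarrow>
    (\<forall>\<mu><\<beta>. \<exists>\<nu><\<beta>. \<mu> < \<nu> \<and> P (replicate_mset l n + \<nu>))" (is "?L \<longleftrightarrow> ?R")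
proof
  assume L: ?L
  show ?R
  proof (intro allI impI)
    fix \<mu> assume "\<mu> < \<beta>"
    then have "replicate_mset l n + \<mu> < replicate_mset l n + \<beta>" by simp
    with L obtain \<nu> where \<nu>: "\<nu> < replicate_mset l n + \<beta>" "replicate_mset l n + \<mu> < \<nu>" "P \<nu>" by blast
    have "replicate_mset l n \<le> replicate_mset l n + \<mu>" by (rule subset_eq_imp_le_multiset) simp
    then have "replicate_mset l n \<le> \<nu>" using \<nu>(2) by (meson le_less_trans less_imp_le)
    from shift_decomp[OF this \<nu>(1) assms(2)] obtain \<nu>' where "\<nu> = replicate_mset l n + \<nu>'" "\<nu>' < \<beta>" .
    with \<nu> show "\<exists>\<nu><\<beta>. \<mu> < \<nu> \<and> P (replicate_mset l n + \<nu>)" by auto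
  qed
next
  assume R: ?R
  show ?L
  proof (intro allI impI)
    fix \<mu> assume \<mu>: "\<mu> < replicate_mset l n + \<beta>"
    have "\<exists>\<mu>'<\<beta>. \<mu> \<le> replicate_mset l n + \<mu>'"
    proof (cases "replicate_mset l n \<le> \<mu>")
      case True
      from shift_decomp[OF True \<mu> assms(2)] show ?thesis by auto
    next
      case False
      then show ?thesis using assms(1) by (intro exI[of _ "{#}"]) (auto simp: nonempty_has_size)
    qed
    then obtain \<mu>' where \<mu>': "\<mu>' < \<beta>" "\<mu> \<le> replicate_mset l n + \<mu>'" by blast
    with R obtain \<nu> where "\<nu> < \<beta>" "\<mu>' < \<nu>" "P (replicate_mset l n + \<nu>)" by blast
    then show "\<exists>\<nu><replicate_mset l n + \<beta>. \<mu> < \<nu> \<and> P \<nu>"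
      using \<mu>'(2) by (intro exI[of _ "replicate_mset l n + \<nu>"]) (auto elim: le_less_trans)
  qed
qed

lemma limit_shift:
  assumes "\<beta> \<noteq> {#}" "\<beta> \<le> omega_pow n"
  shows "limit_ord (replicate_mset l n + \<beta>) \<longleftrightarrow> limit_ord \<beta>"
  using cofinal_shift[OF assms, of l "\<lambda>_. True"] assms(1) by (simp add: limit_ord_def bot_mset)

lemma Inf_shift:
  assumes "\<beta> \<noteq> {#}" "\<beta> \<le> omega_pow n"
  shows "Inf_states A x (replicate_mset l n + \<beta>) = Inf_states A (\<lambda>\<beta>. x (replicate_mset l n + \<beta>)) \<beta>"
  using cofinal_shift[OF assms, of l] by (simp add: Inf_states_def)

lemma limit_omega_pow_Suc: "limit_ord (omega_pow (Suc n))"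
  unfolding limit_ord_def
proof (intro conjI allI impI)
  show "omega_pow (Suc n) \<noteq> bot" by (simp add: bot_mset omega_pow_def)
  fix \<mu> assume "\<mu> < omega_pow (Suc n)"
  then show "\<exists>\<nu><omega_pow (Suc n). \<mu> < \<nu>"
    by (intro exI[of _ "add_mset 0 \<mu>"]) (auto simp: less_omega_pow_iff)
qed

lemma Inf_omega_pow_Suc:
  "Inf_states A x (omega_pow (Suc n)) =
     {r \<in> states A. \<exists>\<^sub>\<infinity>l. r \<in> (\<lambda>\<beta>. x (replicate_mset l n + \<beta>)) ` {..<omega_pow n}}"
proof -
  have "(\<forall>\<mu><omega_pow (Suc n). \<exists>\<nu><omega_pow (Suc n). \<mu> < \<nu> \<and> x \<nu> = r) \<longleftrightarrow>
    (\<exists>\<^sub>\<infinity>l. r \<in> (\<lambda>\<beta>. x (replicate_mset l n + \<beta>)) ` {..<omega_pow n})" (is "?L \<longleftrightarrow> ?R") for r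
  proof
    assume L: ?L
    show ?R
      unfolding INFM_nat_le
    proof
      fix m
      have "replicate_mset m n < omega_pow (Suc n)" by (auto simp: less_omega_pow_iff)
      with L obtain \<nu> where \<nu>: "\<nu> < omega_pow (Suc n)" "replicate_mset m n < \<nu>" "x \<nu> = r" by blast
      obtain l \<beta> where \<beta>: "\<nu> = replicate_mset l n + \<beta>" "\<beta> < omega_pow n"
        using below_omega_pow_Suc[OF \<nu>(1)] .
      have "m \<le> l"
      proof (rule ccontr)
        assume "\<not> m \<le> l"
        then have "\<nu> < replicate_mset m n" using replicate_less[OF _ \<beta>(2), of "l" m] \<beta>(1) by simp
        with \<nu>(2) show False by simp
      qed
      then show "\<exists>l\<ge>m. r \<in> (\<lambda>\<beta>. x (replicate_mset l n + \<beta>)) ` {..<omega_pow n}"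
        using \<nu>(3) \<beta> by (intro exI[of _ "l"]) auto
    qed
  next
    assume R: ?R
    show ?L
    proof (intro allI impI)
      fix \<mu> assume "\<mu> < omega_pow (Suc n)"
      then obtain k \<beta> where \<beta>: "\<mu> = replicate_mset k n + \<beta>" "\<beta> < omega_pow n"
        by (rule below_omega_pow_Suc)
      from R obtain l \<beta>' where l: "l \<ge> Suc k" "\<beta>' < omega_pow n" "r = x (replicate_mset l n + \<beta>')"
        unfolding INFM_nat_le by blast
      have "\<mu> < replicate_mset l n" using replicate_less[OF _ \<beta>(2), of _ l] \<beta>(1) l(1)
        by (metis Suc_le_lessD)
      also have "\<dots> \<le> replicate_mset l n + \<beta>'" by (rule subset_eq_imp_le_multiset) simp
      finally show "\<exists>\<nu><omega_pow (Suc n). \<mu> < \<nu> \<and> x \<nu> = r"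
        using l(3) block_less[OF less_imp_le[OF l(2)], of l] by blast
    qed
  qed
  then show ?thesis by (simp add: Inf_states_def)
qed

text \<open>
  Every position below \<open>\<omega>\<^bsup>n+1\<^esup>\<close> other than \<open>0\<close> lies strictly inside a block or is the end of one; hence the
  only condition on a run that is not local to a block is the limit transition at the very end.
\<close>

lemma run_between_Suc:
  "run_between (Suc n) A w x \<longleftrightarrow>
     (\<forall>l. run_between n A (\<lambda>\<beta>. w (replicate_mset l n + \<beta>)) (\<lambda>\<beta>. x (replicate_mset l n + \<beta>))) \<and>
     x (omega_pow (Suc n)) \<in> states A \<and>
     (Inf_states A x (omega_pow (Suc n)), x (omega_pow (Suc n))) \<in> lim_trans A"
    (is "?L \<longleftrightarrow> ?R")
proof
  assume L: ?L
  have 1: "replicate_mset l n + i \<le> omega_pow (Suc n)" if "i \<le> omega_pow n" for l i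
    using block_less[OF that, of l] by simp
  show ?R
    unfolding run_between_def
  proof (intro conjI allI impI)
    fix l i assume i: "i \<le> omega_pow n" "limit_ord i"
    then have "i \<noteq> {#}" by (auto simp: limit_ord_def bot_mset)
    then show "(Inf_states A (\<lambda>\<beta>. x (replicate_mset l n + \<beta>)) i, x (replicate_mset l n + i)) \<in> lim_trans A"
      using limit_shift[of i n l] Inf_shift[of i n A x l] i
        L[unfolded run_between_def, THEN conjunct2, THEN conjunct2, rule_format, OF 1[OF i(1), of l]]
      by simp
  next
    fix l i assume "i < omega_pow n"
    then show "(x (replicate_mset l n + i), w (replicate_mset l n + i), x (replicate_mset l n + ord_succ i)) \<in> succ_trans A"
      using L block_less[of i n l] by (auto simp: run_between_def ord_succ_multiset)
  qed (use L 1 limit_omega_pow_Suc[of n] in \<open>auto simp: run_between_def\<close>)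
next
  assume R: ?R
  show ?L
    unfolding run_between_def
  proof (intro conjI allI impI)
    fix i assume i: "i \<le> omega_pow (Suc n)" 
    show "x i \<in> states A"
    proof (cases "i = omega_pow (Suc n)")
      case False
      with i have "i < omega_pow (Suc n)" by simp
      then obtain l \<beta> where "i = replicate_mset l n + \<beta>" "\<beta> < omega_pow n"
        by (rule below_omega_pow_Suc)
      then show ?thesis using R unfolding run_between_def by (metis less_imp_le)
    qed (use R in auto)
    assume lim: "limit_ord i"
    show "(Inf_states A x i, x i) \<in> lim_trans A"
    proof (cases "i = omega_pow (Suc n)")
      case False
      with i have "i < omega_pow (Suc n)" by simp
      then obtain k \<beta> where \<beta>: "i = replicate_mset k n + \<beta>" "\<beta> < omega_pow n"
        by (rule below_omega_pow_Suc)
      have "\<exists>l \<beta>. i = replicate_mset l n + \<beta> \<and> \<beta> \<le> omega_pow n \<and> \<beta> \<noteq> {#}"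
      proof (cases "\<beta> = {#}")
        case True
        then have "k \<noteq> 0" using lim \<beta>(1) by (cases k) (auto simp: limit_ord_def bot_mset)
        then obtain l where "k = Suc l" using not0_implies_Suc by auto
        then show ?thesis using True \<beta> by (intro exI[of _ l] exI[of _ "omega_pow n"]) (simp add: omega_pow_def)
      qed (use \<beta> in \<open>metis less_imp_le\<close>)
      then obtain l \<beta> where b: "i = replicate_mset l n + \<beta>" "\<beta> \<le> omega_pow n" "\<beta> \<noteq> {#}" by blast
      then show ?thesis
        using R lim limit_shift[OF b(3,2), of l] Inf_shift[OF b(3,2), of A x l] by (simp add: run_between_def)
    qed (use R in auto)
  next
    fix i assume "i < omega_pow (Suc n)"
    then obtain k \<beta> where \<beta>: "i = replicate_mset k n + \<beta>" "\<beta> < omega_pow n"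
      by (rule below_omega_pow_Suc)
    from R \<beta>(2) have "(x (replicate_mset k n + \<beta>), w (replicate_mset k n + \<beta>),
       x (replicate_mset k n + ord_succ \<beta>)) \<in> succ_trans A"
      by (auto simp: run_between_def)
    moreover have "replicate_mset k n + ord_succ \<beta> = ord_succ i"
      by (simp add: \<beta>(1) ord_succ_multiset)
    ultimately show "(x i, w i, x (ord_succ i)) \<in> succ_trans A" using \<beta>(1) by simp
  qed
qed

lemma run_between_cong:
  assumes "run_between n A w y" and eq: "\<And>i. i \<le> omega_pow n \<Longrightarrow> x i = y i"
  shows "run_between n A w x"
  unfolding run_between_def
proof (intro conjI allI impI)
  have succ_le: "ord_succ i \<le> omega_pow n" if "i < omega_pow n" for i
    unfolding ord_succ_def using that by (rule Least_le)
  fix i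
  show "x i \<in> states A" if "i \<le> omega_pow n"
    using that assms(1) eq[OF that] by (simp add: run_between_def)
  show "(x i, w i, x (ord_succ i)) \<in> succ_trans A" if "i < omega_pow n"
    using that assms(1) eq[of i] eq[OF succ_le[OF that]] by (simp add: run_between_def)
  assume i: "i \<le> omega_pow n" "limit_ord i"
  have "x \<nu> = y \<nu>" if "\<nu> < i" for \<nu>
    using that i(1) by (intro eq) auto
  then have "Inf_states A x i = Inf_states A y i"
    unfolding Inf_states_def by (metis (no_types, lifting))
  then show "(Inf_states A x i, x i) \<in> lim_trans A"
    using assms(1) i eq[OF i(1)] by (simp add: run_between_def)
qed

text \<open>
  The induction step cuts a run at the multiples of \<open>\<omega>\<^sup>n\<close>, and conversely glues runs on the blocks.
\<close>

lemma path_iff_run: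
  assumes A: "ordinal_automaton A"
  shows "path n A p (tree_of n w) V q \<longleftrightarrow>
    (\<exists>x. run_between n A w x \<and> x {#} = p \<and> V = x ` {..<omega_pow n} \<and> x (omega_pow n) = q)"
proof (induction n arbitrary: p w V q)
  case 0
  have lt: "i < omega_pow 0 \<longleftrightarrow> i = {#}" for i using omega_pow_0 bot_mset by auto
  have le: "i \<le> omega_pow 0 \<longleftrightarrow> i = {#} \<or> i = omega_pow 0" for i using lt[of i] by (auto simp: le_less)
  have nl: "limit_ord i \<Longrightarrow> i \<le> omega_pow 0 \<Longrightarrow> False" for i
    unfolding limit_ord_def le by (auto simp: bot_mset lt)
  have r: "run_between 0 A w x \<longleftrightarrow> (x {#}, w {#}, x (omega_pow 0)) \<in> succ_trans A" for x
    using A nl unfolding run_between_def ordinal_automaton_def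
    by (auto simp: lt le ord_succ_multiset omega_pow_def)
  show ?case (is "?L \<longleftrightarrow> ?R")
  proof
    assume ?L
    then show ?R
      by (intro exI[of _ "\<lambda>i. if i = {#} then p else q"]) (auto simp: r lt omega_pow_def)
  next
    assume ?R
    then show ?L by (auto simp: r lt)
  qed
next
  case (Suc n)
  let ?R = "\<lambda>l. replicate_mset l n"
  show ?case (is "?L \<longleftrightarrow> ?RR")
  proof
    assume ?L
    then obtain s Vs where s: "s 0 = p" "V = (\<Union>l. Vs l)" "(recurring Vs, q) \<in> lim_trans A"
      and "\<And>l. path n A (s l) (tree_of n (\<lambda>\<beta>. w (?R l + \<beta>))) (Vs l) (s (Suc l))"
      unfolding path.simps tree_of.simps omega_path_def by auto
    then have "\<forall>l. \<exists>x. run_between n A (\<lambda>\<beta>. w (?R l + \<beta>)) x \<and> x {#} = s l \<and>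
       Vs l = x ` {..<omega_pow n} \<and> x (omega_pow n) = s (Suc l)"
      using Suc.IH by blast
    from choice[OF this] obtain xs where xs:
       "\<And>l. run_between n A (\<lambda>\<beta>. w (?R l + \<beta>)) (xs l)" "\<And>l. xs l {#} = s l"
       "\<And>l. Vs l = xs l ` {..<omega_pow n}" "\<And>l. xs l (omega_pow n) = s (Suc l)"
      by blast
    define x where "x i = (if i = omega_pow (Suc n) then q else xs (count i n) (i - ?R (count i n)))" for i
    have x: "x (?R l + \<beta>) = xs l \<beta>" if "\<beta> \<le> omega_pow n" for l \<beta>
    proof (cases "\<beta> = omega_pow n")
      case True
      then have "?R l + \<beta> = ?R (Suc l)" by (simp add: omega_pow_def)
      moreover have "x (?R (Suc l)) = xs (Suc l) {#}"
        using block_less[of "{#}" n "Suc l"] by (auto simp: x_def)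
      ultimately show ?thesis using True xs by simp
    next
      case False
      with that have "\<beta> < omega_pow n" by simp
      then have "count (?R l + \<beta>) n = l" by (rule count_block)
      moreover have "?R l + \<beta> \<noteq> omega_pow (Suc n)" using block_less[OF that, of l] by auto
      ultimately show ?thesis unfolding x_def by simp
    qed
    have Vs: "(\<lambda>\<beta>. x (?R l + \<beta>)) ` {..<omega_pow n} = Vs l" for l
      unfolding xs(3) by (rule image_cong) (auto simp: x)
    have q: "x (omega_pow (Suc n)) = q" by (simp add: x_def)
    have Vst: "Vs l \<subseteq> states A" for l using xs(1)[of l] unfolding xs(3) run_between_def by auto
    have "\<exists>\<^sub>\<infinity>l. r \<in> Vs l \<Longrightarrow> r \<in> states A" for r
      using Vst INFM_EX[of "\<lambda>l. r \<in> Vs l"] by blast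
    then have inf: "Inf_states A x (omega_pow (Suc n)) = recurring Vs"
      unfolding Inf_omega_pow_Suc Vs by auto
    have eqr: "run_between n A v (\<lambda>\<beta>. x (?R l + \<beta>))" if "run_between n A v (xs l)" for v l
      by (rule run_between_cong[OF that]) (simp add: x)
    have "run_between (Suc n) A w x"
      unfolding run_between_Suc q inf using eqr[OF xs(1)] s(3) A by (auto simp: ordinal_automaton_def)
    moreover have "x {#} = p" using x[of "{#}" 0] xs(2)[of 0] s(1) by simp
    moreover have "V = x ` {..<omega_pow (Suc n)}"
      unfolding s(2) Vs[symmetric] lessThan_omega_pow_Suc by (simp add: image_UN image_image)
    ultimately show ?RR using q by blast
  next
    assume ?RR
    then obtain x where x: "run_between (Suc n) A w x" "x {#} = p" "V = x ` {..<omega_pow (Suc n)}"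
      "x (omega_pow (Suc n)) = q" by blast
    define Vs where "Vs l = (\<lambda>\<beta>. x (?R l + \<beta>)) ` {..<omega_pow n}" for l
    have st: "Vs l \<subseteq> states A" for l
      using x(1) unfolding run_between_Suc by (auto simp: Vs_def run_between_def)
    then have "\<exists>\<^sub>\<infinity>l. r \<in> Vs l \<Longrightarrow> r \<in> states A" for r
      using INFM_EX[of "\<lambda>l. r \<in> Vs l"] by blast
    then have inf: "Inf_states A x (omega_pow (Suc n)) = recurring Vs"
      unfolding Inf_omega_pow_Suc Vs_def[symmetric] by auto
    have "path n A (x (?R l)) (tree_of n (\<lambda>\<beta>. w (?R l + \<beta>))) (Vs l) (x (?R (Suc l)))" for l
      unfolding Suc.IH using x(1) unfolding run_between_Suc
      by (intro exI[of _ "\<lambda>\<beta>. x (?R l + \<beta>)"]) (simp add: Vs_def omega_pow_def)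
    moreover have "V = (\<Union>l. Vs l)"
      unfolding x(3) Vs_def lessThan_omega_pow_Suc by (simp add: image_UN image_image)
    moreover have "(recurring Vs, q) \<in> lim_trans A"
      using x(1) unfolding run_between_Suc inf x(4) by auto
    ultimately show ?L
      using x(2) unfolding path.simps tree_of.simps omega_path_def
      by (intro exI[of _ "\<lambda>l. tree_of n (\<lambda>\<beta>. w (?R l + \<beta>))"] conjI refl
          exI[of _ "\<lambda>l. x (?R l)"] exI[of _ Vs]) auto
  qed
qed

section \<open>Presentations by trees\<close>

lemma tree_of_eq_iff: "tree_of n w = tree_of n w' \<longleftrightarrow> (\<forall>\<beta><omega_pow n. w \<beta> = w' \<beta>)"
proof (induction n arbitrary: w w')
  case 0
  have "i < omega_pow 0 \<longleftrightarrow> i = {#}" for i using omega_pow_0 bot_mset by auto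
  then show ?case by simp
next
  case (Suc n)
  have "(\<forall>\<beta><omega_pow (Suc n). w \<beta> = w' \<beta>) \<longleftrightarrow> (\<forall>\<beta>\<in>{..<omega_pow (Suc n)}. w \<beta> = w' \<beta>)" by auto
  also have "\<dots> \<longleftrightarrow> (\<forall>l. \<forall>\<beta><omega_pow n. w (replicate_mset l n + \<beta>) = w' (replicate_mset l n + \<beta>))"
    unfolding lessThan_omega_pow_Suc by blast
  finally show ?case by (simp add: Suc.IH fun_eq_iff)
qed

lemma map_wtree_tree_of: "map_wtree f (tree_of n w) = tree_of n (\<lambda>\<beta>. f (w \<beta>))"
  by (induction n arbitrary: w) (auto simp: fun_eq_iff)

definition tree_language :: "nat \<Rightarrow> ('a, 'q) automaton \<Rightarrow> 'a wtree set" where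
  "tree_language n A = {t. \<exists>V. \<exists>q\<in>final A. path n A (initial A) t V q}"

lemma path_states:
  assumes A: "ordinal_automaton A"
  shows "path n A p t V q \<Longrightarrow> p \<in> V \<and> V \<subseteq> states A \<and> q \<in> states A"
proof (induction n arbitrary: p t V q)
  case 0
  then show ?case using A by (auto simp: ordinal_automaton_def)
next
  case (Suc n)
  then obtain u s Vs where s: "s 0 = p" "V = (\<Union>l. Vs l)" "(recurring Vs, q) \<in> lim_trans A"
      and "\<And>l. path n A (s l) (u l) (Vs l) (s (Suc l))"
    unfolding path.simps omega_path_def by blast
  with Suc.IH have *: "\<And>l. s l \<in> Vs l \<and> Vs l \<subseteq> states A" by blast
  have "p \<in> V" using *[of 0] s(1,2) by blast
  moreover have "V \<subseteq> states A" using * s(2) by blast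
  moreover have "q \<in> states A" using A s(3) unfolding ordinal_automaton_def by blast
  ultimately show ?case by blast
qed

lemma path_of_tree_of:
  assumes "path n A p t V q"
  shows "\<exists>w. t = tree_of n w"
  using assms
proof (induction n arbitrary: p t V q)
  case 0
  then obtain a where "t = Leaf a" by auto
  then show ?case by (intro exI[of _ "\<lambda>_. a"]) simp
next
  case (Suc n)
  then obtain u s Vs where u: "t = Node u" and "\<And>l. path n A (s l) (u l) (Vs l) (s (Suc l))"
    unfolding path.simps omega_path_def by blast
  with Suc.IH have "\<forall>l. \<exists>w. u l = tree_of n w" by blast
  from choice[OF this] obtain ws where ws: "\<And>l. u l = tree_of n (ws l)" by blast
  define w where "w \<beta> = ws (count \<beta> n) (\<beta> - replicate_mset (count \<beta> n) n)" for \<beta>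
  have "u l = tree_of n (\<lambda>\<beta>. w (replicate_mset l n + \<beta>))" for l
    unfolding ws tree_of_eq_iff
  proof (intro allI impI)
    show "ws l \<beta> = w (replicate_mset l n + \<beta>)" if "\<beta> < omega_pow n" for \<beta>
      unfolding w_def count_block[OF that] by simp
  qed
  with u show ?case by auto
qed

lemma language_iff:
  assumes A: "ordinal_automaton A"
  shows "w \<in> language (omega_pow n) A \<longleftrightarrow> w \<in> extensional {..<omega_pow n} \<and> tree_of n w \<in> tree_language n A"
proof -
  have r: "run (omega_pow n) A w x \<longleftrightarrow> run_between n A w x \<and> x {#} = initial A" for x
    by (auto simp: run_def run_between_def bot_mset)
  have a: "w \<beta> \<in> alphabet A" if "run_between n A w x" "\<beta> < omega_pow n" for x \<beta>
    using that A by (fastforce simp: run_between_def ordinal_automaton_def)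
  have "tree_of n w \<in> tree_language n A \<longleftrightarrow>
      (\<exists>x. run_between n A w x \<and> x {#} = initial A \<and> x (omega_pow n) \<in> final A)"
    by (auto simp: tree_language_def path_iff_run[OF A])
  then show ?thesis using a by (auto simp: language_def words_def PiE_def r)
qed

lemma bij_betw_tree_of:
  assumes "ordinal_automaton A"
  shows "bij_betw (tree_of n) (language (omega_pow n) A) (tree_language n A)"
  unfolding bij_betw_def
proof
  show "inj_on (tree_of n) (language (omega_pow n) A)"
    by (auto simp: inj_on_def tree_of_eq_iff language_iff[OF assms] intro: extensionalityI)
  have "t \<in> tree_of n ` language (omega_pow n) A" if t: "t \<in> tree_language n A" for t
  proof -
    obtain w where w: "t = tree_of n w" using t path_of_tree_of[of n A "initial A" t] unfolding tree_language_def by auto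
    have "tree_of n (restrict w {..<omega_pow n}) = t" unfolding w tree_of_eq_iff by simp
    with t show ?thesis
      by (intro image_eqI[of _ _ "restrict w {..<omega_pow n}"]) (auto simp: language_iff[OF assms])
  qed
  then show "tree_of n ` language (omega_pow n) A = tree_language n A" using language_iff[OF assms] by auto
qed

definition unzip :: "nat \<Rightarrow> 'a list wtree \<Rightarrow> 'a wtree list" where
  "unzip k v = map (\<lambda>i. map_wtree (\<lambda>xs. xs ! i) v) [0..<k]"

definition tree_structure ::
  "nat \<Rightarrow> ('a, 'q) automaton \<Rightarrow> (nat \<times> ('a list, 'r) automaton) list \<Rightarrow> 'a wtree rel_structure" where
  "tree_structure n A Bs =
     \<lparr>universe = tree_language n A, relations = map (\<lambda>(k, B). (k, unzip k ` tree_language n B)) Bs\<rparr>"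

text \<open>
  A word over the alphabet of \<open>k\<close>-tuples is the convolution of its \<open>k\<close> tracks.
\<close>

lemma tuple_relation_unzip:
  assumes B: "ordinal_automaton B" "alphabet B = tuples k \<Sigma>"
  shows "map (tree_of n) ` tuple_relation (omega_pow n) \<Sigma> k B = unzip k ` tree_language n B"
proof
  have *: "unzip k (tree_of n (convolution (omega_pow n) ws)) = map (tree_of n) ws" if "length ws = k" for ws
    using that by (auto simp: unzip_def map_wtree_tree_of tree_of_eq_iff convolution_def intro!: nth_equalityI)
  show "map (tree_of n) ` tuple_relation (omega_pow n) \<Sigma> k B \<subseteq> unzip k ` tree_language n B"
  proof safe
    fix ws assume "ws \<in> tuple_relation (omega_pow n) \<Sigma> k B"
    then have "length ws = k" "tree_of n (convolution (omega_pow n) ws) \<in> tree_language n B"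
      by (auto simp: tuple_relation_def tuples_def language_iff[OF B(1)])
    then show "map (tree_of n) ws \<in> unzip k ` tree_language n B"
      by (auto simp: *[symmetric])
  qed
  show "unzip k ` tree_language n B \<subseteq> map (tree_of n) ` tuple_relation (omega_pow n) \<Sigma> k B"
  proof safe
    fix v assume "v \<in> tree_language n B"
    then obtain c where c: "c \<in> language (omega_pow n) B" "v = tree_of n c"
      using bij_betw_tree_of[OF B(1), of n] unfolding bij_betw_def by blast
    define ws where "ws = map (\<lambda>i. \<lambda>\<beta>\<in>{..<omega_pow n}. c \<beta> ! i) [0..<k]"
    have l: "length (c \<beta>) = k" "set (c \<beta>) \<subseteq> \<Sigma>" if "\<beta> < omega_pow n" for \<beta>
      using that c(1) B(2) by (auto simp: language_def words_def tuples_def PiE_def Pi_def)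
    have conv: "convolution (omega_pow n) ws = c"
    proof (rule extensionalityI[of _ "{..<omega_pow n}"])
      show "convolution (omega_pow n) ws \<in> extensional {..<omega_pow n}" by (simp add: convolution_def)
      show "c \<in> extensional {..<omega_pow n}" using c(1) by (simp add: language_def words_def PiE_def)
      fix \<beta> :: "nat multiset" assume "\<beta> \<in> {..<omega_pow n}"
      then show "convolution (omega_pow n) ws \<beta> = c \<beta>"
        using l by (auto simp: convolution_def ws_def intro!: nth_equalityI)
    qed
    have "set ws \<subseteq> words (omega_pow n) \<Sigma>"
    proof -
      have "c \<beta> ! i \<in> \<Sigma>" if "\<beta> < omega_pow n" "i < k" for \<beta> i
        using l[OF that(1)] that(2) nth_mem by blast
      then show ?thesis by (auto simp: ws_def words_def split: if_splits)
    qed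
    then have "ws \<in> tuple_relation (omega_pow n) \<Sigma> k B"
      using conv c(1) by (simp add: tuple_relation_def tuples_def ws_def)
    moreover have "unzip k v = map (tree_of n) ws"
      using *[of ws] conv c(2) by (simp add: ws_def)
    ultimately show "unzip k v \<in> map (tree_of n) ` tuple_relation (omega_pow n) \<Sigma> k B" by auto
  qed
qed

lemma isomorphism_trans:
  assumes "isomorphism f L M" "isomorphism g M N"
  shows "isomorphism (g \<circ> f) L N"
  unfolding isomorphism_def
proof (intro conjI allI impI ballI)
  show "bij_betw (g \<circ> f) (universe L) (universe N)"
    using assms bij_betw_trans unfolding isomorphism_def by blast
  have fst: "map fst (relations L) = map fst (relations M)" "map fst (relations M) = map fst (relations N)"
    using assms by (auto simp: isomorphism_def)
  then show "map fst (relations L) = map fst (relations N)" by simp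
  fix i xs assume i: "i < length (relations L)" and xs: "xs \<in> tuples (fst (relations L ! i)) (universe L)"
  have len: "length (relations M) = length (relations L)" using fst by (metis length_map)
  have "fst (relations L ! i) = fst (relations M ! i)" using fst(1) i len by (metis nth_map)
  then have "map f xs \<in> tuples (fst (relations M ! i)) (universe M)"
    using xs assms(1) by (auto simp: tuples_def isomorphism_def bij_betw_def)
  then show "xs \<in> snd (relations L ! i) \<longleftrightarrow> map (g \<circ> f) xs \<in> snd (relations N ! i)"
    using assms i xs len by (simp add: isomorphism_def)
qed

lemma isomorphism_inv:
  assumes "isomorphism f L M"
  shows "isomorphism (inv_into (universe L) f) M L"
  unfolding isomorphism_def
proof (intro conjI allI impI ballI)
  let ?g = "inv_into (universe L) f"
  have bij: "bij_betw f (universe L) (universe M)" using assms by (simp add: isomorphism_def)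
  then show "bij_betw ?g (universe M) (universe L)" by (rule bij_betw_inv_into)
  show fst: "map fst (relations M) = map fst (relations L)" using assms by (simp add: isomorphism_def)
  fix i xs assume i: "i < length (relations M)" and xs: "xs \<in> tuples (fst (relations M ! i)) (universe M)"
  have len: "length (relations M) = length (relations L)" using fst by (metis length_map)
  have "fst (relations L ! i) = fst (relations M ! i)" using fst i len by (metis nth_map)
  then have "map ?g xs \<in> tuples (fst (relations L ! i)) (universe L)"
    using xs bij by (auto simp: tuples_def bij_betw_def intro!: inv_into_into)
  moreover have "map f (map ?g xs) = xs"
    using xs bij by (auto simp: tuples_def bij_betw_def f_inv_into_f intro!: map_idI)
  ultimately show "xs \<in> snd (relations M ! i) \<longleftrightarrow> map ?g xs \<in> snd (relations L ! i)"
    using assms i len by (auto simp: isomorphism_def)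
qed

context
  fixes n :: nat and A :: "('a, 'q) automaton" and Bs :: "(nat \<times> ('a list, 'q) automaton) list"
  assumes A: "ordinal_automaton A"
    and Bs: "\<forall>(k, B) \<in> set Bs. ordinal_automaton B \<and> alphabet B = tuples k (alphabet A)"
begin

lemma is_structure_tree_structure:
  "is_structure (presented_structure (omega_pow n) A Bs) \<longleftrightarrow> is_structure (tree_structure n A Bs)"
proof -
  have "tuple_relation (omega_pow n) (alphabet A) k B \<subseteq> tuples k (language (omega_pow n) A) \<longleftrightarrow>
    unzip k ` tree_language n B \<subseteq> tuples k (tree_language n A)" if "(k, B) \<in> set Bs" for k B
  proof -
    have B: "ordinal_automaton B" "alphabet B = tuples k (alphabet A)" using that Bs by auto
    have "ws \<in> tuples k (language (omega_pow n) A) \<longleftrightarrow> map (tree_of n) ws \<in> tuples k (tree_language n A)"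
      if "ws \<in> tuple_relation (omega_pow n) (alphabet A) k B" for ws
      using that by (fastforce simp: tuple_relation_def tuples_def language_iff[OF A] words_def PiE_def)
    then show ?thesis unfolding tuple_relation_unzip[OF B, symmetric] by blast
  qed
  then show ?thesis unfolding is_structure_def presented_structure_def tree_structure_def by fastforce
qed

lemma isomorphism_tree_structure:
  "isomorphism (tree_of n) (presented_structure (omega_pow n) A Bs) (tree_structure n A Bs)"
  unfolding isomorphism_def
proof (intro conjI allI impI ballI)
  show "bij_betw (tree_of n) (universe (presented_structure (omega_pow n) A Bs)) (universe (tree_structure n A Bs))"
    using bij_betw_tree_of[OF A] by (simp add: presented_structure_def tree_structure_def)
  show "map fst (relations (presented_structure (omega_pow n) A Bs)) = map fst (relations (tree_structure n A Bs))"
    by (auto simp: presented_structure_def tree_structure_def)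
  fix i xs assume "i < length (relations (presented_structure (omega_pow n) A Bs))"
    and xs: "xs \<in> tuples (fst (relations (presented_structure (omega_pow n) A Bs) ! i))
               (universe (presented_structure (omega_pow n) A Bs))"
  then have i: "i < length Bs" by (simp add: presented_structure_def)
  obtain k B where kB: "Bs ! i = (k, B)" by fastforce
  then have B: "ordinal_automaton B" "alphabet B = tuples k (alphabet A)" using Bs i nth_mem by fastforce+
  have xs: "set xs \<subseteq> extensional {..<omega_pow n}"
    using xs i kB by (auto simp: presented_structure_def tuples_def language_iff[OF A])
  have "xs \<in> tuple_relation (omega_pow n) (alphabet A) k B" 
    if "map (tree_of n) xs \<in> map (tree_of n) ` tuple_relation (omega_pow n) (alphabet A) k B"
  proof -
    from that obtain ys where ys: "ys \<in> tuple_relation (omega_pow n) (alphabet A) k B"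
      "map (tree_of n) xs = map (tree_of n) ys" by blast
    then have "set ys \<subseteq> extensional {..<omega_pow n}"
      by (auto simp: tuple_relation_def tuples_def words_def PiE_def)
    with xs have "inj_on (tree_of n) (set xs \<union> set ys)"
      by (auto simp: inj_on_def tree_of_eq_iff intro!: extensionalityI[of _ "{..<omega_pow n}"])
    with ys have "xs = ys" by (metis inj_on_map_eq_map)
    with ys show ?thesis by simp
  qed
  then show "xs \<in> snd (relations (presented_structure (omega_pow n) A Bs) ! i) \<longleftrightarrow>
    map (tree_of n) xs \<in> snd (relations (tree_structure n A Bs) ! i)"
    using i kB tuple_relation_unzip[OF B, of n, symmetric]
    by (auto simp: presented_structure_def tree_structure_def)
qed

end

lemma INFM_image:
  assumes "finite Q" "\<And>l. Vs l \<subseteq> Q"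
  shows "{r. \<exists>\<^sub>\<infinity>l. r \<in> f ` Vs l} = f ` recurring Vs"
proof -
  have "r \<in> f ` Vs l \<longleftrightarrow> (\<exists>x\<in>Q. f x = r \<and> x \<in> Vs l)" for r l using assms(2) by blast
  then have "(\<exists>\<^sub>\<infinity>l. r \<in> f ` Vs l) \<longleftrightarrow> (\<exists>x\<in>Q. \<exists>\<^sub>\<infinity>l. f x = r \<and> x \<in> Vs l)" for r
    by (simp add: INFM_finite_Bex_distrib[OF assms(1)])
  moreover have "\<exists>\<^sub>\<infinity>l. x \<in> Vs l \<Longrightarrow> x \<in> Q" for x
    using assms(2) INFM_EX[of "\<lambda>l. x \<in> Vs l"] by blast
  ultimately show ?thesis by (auto simp: image_iff)
qed

text \<open>
  As there are finitely many states, the image of the set of recurring states is the set of recurring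
  images; so maps of states that respect transitions carry runs to runs.
\<close>

lemma path_map:
  assumes B: "ordinal_automaton B"
    and succ: "\<And>p a q. (p, a, q) \<in> succ_trans B \<Longrightarrow> (f p, g a, f q) \<in> succ_trans A"
    and lim: "\<And>W q. (W, q) \<in> lim_trans B \<Longrightarrow> (f ` W, f q) \<in> lim_trans A"
  shows "path n B p t V q \<Longrightarrow> path n A (f p) (map_wtree g t) (f ` V) (f q)"
proof (induction n arbitrary: p t V q)
  case 0
  then show ?case using succ by auto
next
  case (Suc n)
  then obtain u s Vs where u: "t = Node u" and s: "s 0 = p" "V = (\<Union>l. Vs l)"
      "(recurring Vs, q) \<in> lim_trans B"
      and *: "\<And>l. path n B (s l) (u l) (Vs l) (s (Suc l))"
    unfolding path.simps omega_path_def by blast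
  have "{r. \<exists>\<^sub>\<infinity>l. r \<in> f ` Vs l} = f ` recurring Vs"
    using path_states[OF B *] B by (intro INFM_image[of "states B"]) (auto simp: ordinal_automaton_def)
  then have "omega_path (path n A) (lim_trans A) (f p) (\<lambda>l. map_wtree g (u l)) (f ` V) (f q)"
    unfolding omega_path_def using lim[OF s(3)] Suc.IH[OF *] s
    by (intro exI[of _ "\<lambda>l. f (s l)"] exI[of _ "\<lambda>l. f ` Vs l"]) auto
  then show ?case using u by (simp add: comp_def)
qed

text \<open>
  This lets automata with structured state sets serve as presentations.
\<close>

lemma rename_states:
  fixes A :: "('a, 'q) automaton"
  assumes A: "ordinal_automaton A"
  obtains A' :: "('a, nat) automaton"
    where "ordinal_automaton A'" "alphabet A' = alphabet A" "\<And>n. tree_language n A' = tree_language n A"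
proof -
  obtain f :: "'q \<Rightarrow> nat" where f: "inj_on f (states A)"
  proof -
    have "finite (states A)" using A by (simp add: ordinal_automaton_def)
    from finite_imp_inj_to_nat_seg[OF this] that show thesis by blast
  qed
  define A' where "A' = \<lparr>alphabet = alphabet A, states = f ` states A, initial = f (initial A),
    succ_trans = (\<lambda>(p, a, q). (f p, a, f q)) ` succ_trans A,
    lim_trans = (\<lambda>(W, q). (f ` W, f q)) ` lim_trans A, final = f ` final A\<rparr>"
  let ?g = "inv_into (states A) f"
  have g: "?g (f q) = q" if "q \<in> states A" for q using f that by simp
  have "succ_trans A' \<subseteq> f ` states A \<times> alphabet A \<times> f ` states A"
    using A unfolding ordinal_automaton_def A'_def by auto
  moreover have "lim_trans A' \<subseteq> Pow (f ` states A) \<times> f ` states A"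
    using A unfolding ordinal_automaton_def A'_def by auto
  moreover have "final A' \<subseteq> f ` states A" using A unfolding ordinal_automaton_def A'_def by auto
  ultimately have A': "ordinal_automaton A'" using A unfolding ordinal_automaton_def by (simp add: A'_def)
  have "t \<in> tree_language n A'" if t: "t \<in> tree_language n A" for n t
  proof -
    obtain V q where q: "q \<in> final A" "path n A (initial A) t V q" using t by (auto simp: tree_language_def)
    have "path n A' (f (initial A)) (map_wtree (\<lambda>x. x) t) (f ` V) (f q)"
    proof (rule path_map[OF A _ _ q(2)])
      show "(f p, a, f q) \<in> succ_trans A'" if "(p, a, q) \<in> succ_trans A" for p a q
        using imageI[OF that, of "\<lambda>(p, a, q). (f p, a, f q)"] by (simp add: A'_def)
      show "(f ` W, f q) \<in> lim_trans A'" if "(W, q) \<in> lim_trans A" for W q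
        using imageI[OF that, of "\<lambda>(W, q). (f ` W, f q)"] by (simp add: A'_def)
    qed
    moreover have "f q \<in> final A'" "initial A' = f (initial A)" using q(1) by (simp_all add: A'_def)
    ultimately show ?thesis unfolding tree_language_def wtree.map_ident by auto
  qed
  moreover have "t \<in> tree_language n A" if t: "t \<in> tree_language n A'" for n t
  proof -
    obtain V q where q: "q \<in> final A'" "path n A' (initial A') t V q" using t by (auto simp: tree_language_def)
    have im: "?g ` f ` W = W" if "W \<subseteq> states A" for W
      using inv_into_image_cancel[OF f that] .
    have "path n A (?g (initial A')) (map_wtree (\<lambda>x. x) t) (?g ` V) (?g q)"
    proof (rule path_map[OF A' _ _ q(2)])
      show "(?g p, a, ?g q) \<in> succ_trans A" if "(p, a, q) \<in> succ_trans A'" for p a q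

      proof -
        from that obtain p' q' where p': "(p', a, q') \<in> succ_trans A" "p = f p'" "q = f q'"
          by (auto simp: A'_def)
        then have "p' \<in> states A" "q' \<in> states A" using A unfolding ordinal_automaton_def by auto
        then show ?thesis using p' g by simp
      qed
      show "(?g ` W, ?g q) \<in> lim_trans A" if "(W, q) \<in> lim_trans A'" for W q
        
      proof -
        from that obtain W' q' where W': "(W', q') \<in> lim_trans A" "W = f ` W'" "q = f q'"
          by (auto simp: A'_def)
        then have "W' \<subseteq> states A" "q' \<in> states A" using A unfolding ordinal_automaton_def by auto
        then show ?thesis using W' im g by simp
      qed
    qed
    moreover have "?g (initial A') = initial A" using A by (simp add: A'_def ordinal_automaton_def g)
    moreover have "?g q \<in> final A"
    proof -
      from q(1) obtain q' where q': "q = f q'" "q' \<in> final A" by (auto simp: A'_def)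
      then have "q' \<in> states A" using A unfolding ordinal_automaton_def by blast
      then show ?thesis using q' g by simp
    qed
    ultimately show ?thesis unfolding tree_language_def wtree.map_ident by auto
  qed
  ultimately have "tree_language n A' = tree_language n A" for n by blast
  then show thesis by (rule that[OF A', rotated]) (simp add: A'_def)
qed

lemma injectively_automaticI:
  fixes A :: "(nat, 'q) automaton" and Bs :: "(nat \<times> (nat list, 'r) automaton) list"
  assumes A: "ordinal_automaton A"
    and Bs: "\<forall>(k, B) \<in> set Bs. ordinal_automaton B \<and> alphabet B = tuples k (alphabet A)"
    and T: "is_structure (tree_structure n A Bs)" "isomorphism h (tree_structure n A Bs) M"
    and M: "is_structure M"
  shows "M \<in> injectively_automatic n"
proof -
  obtain A' :: "(nat, nat) automaton" where
    A': "ordinal_automaton A'" "alphabet A' = alphabet A" "\<And>n. tree_language n A' = tree_language n A"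
    using rename_states[OF A] by blast
  have "\<forall>B. \<exists>B' :: (nat list, nat) automaton. ordinal_automaton B \<longrightarrow>
     ordinal_automaton B' \<and> alphabet B' = alphabet B \<and> (\<forall>n. tree_language n B' = tree_language n B)" for B :: "(nat list, 'r) automaton"
    using rename_states by metis
  then obtain F :: "(nat list, 'r) automaton \<Rightarrow> (nat list, nat) automaton" where
    F: "\<And>B. ordinal_automaton B \<Longrightarrow> ordinal_automaton (F B) \<and> alphabet (F B) = alphabet B \<and> (\<forall>n. tree_language n (F B) = tree_language n B)"
    by metis
  define Bs' where "Bs' = map (\<lambda>(k, B). (k, F B)) Bs"
  have Bs': "\<forall>(k, B) \<in> set Bs'. ordinal_automaton B \<and> alphabet B = tuples k (alphabet A')"
    using Bs F A' by (fastforce simp: Bs'_def)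
  have eq: "tree_structure n A' Bs' = tree_structure n A Bs"
    using A' F Bs by (fastforce simp: tree_structure_def Bs'_def)
  have "is_structure (presented_structure (omega_pow n) A' Bs')"
    using is_structure_tree_structure[OF A'(1) Bs'] T(1) eq by simp
  moreover have "isomorphism (h \<circ> tree_of n) (presented_structure (omega_pow n) A' Bs') M"
    using isomorphism_tree_structure[OF A'(1) Bs'] T(2) eq by (metis isomorphism_trans)
  ultimately show ?thesis unfolding injectively_automatic_def using A'(1) Bs' M by blast
qed

lemma injectively_automaticE:
  assumes "M \<in> injectively_automatic n"
  obtains A :: "(nat, nat) automaton" and Bs :: "(nat \<times> (nat list, nat) automaton) list" and h
  where "ordinal_automaton A"
    "\<forall>(k, B) \<in> set Bs. ordinal_automaton B \<and> alphabet B = tuples k (alphabet A)"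
    "is_structure (tree_structure n A Bs)" "isomorphism h (tree_structure n A Bs) M" "is_structure M"
proof -
  obtain A :: "(nat, nat) automaton" and Bs :: "(nat \<times> (nat list, nat) automaton) list" and h
    where P: "ordinal_automaton A"
      "\<forall>(k, B) \<in> set Bs. ordinal_automaton B \<and> alphabet B = tuples k (alphabet A)"
      "is_structure (presented_structure (omega_pow n) A Bs)"
      "isomorphism h (presented_structure (omega_pow n) A Bs) M" "is_structure M"
    using assms unfolding injectively_automatic_def by blast
  from that[OF P(1,2) _ _ P(5)] is_structure_tree_structure[OF P(1,2)] P(3,4)
    isomorphism_trans[OF isomorphism_inv[OF isomorphism_tree_structure[OF P(1,2)]] P(4)]
  show thesis by blast
qed

section \<open>Stretching words by the factor \<open>\<omega>\<close>\<close>

primrec stretch :: "'a wtree \<Rightarrow> 'a wtree" where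
  "stretch (Leaf a) = Node (\<lambda>_. Leaf a)"
| "stretch (Node u) = Node (\<lambda>l. stretch (u l))"

text \<open>
  At the start of a stretched letter the state is \<open>(p, None)\<close>; inside it is \<open>(q, Some a)\<close>, where \<open>q\<close> is the
  guessed next state of the simulated run and \<open>a\<close> is the repeated letter.  The first kind of limit
  transition ends a stretched letter.  The second kind simulates a limit transition: the recurring states
  of the simulated run are found at the starts of stretched letters.
\<close>

definition stretch_automaton :: "('a, 'q) automaton \<Rightarrow> ('a, 'q \<times> 'a option) automaton" where
  "stretch_automaton A =
     \<lparr>alphabet = alphabet A,
      states = states A \<times> insert None (Some ` alphabet A),
      initial = (initial A, None),
      succ_trans = {((p, None), a, (q, Some a)) | p a q. (p, a, q) \<in> succ_trans A} \<union>
        {((q, Some a), a, (q, Some a)) | q a. q \<in> states A \<and> a \<in> alphabet A},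
      lim_trans = {({(q, Some a)}, (q, None)) | q a. q \<in> states A \<and> a \<in> alphabet A} \<union>
        {(W, (q, None)) | W q. W \<subseteq> states A \<times> insert None (Some ` alphabet A) \<and>
           {r. (r, None) \<in> W} \<noteq> {} \<and> ({r. (r, None) \<in> W}, q) \<in> lim_trans A},
      final = final A \<times> {None}\<rparr>"

lemma stretch_automaton_simps [simp]:
  "alphabet (stretch_automaton A) = alphabet A"
  "initial (stretch_automaton A) = (initial A, None)"
  "final (stretch_automaton A) = final A \<times> {None}"
  by (simp_all add: stretch_automaton_def)

lemma ordinal_automaton_stretch:
  assumes "ordinal_automaton A"
  shows "ordinal_automaton (stretch_automaton A)"
proof -
  have *: "p \<in> states A \<and> a \<in> alphabet A \<and> q \<in> states A" if "(p, a, q) \<in> succ_trans A" for p a q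
    using that assms unfolding ordinal_automaton_def by blast
  have **: "q \<in> states A" if "(W, q) \<in> lim_trans A" for W q
    using that assms unfolding ordinal_automaton_def by blast
  show ?thesis
    unfolding ordinal_automaton_def
  proof (intro conjI)
    show "succ_trans (stretch_automaton A)
      \<subseteq> states (stretch_automaton A) \<times> alphabet (stretch_automaton A) \<times> states (stretch_automaton A)"
      by (auto simp: stretch_automaton_def dest: *)
    show "lim_trans (stretch_automaton A) \<subseteq> Pow (states (stretch_automaton A)) \<times> states (stretch_automaton A)"
      by (auto simp: stretch_automaton_def dest: **)
    show "final (stretch_automaton A) \<subseteq> states (stretch_automaton A)"
      using assms by (auto simp: stretch_automaton_def ordinal_automaton_def)
  qed (use assms in \<open>auto simp: stretch_automaton_def ordinal_automaton_def\<close>)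
qed

text \<open>
  This separates the two kinds of limit transitions of the stretched automaton: at the end of a block of
  blocks some state at a block boundary recurs.
\<close>

lemma INFM_nonempty:
  assumes "finite Q" "\<And>l. Vs l \<subseteq> Q" "\<And>l::nat. Vs l \<noteq> {}"
  shows "\<exists>r\<in>Q. \<exists>\<^sub>\<infinity>l. r \<in> Vs l"
proof -
  have "\<exists>r\<in>Q. r \<in> Vs l" for l using assms(2,3)[of l] by blast
  then have "\<exists>\<^sub>\<infinity>l. \<exists>r\<in>Q. r \<in> Vs l" by (simp add: INFM_nat)
  then show ?thesis using INFM_finite_Bex_distrib[OF assms(1), of "\<lambda>r l. r \<in> Vs l"] by simp
qed

lemma path_stretchI:
  assumes A: "ordinal_automaton A"
  shows "path n A p t V q \<Longrightarrow>
    \<exists>V'. path (Suc n) (stretch_automaton A) (p, None) (stretch t) V' (q, None) \<and> V = {r. (r, None) \<in> V'}"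
proof (induction n arbitrary: p t V q)
  case 0
  then obtain a where a: "t = Leaf a" "(p, a, q) \<in> succ_trans A" "V = {p}" by auto
  have st: "q \<in> states A" "a \<in> alphabet A" using a(2) A unfolding ordinal_automaton_def by auto
  let ?s = "\<lambda>l::nat. if l = 0 then (p, None) else (q, Some a)"
  have "{r. \<exists>\<^sub>\<infinity>l. r \<in> {?s l}} = {(q, Some a)}"
  proof -
    have "(\<exists>\<^sub>\<infinity>l. r \<in> {?s l}) \<longleftrightarrow> r = (q, Some a)" for r
      unfolding INFM_nat by auto
    then show ?thesis by auto
  qed
  then have lim: "({r. \<exists>\<^sub>\<infinity>l. r \<in> {?s l}}, (q, None)) \<in> lim_trans (stretch_automaton A)"
    using st by (auto simp: stretch_automaton_def)
  have "omega_path (path 0 (stretch_automaton A)) (lim_trans (stretch_automaton A)) (p, None) (\<lambda>_. Leaf a)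
     {(p, None), (q, Some a)} (q, None)"
    unfolding omega_path_def
  proof (intro exI[of _ ?s] exI[of _ "\<lambda>l. {?s l}"] conjI allI)
    show "path 0 (stretch_automaton A) (?s l) (Leaf a) {?s l} (?s (Suc l))" for l
      using a st by (auto simp: stretch_automaton_def)
    show "{(p, None), (q, Some a)} = (\<Union>l. {?s l})" by (auto split: if_splits)
  qed (simp, fact lim)
  then show ?case using a by (intro exI[of _ "{(p, None), (q, Some a)}"]) auto
next
  case (Suc n)
  then obtain u s Vs where u: "t = Node u" and s: "s 0 = p" "V = (\<Union>l. Vs l)"
      "(recurring Vs, q) \<in> lim_trans A"
      and *: "\<And>l. path n A (s l) (u l) (Vs l) (s (Suc l))"
    unfolding path.simps omega_path_def by blast
  have "\<forall>l. \<exists>V'. path (Suc n) (stretch_automaton A) (s l, None) (stretch (u l)) V' (s (Suc l), None)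
     \<and> Vs l = {r. (r, None) \<in> V'}"
    using Suc.IH[OF *] by blast
  from choice[OF this] obtain Vs' where Vs':
    "\<And>l. path (Suc n) (stretch_automaton A) (s l, None) (stretch (u l)) (Vs' l) (s (Suc l), None)"
    "\<And>l. Vs l = {r. (r, None) \<in> Vs' l}" by blast
  let ?W = "recurring Vs'"
  have W: "{r. (r, None) \<in> ?W} = recurring Vs" using Vs'(2) by simp
  have ps: "\<And>l. s l \<in> Vs l \<and> Vs l \<subseteq> states A" using path_states[OF A *] by blast
  have ne: "recurring Vs \<noteq> {}"
    using INFM_nonempty[of "states A" Vs] ps A by (auto simp: ordinal_automaton_def)
  have "?W \<subseteq> states A \<times> insert None (Some ` alphabet A)"
    using path_states[OF ordinal_automaton_stretch[OF A] Vs'(1)]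
    by (fastforce simp: stretch_automaton_def dest: INFM_EX)
  then have "(?W, (q, None)) \<in> lim_trans (stretch_automaton A)"
    using W ne s(3) unfolding stretch_automaton_def by auto
  then have "omega_path (path (Suc n) (stretch_automaton A)) (lim_trans (stretch_automaton A)) (p, None)
     (\<lambda>l. stretch (u l)) (\<Union>l. Vs' l) (q, None)"
    unfolding omega_path_def using s(1) Vs'(1)
    by (intro exI[of _ "\<lambda>l. (s l, None)"] exI[of _ Vs']) auto
  then have "path (Suc (Suc n)) (stretch_automaton A) (p, None) (stretch t) (\<Union>l. Vs' l) (q, None)"
    unfolding path.simps(2)[of "Suc n"] u stretch.simps by blast
  moreover have "V = {r. (r, None) \<in> (\<Union>l. Vs' l)}" using s(2) Vs'(2) by auto
  ultimately show ?case by blast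
qed

text \<open>
  No other words are accepted, since inside a stretched letter only that letter can be read.
\<close>

lemma path_stretchD:
  assumes A: "ordinal_automaton A"
  shows "path (Suc n) (stretch_automaton A) (p, None) t' V' q' \<Longrightarrow>
    \<exists>t q. t' = stretch t \<and> q' = (q, None) \<and> path n A p t {r. (r, None) \<in> V'} q"
proof (induction n arbitrary: p t' V' q')
  case 0
  then obtain u s Vs where u: "t' = Node u" and s: "s 0 = (p, None)" "V' = (\<Union>l. Vs l)"
      "(recurring Vs, q') \<in> lim_trans (stretch_automaton A)"
      and *: "\<And>l. path 0 (stretch_automaton A) (s l) (u l) (Vs l) (s (Suc l))"
    unfolding path.simps(2) omega_path_def by blast
  obtain a q where a: "u 0 = Leaf a" "s 1 = (q, Some a)" "(p, a, q) \<in> succ_trans A"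
    using *[of 0] s(1) by (auto simp: stretch_automaton_def)
  have sl: "s (Suc l) = (q, Some a)" for l
  proof (induction l)
    case (Suc l)
    then show ?case using *[of "Suc l"] by (auto simp: stretch_automaton_def)
  qed (use a in simp)
  have ul: "u l = Leaf a" for l
    using a(1) *[of l] sl by (cases l) (auto simp: stretch_automaton_def)
  have Vl: "Vs l = {s l}" for l using *[of l] by auto
  have "recurring Vs = {(q, Some a)}"
  proof -
    have "(\<exists>\<^sub>\<infinity>l. r \<in> Vs l) \<longleftrightarrow> r = (q, Some a)" for r
    proof
      assume "\<exists>\<^sub>\<infinity>l. r \<in> Vs l"
      then obtain l where "l > 0" "r \<in> Vs l" unfolding INFM_nat by blast
      then show "r = (q, Some a)" using Vl sl by (cases l) auto
    next
      assume "r = (q, Some a)"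
      then have "r \<in> Vs (Suc m)" for m using Vl[of "Suc m"] sl[of m] by simp
      then show "\<exists>\<^sub>\<infinity>l. r \<in> Vs l" unfolding INFM_nat by blast
    qed
    then show ?thesis by auto
  qed
  then have "q' = (q, None)" using s(3) by (auto simp: stretch_automaton_def)
  moreover have "V' = {(p, None), (q, Some a)}"
  proof -
    have "V' = range s" using s(2) Vl by auto
    moreover have "range s \<subseteq> {(p, None), (q, Some a)}"
    proof (rule image_subsetI)
      fix l show "s l \<in> {(p, None), (q, Some a)}" using s(1) sl by (cases l) auto
    qed
    moreover have "(p, None) \<in> range s" "(q, Some a) \<in> range s"
      using rangeI[of s 0] rangeI[of s "Suc 0"] s(1) sl[of 0] by simp_all
    ultimately show ?thesis by blast
  qed
  then have "{r. (r, None) \<in> V'} = {p}" by auto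
  ultimately show ?case using a u ul by (intro exI[of _ "Leaf a"] exI[of _ q]) auto
next
  case (Suc n)
  then obtain u s Vs where u: "t' = Node u" and s: "s 0 = (p, None)" "V' = (\<Union>l. Vs l)"
      "(recurring Vs, q') \<in> lim_trans (stretch_automaton A)"
      and *: "\<And>l. path (Suc n) (stretch_automaton A) (s l) (u l) (Vs l) (s (Suc l))"
    unfolding path.simps(2)[of "Suc n"] omega_path_def by blast
  note IH = Suc.IH
  have None: "\<exists>r. s l = (r, None)" for l
  proof (induction l)
    case (Suc l)
    then obtain r where "s l = (r, None)" ..
    then show ?case using IH[of r "u l" "Vs l" "s (Suc l)"] *[of l] by auto
  qed (use s in simp)
  have sf: "s l = (fst (s l), None)" for l
  proof -
    obtain r where "s l = (r, None)" using None[of l] by blast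
    then show ?thesis by simp
  qed
  have "\<exists>t. u l = stretch t \<and> path n A (fst (s l)) t {r. (r, None) \<in> Vs l} (fst (s (Suc l)))" for l
    using Suc.IH[of "fst (s l)" "u l" "Vs l" "s (Suc l)"] *[of l] sf[of l] by auto
  then have "\<forall>l. \<exists>t. u l = stretch t \<and> path n A (fst (s l)) t {r. (r, None) \<in> Vs l} (fst (s (Suc l)))" by blast
  from choice[OF this] obtain v where v: "\<And>l. u l = stretch (v l)"
    "\<And>l. path n A (fst (s l)) (v l) {r. (r, None) \<in> Vs l} (fst (s (Suc l)))" by blast
  have ps: "\<And>l. fst (s l) \<in> {r. (r, None) \<in> Vs l} \<and> {r. (r, None) \<in> Vs l} \<subseteq> states A"
    using path_states[OF A v(2)] by blast
  let ?W = "{r. \<exists>\<^sub>\<infinity>l. r \<in> {r. (r, None) \<in> Vs l}}"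
  have "\<exists>r\<in>states A. \<exists>\<^sub>\<infinity>l. r \<in> {r. (r, None) \<in> Vs l}"
  proof (rule INFM_nonempty)
    show "finite (states A)" using A by (simp add: ordinal_automaton_def)
  qed (use ps in blast)+
  then have ne: "?W \<noteq> {}" by blast
  have W: "{r. (r, None) \<in> recurring Vs} = ?W" by simp
  obtain q where q: "q' = (q, None)" "(?W, q) \<in> lim_trans A"
  proof -
    have "\<not> (\<exists>r a. recurring Vs = {(r, Some a)})" using W ne by auto
    then obtain q where "q' = (q, None)" "({r. (r, None) \<in> recurring Vs}, q) \<in> lim_trans A"
      using s(3) unfolding stretch_automaton_def by auto
    then show thesis using that W by simp
  qed
  have "omega_path (path n A) (lim_trans A) p v {r. (r, None) \<in> V'} q"
    unfolding omega_path_def using v(2) q(2) s(1,2)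
    by (intro exI[of _ "\<lambda>l. fst (s l)"] exI[of _ "\<lambda>l. {r. (r, None) \<in> Vs l}"]) auto
  then have "path (Suc n) A p (Node v) {r. (r, None) \<in> V'} q" by simp
  moreover have "t' = stretch (Node v)" using u v(1) by (simp add: fun_eq_iff)
  ultimately show ?case using q(1) by blast
qed

lemma inj_stretch: "stretch t = stretch t' \<Longrightarrow> t = t'"
proof (induction t arbitrary: t')
  case (Leaf a)
  then show ?case by (cases t') (auto simp: fun_eq_iff, metis stretch.simps wtree.distinct(1) wtree.exhaust)
next
  case (Node u)
  show ?case
  proof (cases t')
    case (Leaf b)
    then have "stretch (u 0) = Leaf b" using Node.prems by (auto simp: fun_eq_iff)
    then show ?thesis by (cases "u 0") auto
  next
    case (Node u')
    then have "stretch (u l) = stretch (u' l)" for l using Node.prems by (auto simp: fun_eq_iff)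
    then show ?thesis using Node Node.IH by auto
  qed
qed

lemma map_wtree_stretch: "map_wtree f (stretch t) = stretch (map_wtree f t)"
  by (induction t) (auto simp: fun_eq_iff)

lemma unzip_stretch: "unzip k (stretch v) = map stretch (unzip k v)"
  by (simp add: unzip_def map_wtree_stretch)

lemma tree_language_stretch:
  assumes A: "ordinal_automaton A"
  shows "tree_language (Suc n) (stretch_automaton A) = stretch ` tree_language n A"
proof
  show "tree_language (Suc n) (stretch_automaton A) \<subseteq> stretch ` tree_language n A"
  proof
    fix t' assume "t' \<in> tree_language (Suc n) (stretch_automaton A)"
    then obtain V' q' where q': "q' \<in> final A \<times> {None}"
      and p: "path (Suc n) (stretch_automaton A) (initial A, None) t' V' q'"
      unfolding tree_language_def by auto
    from path_stretchD[OF A p] q' show "t' \<in> stretch ` tree_language n A" by (auto simp: tree_language_def)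
  qed
  show "stretch ` tree_language n A \<subseteq> tree_language (Suc n) (stretch_automaton A)"
  proof safe
    fix t assume "t \<in> tree_language n A"
    then obtain V q where q: "q \<in> final A" and p: "path n A (initial A) t V q" unfolding tree_language_def by auto
    from path_stretchI[OF A p] q show "stretch t \<in> tree_language (Suc n) (stretch_automaton A)"
      unfolding tree_language_def by fastforce
  qed
qed

lemma is_structure_tree_structure_iff:
  "is_structure (tree_structure n A Bs) \<longleftrightarrow> (\<forall>(k, B) \<in> set Bs. unzip k ` tree_language n B \<subseteq> tuples k (tree_language n A))"
  by (simp add: is_structure_def tree_structure_def case_prod_beta)

lemma injectively_automatic_Suc: "injectively_automatic n \<subseteq> injectively_automatic (Suc n)"
proof
  fix M :: "'m rel_structure" assume "M \<in> injectively_automatic n"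
  then obtain A :: "(nat, nat) automaton" and Bs :: "(nat \<times> (nat list, nat) automaton) list" and h
    where A: "ordinal_automaton A"
    and Bs: "\<forall>(k, B) \<in> set Bs. ordinal_automaton B \<and> alphabet B = tuples k (alphabet A)"
    and S: "is_structure (tree_structure n A Bs)" and h: "isomorphism h (tree_structure n A Bs) M"
    and M: "is_structure M"
    by (rule injectively_automaticE)
  let ?A = "stretch_automaton A"
  let ?Bs = "map (\<lambda>(k, B). (k, stretch_automaton B)) Bs"
  have R: "unzip k ` tree_language (Suc n) (stretch_automaton B) = map stretch ` unzip k ` tree_language n B" if "(k, B) \<in> set Bs" for k B

  proof -
    have "ordinal_automaton B" using Bs that by auto
    then show ?thesis by (simp add: tree_language_stretch image_image unzip_stretch)
  qed
  have Bs': "\<forall>(k, B) \<in> set ?Bs. ordinal_automaton B \<and> alphabet B = tuples k (alphabet ?A)"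
    using Bs by (auto intro!: ordinal_automaton_stretch)
  have S': "is_structure (tree_structure (Suc n) ?A ?Bs)"
  proof -
    have "unzip k ` tree_language (Suc n) (stretch_automaton B) \<subseteq> tuples k (tree_language (Suc n) ?A)" if kB: "(k, B) \<in> set Bs" for k B
    proof -
      have "unzip k ` tree_language n B \<subseteq> tuples k (tree_language n A)"
        using S kB unfolding is_structure_tree_structure_iff by blast
      then show ?thesis unfolding R[OF kB] tree_language_stretch[OF A] tuples_def by fastforce
    qed
    then show ?thesis unfolding is_structure_tree_structure_iff by auto
  qed
  have "isomorphism stretch (tree_structure n A Bs) (tree_structure (Suc n) ?A ?Bs)"
    unfolding isomorphism_def
  proof (intro conjI allI impI ballI)
    show "bij_betw stretch (universe (tree_structure n A Bs)) (universe (tree_structure (Suc n) ?A ?Bs))"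
      by (auto simp: tree_structure_def tree_language_stretch[OF A] bij_betw_def inj_on_def dest: inj_stretch)
    show "map fst (relations (tree_structure n A Bs)) = map fst (relations (tree_structure (Suc n) ?A ?Bs))"
      by (auto simp: tree_structure_def)
    fix i xs assume "i < length (relations (tree_structure n A Bs))"
    then have i: "i < length Bs" by (simp add: tree_structure_def)
    obtain k B where kB: "Bs ! i = (k, B)" by fastforce
    then have "(k, B) \<in> set Bs" using i nth_mem by fastforce
    note R = R[OF this]
    have inj: "inj (map stretch)" by (auto simp: inj_def inj_stretch intro: map_injective injI)
    show "xs \<in> snd (relations (tree_structure n A Bs) ! i) \<longleftrightarrow>
        map stretch xs \<in> snd (relations (tree_structure (Suc n) ?A ?Bs) ! i)"
      using i kB R inj_image_mem_iff[OF inj, of xs "unzip k ` tree_language n B"] by (simp add: tree_structure_def)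
  qed
  then have "isomorphism (h \<circ> inv_into (universe (tree_structure n A Bs)) stretch) (tree_structure (Suc n) ?A ?Bs) M"
    using h isomorphism_inv isomorphism_trans by blast
  then show "M \<in> injectively_automatic (Suc n)"
    using injectively_automaticI[OF ordinal_automaton_stretch[OF A] Bs' S' _ M] by blast
qed

section \<open>Tails of the words in a countable language\<close>

lemma INFM_shift: "(\<exists>\<^sub>\<infinity>l. \<phi> (m + l)) \<longleftrightarrow> (\<exists>\<^sub>\<infinity>l::nat. \<phi> l)"
  unfolding INFM_nat_le
proof safe
  fix k assume "\<forall>k. \<exists>l\<ge>k. \<phi> (m + l)"
  then obtain l where "l \<ge> k" "\<phi> (m + l)" by blast
  then show "\<exists>l\<ge>k. \<phi> l" by (intro exI[of _ "m + l"]) simp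
next
  fix k assume "\<forall>k. \<exists>l\<ge>k. \<phi> l"
  then obtain l where "l \<ge> m + k" "\<phi> l" by blast
  then show "\<exists>l\<ge>k. \<phi> (m + l)" by (intro exI[of _ "l - m"]) simp
qed

text \<open>
  Acceptance depends on recurring states only, so that finitely many blocks can be prepended, cut off or
  exchanged freely.
\<close>

lemma omega_path_prefix:
  assumes run: "\<And>l. l < m \<Longrightarrow> P (s l) (u l) (Vs l) (s (Suc l))" and v: "omega_path P G (s m) v V q"
  shows "\<exists>V'. omega_path P G (s 0) (\<lambda>l. if l < m then u l else v (l - m)) V' q"
proof -
  obtain s' Vs' where s': "s' 0 = s m" "\<And>l. P (s' l) (v l) (Vs' l) (s' (Suc l))"
    "(recurring Vs', q) \<in> G"
    using v unfolding omega_path_def by blast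
  let ?s = "\<lambda>l. if l \<le> m then s l else s' (l - m)"
  let ?Vs = "\<lambda>l. if l < m then Vs l else Vs' (l - m)"
  have "(\<exists>\<^sub>\<infinity>l. r \<in> ?Vs l) \<longleftrightarrow> (\<exists>\<^sub>\<infinity>l. r \<in> Vs' l)" for r
    using INFM_shift[of "\<lambda>l. r \<in> ?Vs l" m] by simp
  then have "(recurring ?Vs, q) \<in> G" using s'(3) by simp
  moreover have "P (?s l) (if l < m then u l else v (l - m)) (?Vs l) (?s (Suc l))" for l
    using run[of l] s'(1) s'(2)[of "l - m"] by (cases "l < m"; cases "l = m") (auto simp: Suc_diff_le)
  ultimately show ?thesis unfolding omega_path_def
    by (intro exI[of _ "\<Union>l. ?Vs l"] exI[of _ ?s] exI[of _ ?Vs]) simp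
qed

lemma omega_path_suffix:
  assumes run: "\<And>l. P (s l) (u l) (Vs l) (s (Suc l))" and q: "(recurring Vs, q) \<in> G"
  shows "\<exists>V. omega_path P G (s m) (\<lambda>l. u (m + l)) V q"
proof -
  have "({r. \<exists>\<^sub>\<infinity>l. r \<in> Vs (m + l)}, q) \<in> G"
    using q INFM_shift[of "\<lambda>l. _ \<in> Vs l" m] by simp
  moreover have "P (s (m + l)) (u (m + l)) (Vs (m + l)) (s (m + Suc l))" for l
    using run[of "m + l"] by simp
  ultimately show ?thesis unfolding omega_path_def
    by (intro exI[of _ "\<Union>l. Vs (m + l)"] exI[of _ "\<lambda>l. s (m + l)"] exI[of _ "\<lambda>l. Vs (m + l)"]) simp
qed

lemma omega_path_update:
  assumes run: "\<And>l. P (s l) (u l) (Vs l) (s (Suc l))" and q: "(recurring Vs, q) \<in> G"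
    and b: "P (s k) b V (s (Suc k))"
  shows "\<exists>V'. omega_path P G (s 0) (u(k := b)) V' q"
proof -
  obtain V' where "omega_path P G (s (Suc k)) (\<lambda>l. u (Suc k + l)) V' q"
    using omega_path_suffix[of P s u Vs q G "Suc k", OF run q] by blast
  moreover have "P (s l) ((u(k := b)) l) ((Vs(k := V)) l) (s (Suc l))" for l
    using run b by simp
  ultimately obtain V'' where "omega_path P G (s 0) (\<lambda>l. if l < Suc k then (u(k := b)) l else u (Suc k + (l - Suc k))) V'' q"
    using omega_path_prefix[of "Suc k" P s "u(k := b)" "Vs(k := V)" G "\<lambda>l. u (Suc k + l)" V' q] by blast
  also have "(\<lambda>l. if l < Suc k then (u(k := b)) l else u (Suc k + (l - Suc k))) = u(k := b)" by auto
  finally show ?thesis by blast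
qed

text \<open>
  Finite paths over an alphabet of blocks, with the set of all states visited in those blocks.
\<close>

primrec fpath :: "('q \<Rightarrow> 'b \<Rightarrow> 'q set \<Rightarrow> 'q \<Rightarrow> bool) \<Rightarrow> 'q \<Rightarrow> 'b list \<Rightarrow> 'q set \<Rightarrow> 'q \<Rightarrow> bool" where
  "fpath P r [] W r' \<longleftrightarrow> W = {} \<and> r = r'"
| "fpath P r (b # g) W r' \<longleftrightarrow> (\<exists>V r1 W'. P r b V r1 \<and> fpath P r1 g W' r' \<and> W = V \<union> W')"

lemma fpath_append:
  "fpath P r g W r1 \<Longrightarrow> fpath P r1 h W' r' \<Longrightarrow> fpath P r (g @ h) (W \<union> W') r'"
proof (induction g arbitrary: r W)
  case (Cons b g)
  then obtain V r2 W2 where "P r b V r2" "fpath P r2 g W2 r1" "W = V \<union> W2" by auto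
  moreover have "fpath P r2 (g @ h) (W2 \<union> W') r'" using Cons calculation by blast
  ultimately show ?case by (auto simp: Un_assoc)
qed simp

lemma fpath_run:
  "fpath P r g W r' \<Longrightarrow> \<exists>s Vs. s 0 = r \<and> s (length g) = r' \<and>
     (\<forall>i<length g. P (s i) (g ! i) (Vs i) (s (Suc i))) \<and> W = (\<Union>i<length g. Vs i)"
proof (induction g arbitrary: r W)
  case (Cons b g)
  then obtain V r1 W' where *: "P r b V r1" "fpath P r1 g W' r'" "W = V \<union> W'" by auto
  from Cons.IH[OF *(2)] obtain s Vs where s: "s 0 = r1" "s (length g) = r'"
    "\<forall>i<length g. P (s i) (g ! i) (Vs i) (s (Suc i))" "W' = (\<Union>i<length g. Vs i)" by blast
  show ?case
  proof (intro exI[of _ "case_nat r s"] exI[of _ "case_nat V Vs"] conjI allI impI)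
    fix i assume "i < length (b # g)"
    then show "P (case_nat r s i) ((b # g) ! i) (case_nat V Vs i) (case_nat r s (Suc i))"
      using s *(1) by (cases i) auto
  next
    have "{..<length (b # g)} = insert 0 (Suc ` {..<length g})" by (simp add: lessThan_Suc_eq_insert_0)
    then show "W = (\<Union>i<length (b # g). case_nat V Vs i)" using s(4) *(3) by simp
  qed (use s in auto)
qed auto

lemma fpath_segment:
  assumes run: "\<And>l. P (s l) (u l) (Vs l) (s (Suc l))"
  shows "m \<le> m' \<Longrightarrow> fpath P (s m) (map u [m..<m']) (\<Union>l\<in>{m..<m'}. Vs l) (s m')"
proof (induction m' rule: dec_induct)
  case (step k)
  have "fpath P (s k) [u k] (Vs k) (s (Suc k))" using run by auto
  from fpath_append[OF step.IH this] step.hyps show ?case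
    by (simp add: atLeastLessThanSuc Un_commute)
qed simp

text \<open>
  The words \<open>c j\<close> are loops that all visit exactly \<open>W\<close>, so that whichever of them are concatenated, the
  recurring states are those in \<open>W\<close>.  The loops have a common length to make positions explicit.
\<close>

lemma omega_path_blocks:
  assumes c: "\<And>j. fpath P r (c j) W r" "\<And>j. length (c j) = L" and L: "L > 0" and q: "(W, q) \<in> G"
  shows "\<exists>V. omega_path P G r (\<lambda>l. c (l div L) ! (l mod L)) V q"
proof -
  have "\<forall>j. \<exists>s Vs. s 0 = r \<and> s L = r \<and> (\<forall>i<L. P (s i) (c j ! i) (Vs i) (s (Suc i))) \<and> W = (\<Union>i<L. Vs i)"
    using fpath_run[OF c(1)] c(2) by simp
  from choice[OF this] obtain s where
    "\<forall>j. \<exists>Vs. s j 0 = r \<and> s j L = r \<and> (\<forall>i<L. P (s j i) (c j ! i) (Vs i) (s j (Suc i))) \<and> W = (\<Union>i<L. Vs i)"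
    by blast
  from choice[OF this] obtain Vs where s: "\<And>j. s j 0 = r" "\<And>j. s j L = r"
    "\<And>i j. i < L \<Longrightarrow> P (s j i) (c j ! i) (Vs j i) (s j (Suc i))" "\<And>j. W = (\<Union>i<L. Vs j i)" by blast
  let ?s = "\<lambda>l. s (l div L) (l mod L)" and ?Vs = "\<lambda>l. Vs (l div L) (l mod L)"
  have step: "?s (Suc l) = s (l div L) (Suc (l mod L))" for l
    using L s(1,2) by (auto simp: mod_Suc div_Suc)
  have "?Vs l \<subseteq> W" for l using s(4)[of "l div L"] L by auto
  then have W1: "\<exists>\<^sub>\<infinity>l. x \<in> ?Vs l \<Longrightarrow> x \<in> W" for x using INFM_EX[of "\<lambda>l. x \<in> ?Vs l"] by blast
  have W2: "\<exists>\<^sub>\<infinity>l. x \<in> ?Vs l" if "x \<in> W" for x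
    unfolding INFM_nat_le
  proof
    fix k
    have "x \<in> (\<Union>i<L. Vs k i)" using that unfolding s(4)[of k] .
    then obtain i where i: "i < L" "x \<in> Vs k i" by blast
    then have "x \<in> ?Vs (k * L + i)" by simp
    moreover have "k * L + i \<ge> k" using L by (simp add: trans_le_add1)
    ultimately show "\<exists>l\<ge>k. x \<in> ?Vs l" by blast
  qed
  have "recurring ?Vs = W" using W1 W2 by blast
  then have "(recurring ?Vs, q) \<in> G" using q by simp
  moreover have "P (?s l) (c (l div L) ! (l mod L)) (?Vs l) (?s (Suc l))" for l
    unfolding step using s(3) L by simp
  moreover have "?s 0 = r" using s(1) by simp
  ultimately show ?thesis unfolding omega_path_def
    by (intro exI[of _ "\<Union>l. ?Vs l"] exI[of _ ?s] exI[of _ ?Vs]) simp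
qed

lemma uncountable_bool_sequences: "uncountable (UNIV :: (nat \<Rightarrow> bool) set)"
proof
  assume "countable (UNIV :: (nat \<Rightarrow> bool) set)"
  then have "range (from_nat_into (UNIV :: (nat \<Rightarrow> bool) set)) = UNIV" by (intro range_from_nat_into) auto
  then obtain k where "(\<lambda>n. \<not> from_nat_into UNIV n n) = from_nat_into UNIV k" by (metis rangeE UNIV_I)
  then have "\<not> from_nat_into UNIV k k \<longleftrightarrow> from_nat_into (UNIV :: (nat \<Rightarrow> bool) set) k k" by metis
  then show False by blast
qed

text \<open>
  Otherwise \<open>g @ h\<close> and \<open>h @ g\<close> are different loops of the same length, and the infinite sequences of them
  yield as many accepted words as there are sequences of bits.
\<close>

lemma loops_commute:
  assumes cnt: "countable {u. \<exists>V. omega_path P G r u V q}" and q: "(W, q) \<in> G"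
    and g: "fpath P r g W r" and h: "fpath P r h W r"
  shows "g @ h = h @ g"
proof (rule ccontr)
  assume ne: "g @ h \<noteq> h @ g"
  define L where "L = length (g @ h)"
  define c where "c b j = (if b j then g @ h else h @ g)" for b :: "nat \<Rightarrow> bool" and j
  define f where "f b = (\<lambda>l. c b (l div L) ! (l mod L))" for b
  have len: "length (c b j) = L" for b j by (simp add: c_def L_def)
  have L: "L > 0" using ne by (auto simp: L_def)
  have loop: "fpath P r (c b j) W r" for b j
    using fpath_append[OF g h] fpath_append[OF h g] by (simp add: c_def)
  have "range f \<subseteq> {u. \<exists>V. omega_path P G r u V q}"
    using omega_path_blocks[of P r _ W L, OF loop len L q] by (auto simp: f_def)
  then have "countable (range f)" using cnt by (rule countable_subset)
  moreover have "inj f"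
  proof (rule injI, rule ext)
    fix b b' j assume eq: "f b = f b'"
    have "\<exists>i<L. (g @ h) ! i \<noteq> (h @ g) ! i"
      using ne by (metis L_def length_append add.commute nth_equalityI)
    then obtain i where i: "i < L" "(g @ h) ! i \<noteq> (h @ g) ! i" by blast
    have "c b j ! i = c b' j ! i" using fun_cong[OF eq, of "j * L + i"] i(1) by (simp add: f_def)
    then show "b j = b' j" using i(2) by (auto simp: c_def split: if_splits)
  qed
  ultimately show False using uncountable_bool_sequences countable_image_inj_eq by blast
qed

text \<open>
  A prefix that is longer than \<open>g\<close> and commutes with \<open>g\<close> starts with \<open>g\<close> and has the period of \<open>g\<close>.
\<close>

lemma periodic_of_commuting_prefixes:
  assumes g: "g \<noteq> []" and comm: "\<And>N. \<exists>m\<ge>N. g @ map v [0..<m] = map v [0..<m] @ g"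
  shows "v l = g ! (l mod length g)"
proof (induction l rule: less_induct)
  case (less l)
  obtain m where m: "m \<ge> Suc l" "g @ map v [0..<m] = map v [0..<m] @ g" using comm by blast
  have "(map v [0..<m] @ g) ! l = v l" using m(1) by (simp add: nth_append)
  then have v: "v l = (g @ map v [0..<m]) ! l" using m(2) by simp
  show ?case
  proof (cases "l < length g")
    case False
    then have "v l = v (l - length g)" using v m(1) by (simp add: nth_append)
    also have "\<dots> = g ! ((l - length g) mod length g)" using False g
      by (intro less) (metis diff_less length_greater_0_conv less_le_trans not_less)
    also have "(l - length g) mod length g = l mod length g" using False by (simp add: le_mod_geq)
    finally show ?thesis .
  qed (use v in \<open>simp add: nth_append\<close>)
qed

lemma countable_omega_paths_suffix:
  assumes run: "\<And>l. P (s l) (u l) (Vs l) (s (Suc l))" and cnt: "countable {u. \<exists>V. omega_path P G (s 0) u V q}"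
  shows "countable {u. \<exists>V. omega_path P G (s m) u V q}"
proof -
  let ?f = "\<lambda>v l. if l < m then u l else v (l - m)"
  have "?f ` {u. \<exists>V. omega_path P G (s m) u V q} \<subseteq> {u. \<exists>V. omega_path P G (s 0) u V q}"
    using omega_path_prefix[of m P s u Vs, OF run] by blast
  then have "countable (?f ` {u. \<exists>V. omega_path P G (s m) u V q})" using cnt by (rule countable_subset)
  moreover have "inj ?f"
  proof (rule injI, rule ext)
    fix v v' l assume "?f v = ?f v'"
    from fun_cong[OF this, of "m + l"] show "v l = v' l" by simp
  qed
  ultimately show ?thesis by (meson countable_image_inj_on inj_on_subset subset_UNIV)
qed

text \<open>
  An accepting run eventually visits only its recurring states \<open>W\<close>, and it returns to some state \<open>r\<close>
  infinitely often.  From then on its prefixes contain arbitrarily long loops at \<open>r\<close> visiting exactly \<open>W\<close>;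
  these commute with a fixed such loop, whose iteration is therefore the tail.  One loop for each pair
  \<open>(r, W)\<close> and its finitely many rotations give all tails.
\<close>

lemma omega_tails:
  fixes P :: "'q \<Rightarrow> 'b \<Rightarrow> 'q set \<Rightarrow> 'q \<Rightarrow> bool"
  assumes fin: "finite Q" and P: "\<And>p b V q. P p b V q \<Longrightarrow> p \<in> Q \<and> V \<subseteq> Q"
  shows "\<exists>T. finite T \<and> (\<forall>t\<in>T. (\<lambda>l. t (Suc l)) \<in> T) \<and>
    (\<forall>p q u V. countable {u. \<exists>V. omega_path P G p u V q} \<longrightarrow> omega_path P G p u V q \<longrightarrow>
       (\<exists>m. (\<lambda>l. u (m + l)) \<in> T))"
proof -
  define gen where "gen x = (SOME g. g \<noteq> [] \<and> fpath P (fst x) g (snd x) (fst x))" for x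
  define X where "X = {x \<in> Q \<times> Pow Q. \<exists>g. g \<noteq> [] \<and> fpath P (fst x) g (snd x) (fst x)}"
  define per where "per x m = (\<lambda>l. gen x ! ((m + l) mod length (gen x)))" for x m
  define T where "T = (\<Union>x\<in>X. range (per x))"
  have gen: "gen x \<noteq> [] \<and> fpath P (fst x) (gen x) (snd x) (fst x)" if "x \<in> X" for x
    using that someI_ex[of "\<lambda>g. g \<noteq> [] \<and> fpath P (fst x) g (snd x) (fst x)"] by (auto simp: X_def gen_def)
  have "range (per x) \<subseteq> per x ` {..<length (gen x)}" if "x \<in> X" for x
  proof (rule image_subsetI)
    fix m
    have "per x m = per x (m mod length (gen x))" by (simp add: per_def mod_add_left_eq)
    then show "per x m \<in> per x ` {..<length (gen x)}" using gen[OF that] by (intro image_eqI) auto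
  qed
  then have "finite (range (per x))" if "x \<in> X" for x using that by (meson finite_imageI finite_lessThan finite_subset)
  moreover have "finite X" using fin by (auto simp: X_def intro!: finite_subset[of _ "Q \<times> Pow Q"])
  ultimately have "finite T" by (auto simp: T_def)
  moreover have "\<forall>t\<in>T. (\<lambda>l. t (Suc l)) \<in> T"
  proof
    fix t assume "t \<in> T"
    then obtain x m where x: "x \<in> X" "t = per x m" by (auto simp: T_def)
    then have "(\<lambda>l. t (Suc l)) = per x (Suc m)" by (simp add: per_def)
    then show "(\<lambda>l. t (Suc l)) \<in> T" using x(1) by (auto simp: T_def)
  qed
  moreover have "\<exists>m. (\<lambda>l. u (m + l)) \<in> T"
    if cnt: "countable {u. \<exists>V. omega_path P G p u V q}" and u: "omega_path P G p u V q" for p q u V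
  proof -
    obtain s Vs where s: "s 0 = p" "\<And>l. P (s l) (u l) (Vs l) (s (Suc l))"
      and q: "(recurring Vs, q) \<in> G"
      using u unfolding omega_path_def by blast
    let ?W = "recurring Vs"
    have VQ: "Vs l \<subseteq> Q" "s l \<in> Q" for l using P[OF s(2)[of l]] by auto
    have WQ: "?W \<subseteq> Q" using VQ(1) INFM_EX[of "\<lambda>l. _ \<in> Vs l"] by blast
    have "\<exists>r\<in>Q. \<exists>\<^sub>\<infinity>l. r \<in> {s l}" by (rule INFM_nonempty[OF fin]) (use VQ in auto)
    then obtain r where r: "r \<in> Q" "\<exists>\<^sub>\<infinity>l. r \<in> {s l}" by blast
    have r2: "\<exists>m\<ge>k. s m = r" for k using r(2) unfolding INFM_nat_le by auto
    have "finite (Q - ?W)" using fin by simp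
    moreover have "\<forall>x\<in>Q - ?W. \<exists>m. \<forall>l\<ge>m. x \<notin> Vs l" by (auto simp: INFM_nat_le)
    ultimately have "\<exists>m. \<forall>x\<in>Q - ?W. \<forall>l\<ge>m. x \<notin> Vs l"
    proof (induction rule: finite_induct)
      case (insert x F)
      then obtain m m' where "\<forall>x\<in>F. \<forall>l\<ge>m. x \<notin> Vs l" "\<forall>l\<ge>m'. x \<notin> Vs l" by auto
      then show ?case by (intro exI[of _ "max m m'"]) auto
    qed simp
    then obtain m1 where m1: "\<And>l. l \<ge> m1 \<Longrightarrow> Vs l \<subseteq> ?W" using VQ by blast
    obtain m where m: "m \<ge> m1" "s m = r" using r2 by blast
    have loop: "\<exists>m'\<ge>N. m' > m \<and> fpath P r (map u [m..<m']) ?W r" for N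
    proof -
      have "finite ?W" using WQ fin by (rule finite_subset)
      moreover have "\<forall>x\<in>?W. \<exists>l\<ge>m. x \<in> Vs l" by (auto simp: INFM_nat_le)
      ultimately have "\<exists>k. \<forall>x\<in>?W. \<exists>l\<in>{m..<k}. x \<in> Vs l"
      proof (induction rule: finite_induct)
        case (insert x F)
        then obtain k l where k: "\<forall>x\<in>F. \<exists>l\<in>{m..<k}. x \<in> Vs l" "l \<ge> m" "x \<in> Vs l" by auto
        then show ?case by (intro exI[of _ "max k (Suc l)"]) fastforce
      qed simp
      then obtain k where k: "\<And>x. x \<in> ?W \<Longrightarrow> \<exists>l\<in>{m..<k}. x \<in> Vs l" by blast
      obtain m' where m': "m' \<ge> N + k + Suc m" "s m' = r" using r2 by blast
      have "(\<Union>l\<in>{m..<m'}. Vs l) = ?W"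
      proof
        show "(\<Union>l\<in>{m..<m'}. Vs l) \<subseteq> ?W" using m1 m(1) by (meson UN_least atLeastLessThan_iff order_trans)
        show "?W \<subseteq> (\<Union>l\<in>{m..<m'}. Vs l)"
        proof
          fix x assume "x \<in> ?W"
          from k[OF this] obtain l where "l \<in> {m..<k}" "x \<in> Vs l" by blast
          then show "x \<in> (\<Union>l\<in>{m..<m'}. Vs l)" using m'(1) by (intro UN_I[of l]) auto
        qed
      qed
      then have "fpath P r (map u [m..<m']) ?W r"
        using fpath_segment[of P s u Vs m m', OF s(2)] m m' by simp
      then show ?thesis using m' by (intro exI[of _ m']) simp
    qed
    have x: "(r, ?W) \<in> X"
    proof -
      obtain m' where m': "m' > m" "fpath P r (map u [m..<m']) ?W r" using loop[of 0] by blast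
      then have "map u [m..<m'] \<noteq> []" by simp
      then show ?thesis using m'(2) r(1) WQ unfolding X_def by (intro CollectI conjI SigmaI PowI exI) auto
    qed
    let ?g = "gen (r, ?W)"
    have g: "?g \<noteq> []" "fpath P r ?g ?W r" using gen[OF x] by auto
    have cnt': "countable {u. \<exists>V. omega_path P G r u V q}"
      using countable_omega_paths_suffix[of P s u Vs G q m, OF s(2)] cnt s(1) m(2) by simp
    have seg: "map u [m..<m'] = map (\<lambda>l. u (m + l)) [0..<m' - m]" for m'
      by (rule nth_equalityI) auto
    have "\<exists>k\<ge>N. ?g @ map (\<lambda>l. u (m + l)) [0..<k] = map (\<lambda>l. u (m + l)) [0..<k] @ ?g" for N
    proof -
      obtain m' where m': "m' \<ge> N + m" "fpath P r (map u [m..<m']) ?W r" using loop[of "N + m"] by blast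
      have "?g @ map u [m..<m'] = map u [m..<m'] @ ?g"
        by (rule loops_commute[OF cnt' q g(2) m'(2)])
      then show ?thesis using m'(1) unfolding seg by (intro exI[of _ "m' - m"]) simp
    qed
    from periodic_of_commuting_prefixes[OF g(1) this]
    have "(\<lambda>l. u (m + l)) = per (r, ?W) 0" by (auto simp: per_def)
    then show ?thesis using x by (auto simp: T_def)
  qed
  ultimately show ?thesis by blast
qed

section \<open>Sizes of words\<close>

lemma uniform_bound:
  assumes "finite X" and "\<And>x. x \<in> X \<Longrightarrow> \<exists>c. Q x c" and "\<And>x c c'. Q x c \<Longrightarrow> c \<le> c' \<Longrightarrow> Q x c'"
  shows "\<exists>c::nat. \<forall>x\<in>X. Q x c"
  using assms(1,2)
proof (induction rule: finite_induct)
  case (insert x F)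
  obtain c where 1: "\<forall>x\<in>F. Q x c" using insert.IH insert.prems by blast
  obtain c' where "Q x c'" using insert.prems by blast
  note c = 1 this
  have "Q y (max c c')" if "y \<in> insert x F" for y
    using that c assms(3)[of y c "max c c'"] assms(3)[of y c' "max c c'"] by auto
  then show ?case by blast
qed simp

text \<open>
  A word is thin if it has a path between two states that are joined by countably many words only.  In
  contrast to membership in a countable language, this is inherited by blocks and by final segments.
\<close>

definition thin :: "nat \<Rightarrow> ('a, 'q) automaton \<Rightarrow> 'a wtree \<Rightarrow> bool" where
  "thin n A t \<longleftrightarrow> (\<exists>p q V. path n A p t V q \<and> countable {t. \<exists>V. path n A p t V q})"

lemma countable_Node_paths:
  "countable {t. \<exists>V. path (Suc n) A p t V q} \<longleftrightarrow>
   countable {u. \<exists>V. omega_path (path n A) (lim_trans A) p u V q}"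
proof -
  have "{t. \<exists>V. path (Suc n) A p t V q} = Node ` {u. \<exists>V. omega_path (path n A) (lim_trans A) p u V q}"
    by auto
  then show ?thesis by (simp add: countable_image_inj_eq inj_on_def)
qed

lemma thin_NodeE:
  assumes "thin (Suc n) A (Node u)"
  obtains s Vs q where "\<And>l. path n A (s l) (u l) (Vs l) (s (Suc l))"
    "(recurring Vs, q) \<in> lim_trans A"
    "countable {u. \<exists>V. omega_path (path n A) (lim_trans A) (s 0) u V q}"
proof -
  obtain p q V where *: "path (Suc n) A p (Node u) V q" "countable {t. \<exists>V. path (Suc n) A p t V q}"
    using assms unfolding thin_def by blast
  have "omega_path (path n A) (lim_trans A) p u V q" using *(1) by simp
  then obtain s Vs where s: "s 0 = p" "\<And>l. path n A (s l) (u l) (Vs l) (s (Suc l))"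
    "(recurring Vs, q) \<in> lim_trans A"
    unfolding omega_path_def by blast
  show thesis using that[OF s(2,3)] *(2) s(1) unfolding countable_Node_paths by blast
qed

lemma thin_block:
  assumes "thin (Suc n) A (Node u)"
  shows "thin n A (u l)"
proof -
  obtain s Vs q where s: "\<And>l. path n A (s l) (u l) (Vs l) (s (Suc l))"
    "(recurring Vs, q) \<in> lim_trans A"
    and cnt: "countable {u. \<exists>V. omega_path (path n A) (lim_trans A) (s 0) u V q}"
    using thin_NodeE[OF assms] by blast
  let ?X = "{b. \<exists>V. path n A (s l) b V (s (Suc l))}"
  have "(\<lambda>b. u(l := b)) ` ?X \<subseteq> {u. \<exists>V. omega_path (path n A) (lim_trans A) (s 0) u V q}"
    using omega_path_update[of "path n A" s u Vs q "lim_trans A" l, OF s] by blast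
  then have "countable ((\<lambda>b. u(l := b)) ` ?X)" using cnt by (rule countable_subset)
  moreover have "inj (\<lambda>b. u(l := b))" by (rule injI) (metis fun_upd_same)
  ultimately have "countable ?X" by (meson countable_image_inj_on inj_on_subset subset_UNIV)
  then show ?thesis using s(1)[of l] unfolding thin_def by blast
qed

lemma thin_tail:
  assumes "thin (Suc n) A (Node u)"
  shows "thin (Suc n) A (Node (\<lambda>l. u (m + l)))"
proof -
  obtain s Vs q where s: "\<And>l. path n A (s l) (u l) (Vs l) (s (Suc l))"
    "(recurring Vs, q) \<in> lim_trans A"
    and cnt: "countable {u. \<exists>V. omega_path (path n A) (lim_trans A) (s 0) u V q}"
    using thin_NodeE[OF assms] by blast
  have "countable {t. \<exists>V. path (Suc n) A (s m) t V q}"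
    unfolding countable_Node_paths
    using countable_omega_paths_suffix[of "path n A" s u Vs "lim_trans A" q m, OF s(1) cnt] .
  moreover obtain V where "omega_path (path n A) (lim_trans A) (s m) (\<lambda>l. u (m + l)) V q"
    using omega_path_suffix[of "path n A" s u Vs q "lim_trans A" m, OF s] by blast
  then have "path (Suc n) A (s m) (Node (\<lambda>l. u (m + l))) V q" by simp
  ultimately show ?thesis unfolding thin_def by blast
qed

text \<open>
  The tails at level \<open>n + 1\<close> are the members of \<open>T n\<close>, so that these are sequences of words of length \<open>\<omega>\<^sup>n\<close>.
\<close>

definition tail_family :: "('a, 'q) automaton \<Rightarrow> (nat \<Rightarrow> (nat \<Rightarrow> 'a wtree) set) \<Rightarrow> bool" where
  "tail_family A T \<longleftrightarrow> (\<forall>n. finite (T n) \<and> (\<forall>t\<in>T n. (\<lambda>l. t (Suc l)) \<in> T n) \<and>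
     (\<forall>u. thin (Suc n) A (Node u) \<longrightarrow> (\<exists>m. (\<lambda>l. u (m + l)) \<in> T n)))"

lemma tail_family_exists:
  fixes A :: "('a, 'q) automaton"
  assumes A: "ordinal_automaton A"
  shows "\<exists>T. tail_family A T"
proof -
  have "\<forall>n. \<exists>T. finite T \<and> (\<forall>t\<in>T. (\<lambda>l. t (Suc l)) \<in> T) \<and>
      (\<forall>u. thin (Suc n) A (Node u) \<longrightarrow> (\<exists>m. (\<lambda>l. u (m + l)) \<in> T))"
  proof
    fix n
    have fin: "finite (states A)" using A by (simp add: ordinal_automaton_def)
    have P: "p \<in> states A \<and> V \<subseteq> states A" if "path n A p b V q" for p b V q
      using path_states[OF A that] by blast
    have "\<exists>T. finite T \<and> (\<forall>t\<in>T. (\<lambda>l. t (Suc l)) \<in> T) \<and>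
      (\<forall>p q u V. countable {u. \<exists>V. omega_path (path n A) (lim_trans A) p u V q} \<longrightarrow>
        omega_path (path n A) (lim_trans A) p u V q \<longrightarrow> (\<exists>m. (\<lambda>l. u (m + l)) \<in> T))"
      by (rule omega_tails[OF fin]) (rule P)
    then obtain T where T: "finite T" "\<forall>t\<in>T. (\<lambda>l. t (Suc l)) \<in> T"
      and tail: "\<forall>p q u V. countable {u. \<exists>V. omega_path (path n A) (lim_trans A) p u V q} \<longrightarrow>
        omega_path (path n A) (lim_trans A) p u V q \<longrightarrow> (\<exists>m. (\<lambda>l. u (m + l)) \<in> T)"
      by (elim exE conjE)
    have "\<exists>m. (\<lambda>l. u (m + l)) \<in> T" if th: "thin (Suc n) A (Node u)" for u
    proof -
      obtain p q V where *: "path (Suc n) A p (Node u) V q" "countable {t. \<exists>V. path (Suc n) A p t V q}"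
        using th unfolding thin_def by blast
      then have "omega_path (path n A) (lim_trans A) p u V q"
        "countable {u. \<exists>V. omega_path (path n A) (lim_trans A) p u V q}"
        unfolding countable_Node_paths by simp_all
      then show ?thesis using tail by blast
    qed
    then show "\<exists>T. finite T \<and> (\<forall>t\<in>T. (\<lambda>l. t (Suc l)) \<in> T) \<and>
      (\<forall>u. thin (Suc n) A (Node u) \<longrightarrow> (\<exists>m. (\<lambda>l. u (m + l)) \<in> T))" using T by blast
  qed
  from choice[OF this] show ?thesis unfolding tail_family_def by blast
qed

text \<open>
  The size bound \<open>m\<close> constrains the blocks at all levels and, in particular, also the blocks that belong to
  the tail.  This makes the notion monotone in \<open>m\<close>.
\<close>

primrec small :: "(nat \<Rightarrow> (nat \<Rightarrow> 'a wtree) set) \<Rightarrow> 'a set \<Rightarrow> nat \<Rightarrow> nat \<Rightarrow> 'a wtree \<Rightarrow> bool" where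
  "small T S 0 = (\<lambda>m t. t \<in> Leaf ` S)"
| "small T S (Suc n) = (\<lambda>m t. \<exists>u. t = Node u \<and> (\<lambda>l. u (m + l)) \<in> T n \<and> (\<forall>l. small T S n m (u l)))"

context
  fixes A :: "('a, 'q) automaton" and T
  assumes A: "ordinal_automaton A" and T: "tail_family A T"
begin

lemma finite_tails: "finite (T n)"
  using T by (simp add: tail_family_def)

lemma tails_Suc: "t \<in> T n \<Longrightarrow> (\<lambda>l. t (Suc l)) \<in> T n"
  using T by (simp add: tail_family_def)

lemma tails_reached: "thin (Suc n) A (Node u) \<Longrightarrow> \<exists>m. (\<lambda>l. u (m + l)) \<in> T n"
  using T by (simp add: tail_family_def)

lemma tails_shift: "t \<in> T n \<Longrightarrow> (\<lambda>l. t (m + l)) \<in> T n"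
proof (induction m)
  case (Suc m)
  then have "(\<lambda>l. t (m + l)) \<in> T n" by simp
  from tails_Suc[OF this] show ?case by simp
qed simp

lemma tails_shift_le: "(\<lambda>l. u (m + l)) \<in> T n \<Longrightarrow> m \<le> m' \<Longrightarrow> (\<lambda>l. u (m' + l)) \<in> T n"
proof -
  assume *: "(\<lambda>l. u (m + l)) \<in> T n" "m \<le> m'"
  from tails_shift[OF *(1), of "m' - m"] *(2) show ?thesis by (simp add: add.assoc[symmetric])
qed

lemma small_mono: "small T S n m t \<Longrightarrow> m \<le> m' \<Longrightarrow> small T S n m' t"
proof (induction n arbitrary: t)
  case (Suc n)
  then obtain u where u: "t = Node u" "(\<lambda>l. u (m + l)) \<in> T n" "\<forall>l. small T S n m (u l)" by auto
  have "small T S n m' (u l)" for l using Suc.IH u(3) Suc.prems(2) by blast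
  moreover have "(\<lambda>l. u (m' + l)) \<in> T n" using u(2) Suc.prems(2) by (rule tails_shift_le)
  ultimately show ?case using u(1) by simp
qed simp

text \<open>
  Only finitely many different blocks occur in a thin word, as the blocks of its tail recur; hence their
  sizes have a common bound.
\<close>

lemma thin_small: "thin n A t \<Longrightarrow> \<exists>m. small T (alphabet A) n m t"
proof (induction n arbitrary: t)
  case 0
  then obtain p a q where "t = Leaf a" "(p, a, q) \<in> succ_trans A" by (auto simp: thin_def)
  moreover from this(2) have "a \<in> alphabet A" using A unfolding ordinal_automaton_def by blast
  ultimately show ?case by simp
next
  case (Suc n)
  then obtain u where u: "t = Node u" by (auto simp: thin_def)
  have th: "thin (Suc n) A (Node u)" using Suc.prems u by simp
  then obtain m where m: "(\<lambda>l. u (m + l)) \<in> T n" using tails_reached[OF th] by blast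
  have "range u \<subseteq> u ` {..<m} \<union> (\<lambda>t. t 0) ` T n"
  proof (rule image_subsetI)
    fix l
    show "u l \<in> u ` {..<m} \<union> (\<lambda>t. t 0) ` T n"
    proof (cases "l < m")
      case False
      then have "(\<lambda>j. u (l + j)) \<in> T n" using tails_shift_le[OF m, of l] by simp
      then have "(\<lambda>t. t 0) (\<lambda>j. u (l + j)) \<in> (\<lambda>t. t 0) ` T n" by (rule imageI)
      then show ?thesis by simp
    qed simp
  qed
  then have "finite (range u)" by (rule finite_subset) (simp add: finite_tails)
  moreover have "\<exists>m. small T (alphabet A) n m b" if "b \<in> range u" for b
    using that thin_block[OF th] Suc.IH by auto
  ultimately obtain c where c: "\<forall>b\<in>range u. small T (alphabet A) n c b"
    using uniform_bound[of "range u" "\<lambda>b m. small T (alphabet A) n m b"] small_mono by blast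
  have "small T (alphabet A) (Suc n) (max m c) t"
    using u c tails_shift_le[OF m, of "max m c"] small_mono[of "alphabet A" n c _ "max m c"] by auto
  then show ?case by blast
qed

text \<open>
  A word is determined by its first \<open>m\<close> blocks and its tail, so the number of small words at level \<open>n + 1\<close>
  is at most the \<open>m\<close>-th power of that at level \<open>n\<close>, times a constant.
\<close>

lemma card_small:
  assumes S: "finite S"
  shows "\<exists>K. \<forall>m. finite {t. small T S n m t} \<and> card {t. small T S n m t} \<le> K ^ ((m + 1) ^ n)"
proof (induction n)
  case 0
  have "{t. small T S 0 m t} = Leaf ` S" for m by auto
  then show ?case using S by (intro exI[of _ "card S"]) (simp add: card_image_le)
next
  case (Suc n)
  then obtain K where K: "\<And>m. finite {t. small T S n m t}" "\<And>m. card {t. small T S n m t} \<le> K ^ ((m + 1) ^ n)"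
    by blast
  let ?K = "max 1 (max K (card (T n)))"
  have "finite {t. small T S (Suc n) m t} \<and> card {t. small T S (Suc n) m t} \<le> ?K ^ ((m + 1) ^ Suc n)" for m
  proof -
    let ?L = "{bs. set bs \<subseteq> {t. small T S n m t} \<and> length bs = m}"
    let ?code = "\<lambda>t. case t of Node u \<Rightarrow> (map u [0..<m], \<lambda>l. u (m + l))"
    have finL: "finite (?L \<times> T n)" using finite_lists_length_eq[OF K(1)] finite_tails by simp
    have sub: "?code ` {t. small T S (Suc n) m t} \<subseteq> ?L \<times> T n" by auto
    have inj: "inj_on ?code {t. small T S (Suc n) m t}"
    proof (rule inj_onI)
      fix t t' assume "t \<in> {t. small T S (Suc n) m t}" "t' \<in> {t. small T S (Suc n) m t}"
        and eq: "?code t = ?code t'"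
      then obtain u u' where u: "t = Node u" "t' = Node u'" by auto
      have "u l = u' l" for l
      proof (cases "l < m")
        case True
        then show ?thesis using eq u by simp
      next
        case False
        have "(\<lambda>l. u (m + l)) = (\<lambda>l. u' (m + l))" using eq u by simp
        from fun_cong[OF this, of "l - m"] False show ?thesis by simp
      qed
      then show "t = t'" using u by auto
    qed
    have "card {t. small T S (Suc n) m t} \<le> card (?L \<times> T n)"
      using card_inj_on_le[OF inj sub finL] .
    also have "\<dots> = card {t. small T S n m t} ^ m * card (T n)"
      by (simp add: card_cartesian_product card_lists_length_eq[OF K(1)])
    also have "\<dots> \<le> (?K ^ ((m + 1) ^ n)) ^ m * ?K ^ 1"
    proof (intro mult_mono power_mono)
      have "K ^ ((m + 1) ^ n) \<le> ?K ^ ((m + 1) ^ n)" by (intro power_mono) auto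
      with K(2)[of m] show "card {t. small T S n m t} \<le> ?K ^ ((m + 1) ^ n)" by linarith
    qed auto
    also have "\<dots> = ?K ^ ((m + 1) ^ n * m + 1)" by (simp add: power_mult power_add)
    also have "\<dots> \<le> ?K ^ ((m + 1) ^ Suc n)"
    proof (rule power_increasing)
      have "1 \<le> (m + 1) ^ n" by simp
      then show "(m + 1) ^ n * m + 1 \<le> (m + 1) ^ Suc n" by (simp add: algebra_simps)
    qed simp
    finally show ?thesis using finite_imageD[OF finite_subset[OF sub finL] inj] by simp
  qed
  then show ?case by blast
qed

context
  fixes B :: "('a list, 'r) automaton" and k :: nat
  assumes B: "ordinal_automaton B"
begin

abbreviation track :: "nat \<Rightarrow> 'a list wtree \<Rightarrow> 'a wtree" where
  "track i \<equiv> map_wtree (\<lambda>xs. xs ! i)"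

text \<open>
  Track \<open>k\<close> of a word is regarded as the value of a function of the tracks \<open>0, \<dots>, k - 1\<close>.  This is the
  property of a functional relation that is local: it passes from the initial and final states of an
  automaton to the states at the block boundaries of its runs.
\<close>

definition nice :: "nat \<Rightarrow> 'r \<Rightarrow> 'r \<Rightarrow> bool" where
  "nice n p q \<longleftrightarrow>
     (\<forall>v V. path n B p v V q \<longrightarrow> thin n A (track k v)) \<and>
     (\<forall>v V v' V'. path n B p v V q \<longrightarrow> path n B p v' V' q \<longrightarrow>
        (\<forall>i<k. track i v = track i v') \<longrightarrow> track k v = track k v')"

lemma niceD:
  assumes "nice n p q" "path n B p v V q"
  shows "thin n A (track k v)"
    "path n B p v' V' q \<Longrightarrow> (\<And>i. i < k \<Longrightarrow> track i v = track i v') \<Longrightarrow> track k v = track k v'"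
  using assms unfolding nice_def by blast+

text \<open>
  Exchanging one block of an accepted word gives an accepted word.
\<close>

lemma nice_block:
  assumes nice: "nice (Suc n) (s 0) q"
    and run: "\<And>l. path n B (s l) (w l) (Vs l) (s (Suc l))" "(recurring Vs, q) \<in> lim_trans B"
  shows "nice n (s l) (s (Suc l))"
  unfolding nice_def
proof (intro conjI allI impI)
  have upd: "\<exists>V'. path (Suc n) B (s 0) (Node (w(l := b))) V' q" if "path n B (s l) b V (s (Suc l))" for b V
    using omega_path_update[of "path n B" s w Vs q "lim_trans B" l b V, OF run that] by simp
  have tr: "track i (Node (w(l := b))) = Node ((\<lambda>j. track i (w j))(l := track i b))" for i b
    by (auto simp: fun_eq_iff)
  fix b V assume b: "path n B (s l) b V (s (Suc l))"
  obtain V1 where p1: "path (Suc n) B (s 0) (Node (w(l := b))) V1 q" using upd[OF b] by blast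
  show "thin n A (track k b)"
    using thin_block[of n A "(\<lambda>j. track k (w j))(l := track k b)" l] niceD(1)[OF nice p1]
    unfolding tr by simp
  fix b' V' assume b': "path n B (s l) b' V' (s (Suc l))" and eq: "\<forall>i<k. track i b = track i b'"
  obtain V2 where p2: "path (Suc n) B (s 0) (Node (w(l := b'))) V2 q" using upd[OF b'] by blast
  have "track k (Node (w(l := b))) = track k (Node (w(l := b')))"
    using niceD(2)[OF nice p1 p2] eq unfolding tr by simp
  then have "(\<lambda>j. track k (w j))(l := track k b) = (\<lambda>j. track k (w j))(l := track k b')"
    unfolding tr by simp
  from fun_cong[OF this, of l] show "track k b = track k b'" by simp
qed

lemma nice_tail:
  assumes nice: "nice (Suc n) (s 0) q"
    and run: "\<And>l. path n B (s l) (w l) (Vs l) (s (Suc l))"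
  shows "nice (Suc n) (s m) q"
  unfolding nice_def
proof (intro conjI allI impI)
  let ?glue = "\<lambda>v l. if l < m then w l else v (l - m)"
  have glue: "\<exists>V'. path (Suc n) B (s 0) (Node (?glue v)) V' q" if "path (Suc n) B (s m) (Node v) V q" for v V
    using omega_path_prefix[of m "path n B" s w Vs "lim_trans B" v V q] run that by simp
  have tr: "track i (Node (?glue v)) = Node (\<lambda>l. if l < m then track i (w l) else track i (v (l - m)))" for i v
    by (auto simp: fun_eq_iff)
  have ntr: "track i (Node v) = Node (\<lambda>l. track i (v l))" for i v by (simp add: comp_def)
  fix t V assume t: "path (Suc n) B (s m) t V q"
  then obtain v where v: "t = Node v" by auto
  obtain V1 where p1: "path (Suc n) B (s 0) (Node (?glue v)) V1 q" using glue t v by blast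
  show "thin (Suc n) A (track k t)"
    using thin_tail[of n A "\<lambda>l. if l < m then track k (w l) else track k (v (l - m))" m] niceD(1)[OF nice p1]
    unfolding tr v ntr by simp
  fix t' V' assume t': "path (Suc n) B (s m) t' V' q" and eq: "\<forall>i<k. track i t = track i t'"
  then obtain v' where v': "t' = Node v'" by auto
  obtain V2 where p2: "path (Suc n) B (s 0) (Node (?glue v')) V2 q" using glue t' v' by blast
  have eqv: "track i (v l) = track i (v' l)" if "i < k" for i l
  proof -
    have "(\<lambda>l. track i (v l)) = (\<lambda>l. track i (v' l))" using eq that unfolding v v' ntr by simp
    then show ?thesis by (rule fun_cong)
  qed
  have "track i (Node (?glue v)) = track i (Node (?glue v'))" if "i < k" for i
    unfolding tr wtree.inject using eqv[OF that] by (intro ext) simp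
  from niceD(2)[OF nice p1 p2 this]
  have "track k (Node (?glue v)) = track k (Node (?glue v'))" .
  then have "(if m + l < m then track k (w (m + l)) else track k (v (m + l - m))) =
    (if m + l < m then track k (w (m + l)) else track k (v' (m + l - m)))" for l
    unfolding tr wtree.inject by (rule fun_cong)
  then show "track k t = track k t'" unfolding v v' ntr by simp
qed

text \<open>
  The values \<open>y\<close> that can occur when the arguments follow the tails \<open>ts\<close>.
\<close>

definition tail_values :: "nat \<Rightarrow> 'r \<times> 'r \<times> (nat \<Rightarrow> 'a wtree) list \<Rightarrow> (nat \<Rightarrow> 'a wtree) \<Rightarrow> bool" where
  "tail_values n x y \<longleftrightarrow> (case x of (p, q, ts) \<Rightarrow> \<exists>v V. nice (Suc n) p q \<and> path (Suc n) B p (Node v) V q \<and>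
     ts = map (\<lambda>i l. track i (v l)) [0..<k] \<and> set ts \<subseteq> T n \<and> y = (\<lambda>l. track k (v l)))"

lemma tail_values_unique:
  assumes "tail_values n x y" "tail_values n x y'"
  shows "y = y'"
proof -
  obtain p q ts where x: "x = (p, q, ts)" by (cases x)
  obtain v V where v: "nice (Suc n) p q" "path (Suc n) B p (Node v) V q"
     "ts = map (\<lambda>i l. track i (v l)) [0..<k]" "y = (\<lambda>l. track k (v l))"
    using assms(1) unfolding tail_values_def x prod.case by (elim exE conjE)
  obtain v' V' where v': "path (Suc n) B p (Node v') V' q"
     "ts = map (\<lambda>i l. track i (v' l)) [0..<k]" "y' = (\<lambda>l. track k (v' l))"
    using assms(2) unfolding tail_values_def x prod.case by (elim exE conjE)
  have "(\<lambda>l. track i (v l)) = (\<lambda>l. track i (v' l))" if "i < k" for i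
    using arg_cong[OF trans[OF v(3)[symmetric] v'(2)], of "\<lambda>ts. ts ! i"] that by simp
  then have "track i (Node v) = track i (Node v')" if "i < k" for i
    using that by (simp add: comp_def)
  from niceD(2)[OF v(1,2) v'(1) this] show ?thesis by (simp add: v(4) v'(3) comp_def)
qed

lemma finite_tail_values: "finite {y. \<exists>x. tail_values n x y}"
proof -
  \<comment> \<open>Each value is determined by a state at either end and a tuple of tails.\<close>
  define key where "key y = (SOME x. tail_values n x y)" for y
  let ?Y = "{y. \<exists>x. tail_values n x y}"
  have key: "tail_values n (key y) y" if "y \<in> ?Y" for y
    using that unfolding key_def mem_Collect_eq by (rule someI_ex)
  have "inj_on key ?Y"
  proof (rule inj_onI)
    fix y y' assume y: "y \<in> ?Y" "y' \<in> ?Y" and eq: "key y = key y'"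
    show "y = y'" using tail_values_unique[OF key[OF y(1)]] key[OF y(2)] eq by simp
  qed
  moreover have "key ` ?Y \<subseteq> states B \<times> states B \<times> {ts. set ts \<subseteq> T n \<and> length ts = k}"
  proof (rule image_subsetI)
    fix y assume "y \<in> ?Y"
    note ky = key[OF this]
    obtain p q ts where x: "key y = (p, q, ts)" by (cases "key y")
    obtain v V where *: "path (Suc n) B p (Node v) V q" "ts = map (\<lambda>i l. track i (v l)) [0..<k]" "set ts \<subseteq> T n"
      using ky unfolding tail_values_def x prod.case by (elim exE conjE)
    have "p \<in> states B" "q \<in> states B" using path_states[OF B *(1)] by auto
    then show "key y \<in> states B \<times> states B \<times> {ts. set ts \<subseteq> T n \<and> length ts = k}" using * x by simp
  qed
  moreover have "finite (states B \<times> states B \<times> {ts. set ts \<subseteq> T n \<and> length ts = k})"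
    using B finite_lists_length_eq[OF finite_tails] by (simp add: ordinal_automaton_def)
  ultimately show ?thesis by (rule inj_on_finite)
qed

text \<open>
  A block of the value is bounded by induction, from the corresponding blocks of the arguments.  Beyond
  block \<open>m\<close> the arguments follow tails, so the value is one of finitely many sequences, and these all
  reach a tail within a common number of blocks.
\<close>

lemma growth:
  "\<exists>c. \<forall>p q v V m. nice n p q \<longrightarrow> path n B p v V q \<longrightarrow> (\<forall>i<k. small T (alphabet A) n m (track i v)) \<longrightarrow>
     small T (alphabet A) n (m + c) (track k v)"
proof (induction n)
  case 0
  have "small T (alphabet A) 0 m (track k v)" if "nice 0 p q" "path 0 B p v V q" for p q v V m
    using thin_small[OF niceD(1)[OF that]] by simp
  then show ?case by (intro exI[of _ 0]) simp
next
  case (Suc n)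
  then obtain c1 where "\<forall>p q v V m. nice n p q \<longrightarrow> path n B p v V q \<longrightarrow>
      (\<forall>i<k. small T (alphabet A) n m (track i v)) \<longrightarrow> small T (alphabet A) n (m + c1) (track k v)" ..
  note c1 = this[rule_format]
  have ex: "\<exists>c. (\<lambda>l. y (c + l)) \<in> T n" if "y \<in> {y. \<exists>x. tail_values n x y}" for y
  proof -
    from that obtain x where yx: "tail_values n x y" by blast
    obtain p q ts where x: "x = (p, q, ts)" by (cases x)
    obtain v V where *: "nice (Suc n) p q" "path (Suc n) B p (Node v) V q" "y = (\<lambda>l. track k (v l))"
      using yx unfolding tail_values_def x prod.case by (elim exE conjE)
    have "thin (Suc n) A (Node y)" using niceD(1)[OF *(1,2)] *(3) by (simp add: comp_def)
    then show ?thesis by (rule tails_reached)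
  qed
  have "\<exists>c. \<forall>y\<in>{y. \<exists>x. tail_values n x y}. (\<lambda>l. y (c + l)) \<in> T n"
    by (rule uniform_bound[OF finite_tail_values]) (rule ex, assumption, rule tails_shift_le)
  then obtain c2 where c2: "\<And>y x. tail_values n x y \<Longrightarrow> (\<lambda>l. y (c2 + l)) \<in> T n" by blast
  let ?c = "max c1 c2"
  have main: "small T (alphabet A) (Suc n) (m + ?c) (track k t)"
    if nice: "nice (Suc n) p q" and t: "path (Suc n) B p t V q"
      and sm: "\<And>i. i < k \<Longrightarrow> small T (alphabet A) (Suc n) m (track i t)" for p q t V m
  proof -
    obtain w s Vs where w: "t = Node w" and s: "s 0 = p"
      and run: "\<And>l. path n B (s l) (w l) (Vs l) (s (Suc l))" and q: "(recurring Vs, q) \<in> lim_trans B"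
      using t unfolding path.simps omega_path_def by blast
    have tr: "track i t = Node (\<lambda>l. track i (w l))" for i by (simp add: w comp_def)
    have sm_tail: "(\<lambda>l. track i (w (m + l))) \<in> T n" if "i < k" for i
      using sm[OF that] unfolding tr by simp
    have sm_block: "small T (alphabet A) n m (track i (w l))" if "i < k" for i l
      using sm[OF that] unfolding tr by simp
    have nice': "nice (Suc n) (s 0) q" using nice s by simp
    have "small T (alphabet A) n (m + ?c) (track k (w l))" for l
    proof (rule small_mono)
      show "small T (alphabet A) n (m + c1) (track k (w l))"
        by (rule c1[OF nice_block[of n s q w Vs l, OF nice' run q] run[of l] sm_block])
    qed simp
    moreover have "(\<lambda>l. track k (w (m + ?c + l))) \<in> T n"
    proof -
      have "\<exists>V. omega_path (path n B) (lim_trans B) (s m) (\<lambda>l. w (m + l)) V q"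
        by (rule omega_path_suffix[of "path n B" s w Vs q "lim_trans B" m, OF run q])
      then obtain V' where V': "path (Suc n) B (s m) (Node (\<lambda>l. w (m + l))) V' q" by auto
      have "nice (Suc n) (s m) q" by (rule nice_tail[of n s q w Vs m, OF nice' run])
      then have "tail_values n (s m, q, map (\<lambda>i l. track i (w (m + l))) [0..<k]) (\<lambda>l. track k (w (m + l)))"
        unfolding tail_values_def prod.case using V' sm_tail
        by (intro exI[of _ "\<lambda>l. w (m + l)"] exI[of _ V']) auto
      from tails_shift_le[of "\<lambda>l. track k (w (m + l))" c2 n ?c, OF c2[OF this]]
      show ?thesis by (simp add: add.assoc)
    qed
    ultimately show ?thesis unfolding tr by simp
  qed
  show ?case
    by (intro exI[of _ ?c] allI impI, erule (1) main) blast
qed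

end

end

section \<open>Growth in countable automatic structures\<close>

text \<open>
  The last entry of a tuple is the value, the others are the arguments.
\<close>

definition functional :: "'m list set \<Rightarrow> bool" where
  "functional R \<longleftrightarrow> (\<forall>xs y y'. xs @ [y] \<in> R \<longrightarrow> xs @ [y'] \<in> R \<longrightarrow> y = y')"

lemma thin_tree_language:
  assumes "countable (tree_language n A)" "t \<in> tree_language n A"
  shows "thin n A t"
proof -
  obtain V q where q: "q \<in> final A" "path n A (initial A) t V q" using assms(2) unfolding tree_language_def by blast
  have "{t. \<exists>V. path n A (initial A) t V q} \<subseteq> tree_language n A" using q(1) unfolding tree_language_def by blast
  then have "countable {t. \<exists>V. path n A (initial A) t V q}" using assms(1) by (rule countable_subset)
  then show ?thesis using q(2) unfolding thin_def by blast
qed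

lemma unzip_Suc: "unzip (Suc k) v = unzip k v @ [map_wtree (\<lambda>xs. xs ! k) v]"
  by (simp add: unzip_def)

text \<open>
  If the automaton of a functional relation accepts two words with the same argument tracks, then the value
  tracks agree; so initial and final states satisfy \<open>nice\<close>.
\<close>

lemma relation_growth:
  assumes A: "ordinal_automaton A" and B: "ordinal_automaton B" and T: "tail_family A T"
    and cnt: "countable (tree_language n A)"
    and sub: "unzip (Suc k) ` tree_language n B \<subseteq> tuples (Suc k) (tree_language n A)"
    and fn: "functional (unzip (Suc k) ` tree_language n B)"
  shows "\<exists>c. \<forall>xs y m. xs @ [y] \<in> unzip (Suc k) ` tree_language n B \<longrightarrow> (\<forall>x\<in>set xs. small T (alphabet A) n m x) \<longrightarrow>
    small T (alphabet A) n (m + c) y"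
proof -
  obtain c where c: "\<forall>p q v V m. nice A B k n p q \<longrightarrow> path n B p v V q \<longrightarrow>
     (\<forall>i<k. small T (alphabet A) n m (map_wtree (\<lambda>xs. xs ! i) v)) \<longrightarrow>
     small T (alphabet A) n (m + c) (map_wtree (\<lambda>xs. xs ! k) v)"
    using growth[OF A T B, of k n] ..
  have nice: "nice A B k n (initial B) q" if q: "q \<in> final B" for q
    unfolding nice_def[OF A T B]
  proof (intro conjI allI impI)
    fix v V assume v: "path n B (initial B) v V q"
    then have vT: "v \<in> tree_language n B" using q unfolding tree_language_def by blast
    then have "unzip (Suc k) v \<in> tuples (Suc k) (tree_language n A)" using sub by blast
    then have "map_wtree (\<lambda>xs. xs ! k) v \<in> tree_language n A" unfolding unzip_Suc tuples_def by simp
    then show "thin n A (map_wtree (\<lambda>xs. xs ! k) v)" by (rule thin_tree_language[OF cnt])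
    fix v' V' assume v': "path n B (initial B) v' V' q"
      and eq: "\<forall>i<k. map_wtree (\<lambda>xs. xs ! i) v = map_wtree (\<lambda>xs. xs ! i) v'"
    then have v'T: "v' \<in> tree_language n B" using q unfolding tree_language_def by blast
    have "unzip k v = unzip k v'" using eq by (simp add: unzip_def)
    then have "unzip k v @ [map_wtree (\<lambda>xs. xs ! k) v] \<in> unzip (Suc k) ` tree_language n B"
      "unzip k v @ [map_wtree (\<lambda>xs. xs ! k) v'] \<in> unzip (Suc k) ` tree_language n B"
      using imageI[OF vT, of "unzip (Suc k)"] imageI[OF v'T, of "unzip (Suc k)"] unfolding unzip_Suc by simp_all
    then show "map_wtree (\<lambda>xs. xs ! k) v = map_wtree (\<lambda>xs. xs ! k) v'"
      using fn unfolding functional_def by blast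
  qed
  have "small T (alphabet A) n (m + c) y"
    if xs: "xs @ [y] \<in> unzip (Suc k) ` tree_language n B" and sm: "\<forall>x\<in>set xs. small T (alphabet A) n m x" for xs y m
  proof -
    obtain v where v: "v \<in> tree_language n B" "xs = unzip k v" "y = map_wtree (\<lambda>xs. xs ! k) v"
      using xs unfolding unzip_Suc by auto
    obtain q V where q: "q \<in> final B" "path n B (initial B) v V q" using v(1) unfolding tree_language_def by blast
    have "small T (alphabet A) n m (map_wtree (\<lambda>xs. xs ! i) v)" if "i < k" for i
      using sm that unfolding v(2) unzip_def by simp
    then show ?thesis using c nice[OF q(1)] q(2) unfolding v(3) by blast
  qed
  then show ?thesis by blast
qed

text \<open>
  The size of an element is that of the word representing it.
\<close>

lemma automatic_growth:
  fixes M :: "'m rel_structure"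
  assumes M: "M \<in> injectively_automatic n" and cnt: "countable (universe M)"
  shows "\<exists>size c K.
    (\<forall>m. finite {x \<in> universe M. size x \<le> m} \<and> card {x \<in> universe M. size x \<le> m} \<le> K ^ ((m + 1) ^ n)) \<and>
    (\<forall>k R xs y m. (k, R) \<in> set (relations M) \<longrightarrow> functional R \<longrightarrow> xs @ [y] \<in> R \<longrightarrow>
       (\<forall>x\<in>set xs. size x \<le> m) \<longrightarrow> size y \<le> m + c)"
proof -
  obtain A :: "(nat, nat) automaton" and Bs :: "(nat \<times> (nat list, nat) automaton) list" and h
    where A: "ordinal_automaton A"
    and Bs: "\<forall>(k, B) \<in> set Bs. ordinal_automaton B \<and> alphabet B = tuples k (alphabet A)"
    and S: "is_structure (tree_structure n A Bs)" and h: "isomorphism h (tree_structure n A Bs) M"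
    and strM: "is_structure M"
    by (rule injectively_automaticE[OF M])
  have bij: "bij_betw h (tree_language n A) (universe M)"
    using h by (simp add: isomorphism_def tree_structure_def)
  have cntT: "countable (tree_language n A)"
    using bij cnt countable_image_inj_eq[of h "tree_language n A"] by (simp add: bij_betw_def)
  obtain T where T: "tail_family A T" using tail_family_exists[OF A] by blast
  define g where "g = inv_into (tree_language n A) h"
  have g: "g x \<in> tree_language n A" "h (g x) = x" if "x \<in> universe M" for x
    using that bij unfolding g_def by (auto simp: bij_betw_def f_inv_into_f intro: inv_into_into)
  have gh: "g (h t) = t" if "t \<in> tree_language n A" for t
    using that bij by (simp add: g_def bij_betw_def)
  define size where "size x = (LEAST m. small T (alphabet A) n m (g x))" for x
  have size: "size x \<le> m \<longleftrightarrow> small T (alphabet A) n m (g x)" if x: "x \<in> universe M" for x m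
  proof -
    obtain m0 where "small T (alphabet A) n m0 (g x)"
      using thin_small[OF A T thin_tree_language[OF cntT g(1)[OF x]]] by blast
    then have "small T (alphabet A) n (size x) (g x)" unfolding size_def by (rule LeastI)
    then show ?thesis using small_mono[OF A T] Least_le unfolding size_def by metis
  qed
  have "finite (alphabet A)" using A by (simp add: ordinal_automaton_def)
  from card_small[OF A T this, of n] obtain K where
    K: "\<And>m. finite {t. small T (alphabet A) n m t}"
       "\<And>m. card {t. small T (alphabet A) n m t} \<le> K ^ ((m + 1) ^ n)" by blast
  have ball: "finite {x \<in> universe M. size x \<le> m} \<and> card {x \<in> universe M. size x \<le> m} \<le> K ^ ((m + 1) ^ n)" for m
  proof -
    have inj: "inj_on g {x \<in> universe M. size x \<le> m}"
      by (rule inj_onI) (metis (no_types, lifting) g(2) mem_Collect_eq)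
    have sub: "g ` {x \<in> universe M. size x \<le> m} \<subseteq> {t. small T (alphabet A) n m t}" using size by auto
    show ?thesis using inj_on_finite[OF inj sub K(1)] card_inj_on_le[OF inj sub K(1)] K(2)[of m] by simp
  qed
  let ?ok = "\<lambda>i c. functional (snd (relations M ! i)) \<longrightarrow> (\<forall>xs y m. xs @ [y] \<in> snd (relations M ! i) \<longrightarrow>
       (\<forall>x\<in>set xs. size x \<le> m) \<longrightarrow> size y \<le> m + c)"
  have len: "length (relations M) = length Bs"
    using h map_eq_imp_length_eq[of fst "relations (tree_structure n A Bs)" fst "relations M"]
    by (simp add: isomorphism_def tree_structure_def)
  have ok: "\<exists>c. ?ok i c" if i: "i \<in> {..<length Bs}" for i
  proof -
    obtain k B where kB: "Bs ! i = (k, B)" by fastforce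
    let ?R = "snd (relations M ! i)"
    have inB: "(k, B) \<in> set Bs" using i kB nth_mem by fastforce
    then have B: "ordinal_automaton B" using Bs by auto
    have rel: "relations (tree_structure n A Bs) ! i = (k, unzip k ` tree_language n B)"
      using i kB by (simp add: tree_structure_def)
    have lenT: "i < length (relations (tree_structure n A Bs))" using i by (simp add: tree_structure_def)
    have "fst (relations M ! i) = k"
      using h i len rel lenT unfolding isomorphism_def by (metis fst_conv length_map nth_map)
    then have RM: "?R \<subseteq> tuples k (universe M)"
      using strM i len nth_mem[of i "relations M"] unfolding is_structure_def by fastforce
    have sub: "unzip k ` tree_language n B \<subseteq> tuples k (tree_language n A)"
      using S inB unfolding is_structure_tree_structure_iff by blast
    have iso: "ts \<in> unzip k ` tree_language n B \<longleftrightarrow> map h ts \<in> ?R" if "ts \<in> tuples k (tree_language n A)" for ts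
    proof -
      have "universe (tree_structure n A Bs) = tree_language n A" by (simp add: tree_structure_def)
      then show ?thesis
        using h[unfolded isomorphism_def, THEN conjunct2, THEN conjunct2, rule_format, OF lenT, of ts] that rel
        by simp
    qed
    have iso': "map g xs \<in> unzip k ` tree_language n B" if xs: "xs \<in> ?R" for xs
    proof -
      have u: "length xs = k" "set xs \<subseteq> universe M" using RM xs by (auto simp: tuples_def)
      then have "map g xs \<in> tuples k (tree_language n A)" using g(1) by (auto simp: tuples_def)
      moreover have "map h (map g xs) = xs" using u(2) g(2) by (auto intro!: map_idI)
      ultimately show ?thesis using iso xs by simp
    qed
    show "\<exists>c. ?ok i c"
    proof (cases k)
      case 0
      then have "xs @ [y] \<notin> ?R" for xs y using RM by (auto simp: tuples_def)
      then show ?thesis by blast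
    next
      case (Suc k0)
      show ?thesis
      proof (cases "functional ?R")
        case True
        have "functional (unzip (Suc k0) ` tree_language n B)"
          unfolding functional_def
        proof (intro allI impI)
          fix ts y y' assume *: "ts @ [y] \<in> unzip (Suc k0) ` tree_language n B" "ts @ [y'] \<in> unzip (Suc k0) ` tree_language n B"
          then have t: "ts @ [y] \<in> tuples k (tree_language n A)" "ts @ [y'] \<in> tuples k (tree_language n A)" using sub Suc by blast+
          have "map h ts @ [h y] \<in> ?R" "map h ts @ [h y'] \<in> ?R"
            using iso[OF t(1)] iso[OF t(2)] * Suc by simp_all
          then have "h y = h y'" using True unfolding functional_def by blast
          moreover have "y \<in> tree_language n A" "y' \<in> tree_language n A" using t by (auto simp: tuples_def)
          ultimately show "y = y'" using gh by metis
        qed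
        then obtain c where c: "\<And>ts y m. ts @ [y] \<in> unzip k ` tree_language n B \<Longrightarrow>
            (\<forall>t\<in>set ts. small T (alphabet A) n m t) \<Longrightarrow> small T (alphabet A) n (m + c) y"
          using relation_growth[OF A B T cntT, of k0] sub unfolding Suc by blast
        have "size y \<le> m + c" if xy: "xs @ [y] \<in> ?R" and sm: "\<forall>x\<in>set xs. size x \<le> m" for xs y m
        proof -
          have "xs @ [y] \<in> tuples k (universe M)" using RM xy by blast
          then have u: "set xs \<subseteq> universe M" "y \<in> universe M" by (simp_all add: tuples_def)
          have "map g xs @ [g y] \<in> unzip k ` tree_language n B" using iso'[OF xy] by simp
          moreover have "\<forall>t\<in>set (map g xs). small T (alphabet A) n m t" using sm u(1) size by auto
          ultimately show ?thesis using c size[OF u(2)] by blast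
        qed
        then show ?thesis by blast
      qed simp
    qed
  qed
  have ok_mono: "?ok i c'" if *: "?ok i c" and le: "c \<le> c'" for i c c'
  proof (intro impI allI)
    fix xs y m assume "functional (snd (relations M ! i))" "xs @ [y] \<in> snd (relations M ! i)" "\<forall>x\<in>set xs. size x \<le> m"
    with * have "size y \<le> m + c" by blast
    then show "size y \<le> m + c'" using le by simp
  qed
  have "\<exists>c. \<forall>i\<in>{..<length Bs}. ?ok i c"
  proof (rule uniform_bound[of "{..<length Bs}" ?ok])
    show "finite {..<length Bs}" by simp
    show "\<exists>c. ?ok i c" if "i \<in> {..<length Bs}" for i using that by (rule ok)
    show "?ok i c'" if "?ok i c" "c \<le> c'" for i c c' using that by (rule ok_mono)
  qed
  then obtain c where c: "\<forall>i\<in>{..<length Bs}. ?ok i c" by (rule exE)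
  have bound: "size y \<le> m + c" if "(k, R) \<in> set (relations M)" "functional R" "xs @ [y] \<in> R" "\<forall>x\<in>set xs. size x \<le> m"
    for k R xs y m
  proof -
    have "\<exists>i<length Bs. relations M ! i = (k, R)" using that(1) unfolding in_set_conv_nth len .
    then obtain i where i: "i < length Bs" "relations M ! i = (k, R)" by blast
    have "?ok i c" by (rule bspec[OF c]) (simp add: i(1))
    then have "functional R \<longrightarrow> (\<forall>xs y m. xs @ [y] \<in> R \<longrightarrow> (\<forall>x\<in>set xs. size x \<le> m) \<longrightarrow> size y \<le> m + c)"
      unfolding i(2) snd_conv .
    from this[rule_format, OF that(2,3)] that(4) show ?thesis by blast
  qed
  show ?thesis
  proof (rule exI[of _ size], rule exI[of _ c], rule exI[of _ K], intro conjI allI impI)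
    show "finite {x \<in> universe M. size x \<le> m}" for m using ball by simp
    show "card {x \<in> universe M. size x \<le> m} \<le> K ^ ((m + 1) ^ n)" for m using ball by simp
    show "size y \<le> m + c" if "(k, R) \<in> set (relations M)" "functional R" "xs @ [y] \<in> R"
      "\<forall>x\<in>set xs. size x \<le> m" for k R xs y m
      using that by (rule bound)
  qed
qed

section \<open>Transducers on words of finite support\<close>

text \<open>
  A position below \<open>\<omega>\<^sup>m\<close> is given by the list of its coefficients, that of \<open>\<omega>\<^bsup>m-1\<^esup>\<close> first.
\<close>

primrec fun_tree :: "nat \<Rightarrow> (nat list \<Rightarrow> 'a) \<Rightarrow> 'a wtree" where
  "fun_tree 0 F = Leaf (F [])"
| "fun_tree (Suc m) F = Node (\<lambda>l. fun_tree m (\<lambda>ps. F (l # ps)))"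

lemma fun_tree_eq_iff: "fun_tree m F = fun_tree m G \<longleftrightarrow> (\<forall>ps. length ps = m \<longrightarrow> F ps = G ps)"
proof (induction m arbitrary: F G)
  case (Suc m)
  have "(\<forall>l ps. length ps = m \<longrightarrow> F (l # ps) = G (l # ps)) \<longleftrightarrow> (\<forall>ps. length ps = Suc m \<longrightarrow> F ps = G ps)"
    by (metis length_Suc_conv)
  then show ?case using Suc.IH by (simp add: fun_eq_iff)
qed simp

lemma map_wtree_fun_tree: "map_wtree g (fun_tree m F) = fun_tree m (\<lambda>ps. g (F ps))"
  by (induction m arbitrary: F) (auto simp: fun_eq_iff)

lemma unzip_fun_tree: "unzip k (fun_tree m F) = map (\<lambda>i. fun_tree m (\<lambda>ps. F ps ! i)) [0..<k]"
  by (simp add: unzip_def map_wtree_fun_tree)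

definition bits :: "nat set" where "bits = {0, 1}"

lemma bits_simps [simp]: "0 \<in> bits" "Suc 0 \<in> bits" "1 \<in> bits" "of_bool P \<in> bits" "finite bits"
  by (simp_all add: bits_def)

text \<open>
  The state is the last letter that was read.  No limit transition is possible if the letter \<open>1\<close> recurs
  below a limit, which must happen if it occurs infinitely often.
\<close>

definition finite_support :: "(nat, nat) automaton" where
  "finite_support = \<lparr>alphabet = bits, states = bits, initial = 0,
     succ_trans = {(p, a, a) | p a. p \<in> bits \<and> a \<in> bits}, lim_trans = {({0}, 0)}, final = bits\<rparr>"

lemma ordinal_automaton_finite_support: "ordinal_automaton finite_support"
  by (auto simp: ordinal_automaton_def finite_support_def)

lemma finite_support_zero:
  "path n finite_support p t V q \<Longrightarrow> V \<subseteq> {0} \<Longrightarrow> q = 0 \<Longrightarrow> t = fun_tree n (\<lambda>_. 0)"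
proof (induction n arbitrary: p t V q)
  case 0
  then show ?case by (auto simp: finite_support_def)
next
  case (Suc n)
  then obtain u s Vs where u: "t = Node u" and V: "V = (\<Union>l. Vs l)"
      and run: "\<And>l. path n finite_support (s l) (u l) (Vs l) (s (Suc l))"
    unfolding path.simps omega_path_def by blast
  have Vl: "Vs l \<subseteq> {0}" for l using Suc.prems(2) V by blast
  have s0: "s l = 0" for l
    using path_states[OF ordinal_automaton_finite_support run[of l]] Vl[of l] by blast
  have "u l = fun_tree n (\<lambda>_. 0)" for l by (rule Suc.IH[OF run[of l] Vl s0])
  then show ?case using u by (simp add: fun_eq_iff)
qed

text \<open>
  From some block on, a word is zero: if a block visits only the state \<open>0\<close>, and so does the next block at
  its start, then no letter \<open>1\<close> was read.
\<close>

lemma countable_finite_support: "countable {t. \<exists>p V q. path n finite_support p t V q}"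
proof (induction n)
  case 0
  have "{t. \<exists>p V q. path 0 finite_support p t V q} \<subseteq> range Leaf" by auto
  then show ?case by (rule countable_subset) simp
next
  case (Suc n)
  let ?C = "{t. \<exists>p V q. path n finite_support p t V q}"
  let ?z = "fun_tree n (\<lambda>_. 0)"
  \<comment> \<open>A word of finite support is coded by the list of its blocks up to the last nonzero one.\<close>
  let ?f = "\<lambda>ts. Node (\<lambda>l. if l < length ts then ts ! l else ?z)"
  have "{t. \<exists>p V q. path (Suc n) finite_support p t V q} \<subseteq> ?f ` lists ?C"
  proof
    fix t assume "t \<in> {t. \<exists>p V q. path (Suc n) finite_support p t V q}"
    then obtain p V q where "path (Suc n) finite_support p t V q" by blast
    then obtain u s Vs where u: "t = Node u"
      and run: "\<And>l. path n finite_support (s l) (u l) (Vs l) (s (Suc l))"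
      and q: "(recurring Vs, q) \<in> lim_trans finite_support"
      unfolding path.simps omega_path_def by blast
    have st: "s l \<in> Vs l \<and> Vs l \<subseteq> bits" for l
      using path_states[OF ordinal_automaton_finite_support run[of l]] by (simp add: finite_support_def)
    have "recurring Vs = {0}" using q by (simp add: finite_support_def)
    then have "1 \<notin> recurring Vs" by simp
    then have "\<not> (\<forall>m. \<exists>l\<ge>m. 1 \<in> Vs l)" unfolding mem_Collect_eq INFM_nat_le .
    then obtain m where m: "\<And>l. l \<ge> m \<Longrightarrow> 1 \<notin> Vs l" by blast
    have V0: "Vs l \<subseteq> {0}" if "l \<ge> m" for l using st[of l] m[OF that] by (auto simp: bits_def)
    have z: "u l = ?z" if "l \<ge> m" for l
      using finite_support_zero[OF run[of l] V0[OF that]] V0[of "Suc l"] st[of "Suc l"] that by auto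
    have "u = (\<lambda>l. if l < length (map u [0..<m]) then map u [0..<m] ! l else ?z)"
    proof (rule ext)
      show "u l = (if l < length (map u [0..<m]) then map u [0..<m] ! l else ?z)" for l
        using z[of l] by (cases "l < m") simp_all
    qed
    from arg_cong[OF this, of Node] have "t = ?f (map u [0..<m])" unfolding u .
    moreover have "u l \<in> ?C" for l using run[of l] by blast
    then have "map u [0..<m] \<in> lists ?C" by (simp add: in_lists_conv_set image_subset_iff)
    ultimately show "t \<in> ?f ` lists ?C" by blast
  qed
  moreover have "countable (?f ` lists ?C)" using Suc by (intro countable_image countable_lists)
  ultimately show ?case by (rule countable_subset)
qed

lemma countable_tree_language_finite_support: "countable (tree_language n finite_support)"
  by (rule countable_subset[OF _ countable_finite_support[of n]]) (auto simp: tree_language_def)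

text \<open>
  A state consists of the last letter, a control state \<open>c\<close> and a number \<open>r\<close>.  In a run, \<open>r\<close> is
  the least exponent in the Cantor normal form of the current position, or \<open>N\<close> at position \<open>0\<close>.
  Below a limit with least exponent \<open>\<rho> + 1\<close> exactly the numbers up to \<open>\<rho>\<close> recur, which is how limit
  transitions compute it.  The last letter ensures that the words on all tracks have finite support.
  \<open>\<delta> c r xs y c'\<close> means that on input letters \<open>xs\<close> the output letter is \<open>y\<close> and the next control state is \<open>c'\<close>.
\<close>

definition transducer ::
  "nat \<Rightarrow> nat \<Rightarrow> (nat \<Rightarrow> nat \<Rightarrow> nat list \<Rightarrow> nat \<Rightarrow> nat \<Rightarrow> bool) \<Rightarrow> (nat list, nat list \<times> nat \<times> nat) automaton" where
  "transducer N k \<delta> =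
     \<lparr>alphabet = tuples (Suc k) bits,
      states = tuples (Suc k) bits \<times> {..2} \<times> {..N},
      initial = (replicate (Suc k) 0, 0, N),
      succ_trans = {((la, c, r), xs @ [y], (xs @ [y], c', 0)) | la c r xs y c'.
        la \<in> tuples (Suc k) bits \<and> c \<le> 2 \<and> c' \<le> 2 \<and> r \<le> N \<and> xs \<in> tuples k bits \<and> y \<in> bits \<and> \<delta> c r xs y c'},
      lim_trans = {({replicate (Suc k) 0} \<times> {c} \<times> {..\<rho>}, (replicate (Suc k) 0, c, Suc \<rho>)) | c \<rho>.
        c \<le> 2 \<and> \<rho> < N},
      final = tuples (Suc k) bits \<times> {..2} \<times> {..N}\<rparr>"

lemma zeros_in_tuples [simp]: "replicate k 0 \<in> tuples k bits"
  by (auto simp: tuples_def)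

lemma finite_tuples: "finite S \<Longrightarrow> finite (tuples k S)"
  using finite_lists_length_eq[of S k] by (simp add: tuples_def conj_commute)

lemma snoc_in_tuples: "xs @ [y] \<in> tuples (Suc k) S \<longleftrightarrow> xs \<in> tuples k S \<and> y \<in> S"
  by (auto simp: tuples_def)

lemma transducer_simps [simp]:
  "alphabet (transducer N k \<delta>) = tuples (Suc k) bits"
  "initial (transducer N k \<delta>) = (replicate (Suc k) 0, 0, N)"
  "final (transducer N k \<delta>) = tuples (Suc k) bits \<times> {..2} \<times> {..N}"
  by (simp_all add: transducer_def)

lemma finite_support_simps [simp]:
  "alphabet finite_support = bits" "initial finite_support = 0" "final finite_support = bits"
  "states finite_support = bits"
  by (simp_all add: finite_support_def)

lemma ordinal_automaton_transducer: "ordinal_automaton (transducer N k \<delta>)"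
  unfolding ordinal_automaton_def
proof (intro conjI)
  let ?A = "transducer N k \<delta>"
  have z: "replicate (Suc k) 0 \<in> tuples (Suc k) bits" by (rule zeros_in_tuples)
  show "succ_trans ?A \<subseteq> states ?A \<times> alphabet ?A \<times> states ?A"
    by (auto simp: transducer_def snoc_in_tuples)
  show "lim_trans ?A \<subseteq> Pow (states ?A) \<times> states ?A"
    using z by (auto simp: transducer_def simp del: replicate_Suc)
  show "initial ?A \<in> states ?A" using z by (simp add: transducer_def del: replicate_Suc)
qed (auto simp: transducer_def finite_tuples)

definition deterministic :: "(nat \<Rightarrow> nat \<Rightarrow> nat list \<Rightarrow> nat \<Rightarrow> nat \<Rightarrow> bool) \<Rightarrow> bool" where
  "deterministic \<delta> \<longleftrightarrow>
     (\<forall>c r xs y y' c' c''. \<delta> c r xs y c' \<longrightarrow> \<delta> c r xs y' c'' \<longrightarrow> y = y' \<and> c' = c'')"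

text \<open>
  Successor steps are determined by the inputs, and limit transitions by the recurring states.
\<close>

lemma transducer_deterministic:
  assumes det: "deterministic \<delta>"
  shows "path n (transducer N k \<delta>) p v V q \<Longrightarrow> path n (transducer N k \<delta>) p v' V' q' \<Longrightarrow>
    unzip k v = unzip k v' \<Longrightarrow> v = v' \<and> V = V' \<and> q = q'"
proof (induction n arbitrary: p v V q v' V' q')
  case 0
  obtain la c r xs y c' where 1: "p = (la, c, r)" "v = Leaf (xs @ [y])" "length xs = k" "\<delta> c r xs y c'"
    "q = (xs @ [y], c', 0)" "V = {p}"
    using 0(1) by (auto simp: transducer_def tuples_def)
  obtain xs2 y2 c2 where 2: "v' = Leaf (xs2 @ [y2])" "length xs2 = k" "\<delta> c r xs2 y2 c2"
    "q' = (xs2 @ [y2], c2, 0)" "V' = {p}"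
    using 0(2) 1(1) by (auto simp: transducer_def tuples_def)
  have "xs ! i = xs2 ! i" if "i < k" for i
    using arg_cong[OF 0(3), of "\<lambda>ts. ts ! i"] that 1(2,3) 2(1,2) by (simp add: unzip_def nth_append)
  then have "xs = xs2" using 1(3) 2(2) by (intro nth_equalityI) auto
  moreover from this have "y = y2 \<and> c' = c2"
    using 1(4) 2(3) det unfolding deterministic_def by blast
  ultimately show ?case using 1 2 by simp
next
  case (Suc n)
  obtain u s Vs where u: "v = Node u" "s 0 = p" "V = (\<Union>l. Vs l)"
      "(recurring Vs, q) \<in> lim_trans (transducer N k \<delta>)"
    and run: "\<And>l. path n (transducer N k \<delta>) (s l) (u l) (Vs l) (s (Suc l))"
    using Suc.prems(1) unfolding path.simps omega_path_def by blast
  obtain u' s' Vs' where u': "v' = Node u'" "s' 0 = p" "V' = (\<Union>l. Vs' l)"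
      "(recurring Vs', q') \<in> lim_trans (transducer N k \<delta>)"
    and run': "\<And>l. path n (transducer N k \<delta>) (s' l) (u' l) (Vs' l) (s' (Suc l))"
    using Suc.prems(2) unfolding path.simps omega_path_def by blast
  have uz: "unzip k (u l) = unzip k (u' l)" for l
    using Suc.prems(3) unfolding u(1) u'(1) by (auto simp: unzip_def fun_eq_iff)
  note IH = Suc.IH
  have s: "s l = s' l" for l
  proof (induction l)
    case (Suc l)
    have "path n (transducer N k \<delta>) (s l) (u' l) (Vs' l) (s' (Suc l))" using run'[of l] Suc by simp
    from IH[OF run[of l] this uz[of l]] show ?case by blast
  qed (simp add: u(2) u'(2))
  have "u l = u' l \<and> Vs l = Vs' l" for l
  proof -
    have "path n (transducer N k \<delta>) (s l) (u' l) (Vs' l) (s' (Suc l))" using run'[of l] s by simp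
    from IH[OF run[of l] this uz[of l]] show ?thesis by blast
  qed
  then have eq: "u = u'" "Vs = Vs'" by auto
  have "q = q'"
  proof -
    obtain c \<rho> where 1: "recurring Vs = {replicate (Suc k) 0} \<times> {c} \<times> {..\<rho>}" "q = (replicate (Suc k) 0, c, Suc \<rho>)"
      using u(4) by (auto simp: transducer_def)
    obtain c' \<rho>' where 2: "recurring Vs' = {replicate (Suc k) 0} \<times> {c'} \<times> {..\<rho>'}" "q' = (replicate (Suc k) 0, c', Suc \<rho>')"
      using u'(4) by (auto simp: transducer_def)
    have "{replicate (Suc k) (0::nat)} \<times> {c} \<times> {..\<rho>} = {replicate (Suc k) 0} \<times> {c'} \<times> {..\<rho>'}"
      using 1(1) 2(1) eq(2) by simp
    then have "{c} = {c'} \<and> {..\<rho>} = {..\<rho>'}" by (simp add: times_eq_iff)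
    then show ?thesis using 1 2 by simp
  qed
  then show ?case using u u' eq by simp
qed

lemma transducer_functional:
  assumes "deterministic \<delta>"
  shows "functional (unzip (Suc k) ` tree_language n (transducer N k \<delta>))"
  unfolding functional_def
proof (intro allI impI)
  fix xs y y'
  assume "xs @ [y] \<in> unzip (Suc k) ` tree_language n (transducer N k \<delta>)" "xs @ [y'] \<in> unzip (Suc k) ` tree_language n (transducer N k \<delta>)"
  then obtain v v' where v: "v \<in> tree_language n (transducer N k \<delta>)" "xs = unzip k v" "y = map_wtree (\<lambda>xs. xs ! k) v"
    and v': "v' \<in> tree_language n (transducer N k \<delta>)" "xs = unzip k v'" "y' = map_wtree (\<lambda>xs. xs ! k) v'"
    unfolding unzip_Suc by auto
  obtain V q where p: "path n (transducer N k \<delta>) (initial (transducer N k \<delta>)) v V q"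
    using v(1) unfolding tree_language_def by blast
  obtain V' q' where p': "path n (transducer N k \<delta>) (initial (transducer N k \<delta>)) v' V' q'"
    using v'(1) unfolding tree_language_def by blast
  have "v = v'" using transducer_deterministic[OF assms p p'] v(2) v'(2) by simp
  then show "y = y'" using v(3) v'(3) by simp
qed

text \<open>
  Projecting the last letter to one track maps runs to runs.
\<close>

lemma transducer_in_finite_support:
  "unzip (Suc k) ` tree_language n (transducer N k \<delta>) \<subseteq> tuples (Suc k) (tree_language n finite_support)"
proof safe
  fix v assume "v \<in> tree_language n (transducer N k \<delta>)"
  then obtain V q where p: "path n (transducer N k \<delta>) (replicate (Suc k) 0, 0, N) v V q"
    unfolding tree_language_def transducer_simps mem_Collect_eq by blast
  have "map_wtree (\<lambda>xs. xs ! i) v \<in> tree_language n finite_support" if i: "i < Suc k" for i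
  proof -
    let ?f = "\<lambda>(la :: nat list, c :: nat, r :: nat). la ! i"
    have bit: "xs ! i \<in> bits" if "xs \<in> tuples (Suc k) bits" for xs
      using that i by (auto simp: tuples_def)
    have "path n finite_support (?f (replicate (Suc k) 0, 0, N)) (map_wtree (\<lambda>xs. xs ! i) v) (?f ` V) (?f q)"
    proof (rule path_map[OF ordinal_automaton_transducer _ _ p])
      fix p a q assume "(p, a, q) \<in> succ_trans (transducer N k \<delta>)"
      then obtain la c r c' where *: "p = (la, c, r)" "q = (a, c', 0)" "la \<in> tuples (Suc k) bits" "a \<in> tuples (Suc k) bits"
        by (auto simp: transducer_def snoc_in_tuples)
      then show "(?f p, a ! i, ?f q) \<in> succ_trans finite_support"
        using bit by (simp add: finite_support_def)
    next
      fix W q assume "(W, q) \<in> lim_trans (transducer N k \<delta>)"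
      then obtain c \<rho> where *: "W = {replicate (Suc k) 0} \<times> {c} \<times> {..\<rho>}" "q = (replicate (Suc k) 0, c, Suc \<rho>)"
        by (auto simp: transducer_def)
      have "?f ` W = {0}" unfolding *(1) using i by (force simp del: replicate_Suc)
      then show "(?f ` W, ?f q) \<in> lim_trans finite_support"
        using i * by (simp add: finite_support_def del: replicate_Suc)
    qed
    moreover have "?f (replicate (Suc k) 0, 0, N) = 0" using i by (simp del: replicate_Suc)
    ultimately have p': "path n finite_support 0 (map_wtree (\<lambda>xs. xs ! i) v) (?f ` V) (?f q)" by simp
    have "?f q \<in> bits" using path_states[OF ordinal_automaton_finite_support p'] by simp
    with p' show ?thesis unfolding tree_language_def finite_support_simps mem_Collect_eq by blast
  qed
  then show "unzip (Suc k) v \<in> tuples (Suc k) (tree_language n finite_support)"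
    by (simp add: unzip_def tuples_def image_subset_iff)
qed

section \<open>Runs of transducers\<close>

lemma INFM_eventually_constant:
  assumes "\<And>l::nat. l \<ge> K \<Longrightarrow> Vs l = X"
  shows "recurring Vs = X"
proof -
  have "(\<exists>\<^sub>\<infinity>l. r \<in> Vs l) \<longleftrightarrow> r \<in> X" for r
  proof -
    have "(\<exists>\<^sub>\<infinity>l. r \<in> Vs l) \<longleftrightarrow> (\<exists>\<^sub>\<infinity>l. r \<in> Vs (K + l))"
      by (rule INFM_shift[symmetric])
    also have "\<dots> \<longleftrightarrow> (\<exists>\<^sub>\<infinity>l::nat. r \<in> X)" using assms by simp
    also have "\<dots> \<longleftrightarrow> r \<in> X" by simp
    finally show ?thesis .
  qed
  then show ?thesis by simp
qed

lemma UN_two: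
  assumes "\<And>l. f (Suc l) = f 1"
  shows "(\<Union>l::nat. f l) = f 0 \<union> f 1"
proof (intro equalityI UN_least)
  show "f l \<subseteq> f 0 \<union> f 1" for l using assms by (cases l) auto
qed auto

context
  fixes N k :: nat and \<delta> :: "nat \<Rightarrow> nat \<Rightarrow> nat list \<Rightarrow> nat \<Rightarrow> nat \<Rightarrow> bool"
begin

abbreviation machine :: "(nat list, nat list \<times> nat \<times> nat) automaton" where
  "machine \<equiv> transducer N k \<delta>"

abbreviation zeros :: "nat list" where "zeros \<equiv> replicate (Suc k) 0"

abbreviation zero_tree :: "nat \<Rightarrow> nat list wtree" where "zero_tree m \<equiv> fun_tree m (\<lambda>_. zeros)"

definition idle :: "nat \<Rightarrow> nat \<Rightarrow> bool" where "idle c r \<longleftrightarrow> \<delta> c r (replicate k 0) 0 c"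

definition reach :: "nat \<Rightarrow> nat list \<times> nat \<times> nat \<Rightarrow> nat list wtree \<Rightarrow> nat list \<times> nat \<times> nat \<Rightarrow> bool" where
  "reach m p t q \<longleftrightarrow> (\<exists>V. path m machine p t V q)"

lemma zeros_snoc: "replicate k 0 @ [0] = zeros"
  by (simp add: replicate_append_same)

lemma reach_0:
  assumes "la \<in> tuples (Suc k) bits" "c \<le> 2" "r \<le> N" "xs \<in> tuples k bits" "y \<in> bits" "c' \<le> 2" "\<delta> c r xs y c'"
  shows "path 0 machine (la, c, r) (Leaf (xs @ [y])) {(la, c, r)} (xs @ [y], c', 0)"
  using assms unfolding transducer_def by simp

text \<open>
  The visited states have to be known exactly, since the limit transition after \<open>\<omega>\<close> such blocks requires
  every exponent up to \<open>m\<close> to recur.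
\<close>

lemma zero_block:
  assumes "la \<in> tuples (Suc k) bits" "c \<le> 2" "r \<le> N" "m \<le> N" "idle c r" "\<And>r'. r' < m \<Longrightarrow> idle c r'"
  shows "path m machine (la, c, r) (zero_tree m)
     (insert (la, c, r) ({zeros} \<times> {c} \<times> {..<m})) (zeros, c, m)"
  using assms
proof (induction m arbitrary: la r)
  case 0
  then show ?case using reach_0[of la c r "replicate k 0" 0 c] unfolding zeros_snoc idle_def by simp
next
  case (Suc m)
  let ?s = "\<lambda>l::nat. if l = 0 then (la, c, r) else (zeros, c, m)"
  let ?Vs = "\<lambda>l::nat. insert (?s l) ({zeros} \<times> {c} \<times> {..<m})"
  have A: "path m machine (la, c, r) (zero_tree m)
     (insert (la, c, r) ({zeros} \<times> {c} \<times> {..<m})) (zeros, c, m)"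
    using Suc.prems by (intro Suc.IH) auto
  have B: "path m machine (zeros, c, m) (zero_tree m)
     (insert (zeros, c, m) ({zeros} \<times> {c} \<times> {..<m})) (zeros, c, m)"
    using Suc.prems zeros_in_tuples[of "Suc k"] by (intro Suc.IH) (auto simp del: replicate_Suc)
  have step: "path m machine (?s l) (zero_tree m) (?Vs l) (?s (Suc l))" for l
    using A B by simp
  have V: "insert (zeros, c, m) ({zeros} \<times> {c} \<times> {..<m}) = {zeros} \<times> {c} \<times> {..m}"
    by (auto simp: le_less simp del: replicate_Suc)
  have "recurring ?Vs = {zeros} \<times> {c} \<times> {..m}"
    by (rule INFM_eventually_constant[of 1]) (use V in \<open>simp del: replicate_Suc\<close>)
  moreover have "({zeros} \<times> {c} \<times> {..m}, (zeros, c, Suc m)) \<in> lim_trans machine"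
    using Suc.prems by (auto simp: transducer_def simp del: replicate_Suc)
  ultimately have lim: "(recurring ?Vs, (zeros, c, Suc m)) \<in> lim_trans machine" by simp
  have U: "insert (la, c, r) ({zeros} \<times> {c} \<times> {..<Suc m}) = (\<Union>l. ?Vs l)"
  proof -
    have "(\<Union>l. ?Vs l) = ?Vs 0 \<union> ?Vs 1" by (rule UN_two) simp
    also have "\<dots> = insert (la, c, r) ({zeros} \<times> {c} \<times> {..m})"
      using V by (auto simp del: replicate_Suc)
    finally show ?thesis by (simp add: lessThan_Suc_atMost del: replicate_Suc)
  qed
  show ?case
    unfolding path.simps(2) fun_tree.simps(2) omega_path_def
    by (rule exI[of _ "\<lambda>l. zero_tree m"], rule conjI, rule refl, rule exI[of _ ?s], rule exI[of _ ?Vs])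
      (use step lim U in \<open>simp del: replicate_Suc\<close>)
qed

lemma reach_zero_tree:
  assumes "la \<in> tuples (Suc k) bits" "c \<le> 2" "r \<le> N" "m \<le> N" "idle c r" "\<And>r'. r' < m \<Longrightarrow> idle c r'"
  shows "reach m (la, c, r) (zero_tree m) (zeros, c, m)"
  unfolding reach_def using zero_block[OF assms] by blast

text \<open>
  All but finitely many blocks of a word of finite support are zero, and they alone determine the limit
  transition.
\<close>

lemma reach_Node:
  assumes m: "m < N" and c: "c \<le> 2" and idle: "\<And>r. r \<le> m \<Longrightarrow> idle c r"
    and step: "\<And>l. l < K \<Longrightarrow> reach m (s l) (u l) (s (Suc l))"
    and K: "s K = (zeros, c, m)" "\<And>l. l \<ge> K \<Longrightarrow> u l = zero_tree m"
  shows "reach (Suc m) (s 0) (Node u) (zeros, c, Suc m)"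
proof -
  let ?X = "{zeros} \<times> {c} \<times> {..m}"
  have V: "insert (zeros, c, m) ({zeros} \<times> {c} \<times> {..<m}) = ?X"
    by (auto simp: le_less simp del: replicate_Suc)
  have "path m machine (zeros, c, m) (zero_tree m) (insert (zeros, c, m) ({zeros} \<times> {c} \<times> {..<m})) (zeros, c, m)"
    by (rule zero_block[OF zeros_in_tuples c]) (use m idle in auto)
  then have Z: "path m machine (zeros, c, m) (zero_tree m) ?X (zeros, c, m)" unfolding V .
  have "\<forall>l. \<exists>V. l < K \<longrightarrow> path m machine (s l) (u l) V (s (Suc l))"
    using step unfolding reach_def by simp
  from choice[OF this] obtain W where
    W: "\<And>l. l < K \<Longrightarrow> path m machine (s l) (u l) (W l) (s (Suc l))" by blast
  let ?s = "\<lambda>l. if l \<le> K then s l else (zeros, c, m)"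
  let ?Vs = "\<lambda>l. if l < K then W l else ?X"
  have "path m machine (?s l) (u l) (?Vs l) (?s (Suc l))" for l
  proof (cases "l < K")
    case True
    then show ?thesis using W[OF True] by simp
  next
    case False
    then have "?s l = (zeros, c, m)" using K(1) by (simp del: replicate_Suc)
    then show ?thesis using Z False K(2)[of l] by (simp del: replicate_Suc)
  qed
  moreover have "recurring ?Vs = ?X"
    by (rule INFM_eventually_constant[of K]) simp
  moreover have "(?X, (zeros, c, Suc m)) \<in> lim_trans machine"
    using m c by (auto simp: transducer_def simp del: replicate_Suc)
  ultimately have "omega_path (path m machine) (lim_trans machine) (s 0) u (\<Union>l. ?Vs l) (zeros, c, Suc m)"
    unfolding omega_path_def
    by (intro exI[of _ ?s] exI[of _ ?Vs]) (simp del: replicate_Suc)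
  then show ?thesis unfolding reach_def path.simps(2) by blast
qed

text \<open>
  In the words that code \<open>{\<beta>}\<close> and \<open>{\<beta> + \<omega>\<^sup>j}\<close>, at most two adjacent blocks are nonzero at each level: the
  block containing \<open>\<beta>\<close> and, at level \<open>j + 1\<close>, the next one.
\<close>

lemma reach_two_blocks:
  assumes m: "m < N" and la: "la \<in> tuples (Suc k) bits" and c: "c0 \<le> 2" "c2 \<le> 2" and r: "r \<le> N"
    and la2: "la2 \<in> tuples (Suc k) bits"
    and idle0: "a > 0 \<Longrightarrow> idle c0 r" "\<And>r'. a > 0 \<Longrightarrow> r' \<le> m \<Longrightarrow> idle c0 r'"
    and idle2: "\<And>r'. r' \<le> m \<Longrightarrow> idle c2 r'"
    and b: "reach m (if a = 0 then (la, c0, r) else (zeros, c0, m)) b q"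
    and b': "reach m q b' (la2, c2, m)"
  shows "reach (Suc m) (la, c0, r) (Node (\<lambda>l. if l = a then b else if l = Suc a then b' else zero_tree m))
    (zeros, c2, Suc m)"
proof -
  let ?s = "\<lambda>l::nat. if l = 0 then (la, c0, r) else if l \<le> a then (zeros, c0, m) else if l = Suc a then q
     else if l = Suc (Suc a) then (la2, c2, m) else (zeros, c2, m)"
  let ?u = "\<lambda>l. if l = a then b else if l = Suc a then b' else zero_tree m"
  have z: "zeros \<in> tuples (Suc k) bits" by (rule zeros_in_tuples)
  have "reach (Suc m) (?s 0) (Node ?u) (zeros, c2, Suc m)"
  proof (rule reach_Node[where K = "Suc (Suc (Suc a))" and s = ?s and u = ?u])
    fix l assume "l < Suc (Suc (Suc a))"
    then consider "l < a" | "l = a" | "l = Suc a" | "l = Suc (Suc a)" by linarith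
    then show "reach m (?s l) (?u l) (?s (Suc l))"
    proof cases
      case 1
      have "reach m (la, c0, r) (zero_tree m) (zeros, c0, m)"
        by (rule reach_zero_tree[OF la c(1) r]) (use m idle0 1 in auto)
      moreover have "reach m (zeros, c0, m) (zero_tree m) (zeros, c0, m)"
        by (rule reach_zero_tree[OF z c(1)]) (use m idle0 1 in auto)
      ultimately show ?thesis using 1 by (simp del: replicate_Suc)
    next
      case 2
      then show ?thesis using b by (cases "a = 0") (simp_all del: replicate_Suc)
    next
      case 3
      then show ?thesis using b' by (simp del: replicate_Suc)
    next
      case 4
      have "reach m (la2, c2, m) (zero_tree m) (zeros, c2, m)"
        by (rule reach_zero_tree[OF la2 c(2)]) (use m idle2 in auto)
      then show ?thesis using 4 by (simp del: replicate_Suc)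
    qed
  qed (use m c idle2 in auto)
  then show ?thesis by (simp del: replicate_Suc)
qed

text \<open>
  This produces the set \<open>{0}\<close>, and also the element \<open>\<beta> + \<omega>\<^sup>j\<close> at the start of a block of length \<open>\<omega>\<^sup>j\<close>.
\<close>

lemma reach_origin:
  assumes c: "c \<le> 2" "c2 \<le> 2" and idle: "\<And>r. r \<le> N \<Longrightarrow> idle c2 r"
  shows "m \<le> N \<Longrightarrow> la \<in> tuples (Suc k) bits \<Longrightarrow> r \<le> N \<Longrightarrow> \<delta> c r (replicate k 0) 1 c2 \<Longrightarrow>
    reach m (la, c, r) (fun_tree m (\<lambda>ps. replicate k 0 @ [of_bool (ps = replicate m 0)]))
      (if m = 0 then replicate k 0 @ [1] else zeros, c2, m)"
proof (induction m arbitrary: la r)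
  case 0
  then show ?case using reach_0[of la c r "replicate k 0" 1 c2] c by (auto simp: reach_def)
next
  case (Suc m)
  let ?F = "\<lambda>ps. replicate k 0 @ [of_bool (ps = replicate (Suc m) 0)]"
  let ?b = "fun_tree m (\<lambda>ps. replicate k 0 @ [of_bool (ps = replicate m 0)])"
  let ?l = "if m = 0 then replicate k 0 @ [1] else zeros"
  have l: "?l \<in> tuples (Suc k) bits" using zeros_in_tuples[of "Suc k"] zeros_in_tuples[of k]
    by (simp add: snoc_in_tuples del: replicate_Suc)
  have b: "reach m (la, c, r) ?b (?l, c2, m)" using Suc by simp
  have b': "reach m (?l, c2, m) (zero_tree m) (zeros, c2, m)"
    by (rule reach_zero_tree[OF l c(2)]) (use Suc.prems idle in auto)
  have "reach (Suc m) (la, c, r) (Node (\<lambda>l. if l = 0 then ?b else if l = Suc 0 then zero_tree m else zero_tree m)) (zeros, c2, Suc m)"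
    by (rule reach_two_blocks[where q = "(?l, c2, m)" and ?la2.0 = zeros])
      (use Suc.prems c idle b b' zeros_in_tuples[of "Suc k"] in \<open>auto simp del: replicate_Suc\<close>)
  moreover have "fun_tree (Suc m) ?F = Node (\<lambda>l. if l = 0 then ?b else if l = Suc 0 then zero_tree m else zero_tree m)"
    using zeros_snoc by (auto simp: fun_eq_iff fun_tree_eq_iff)
  ultimately show ?case by simp
qed

lemma reach_finite_support:
  assumes idle: "\<And>r. r \<le> N \<Longrightarrow> idle 0 r"
  shows "m \<le> N \<Longrightarrow> la \<in> tuples (Suc k) bits \<Longrightarrow> r \<le> N \<Longrightarrow>
    (\<And>ps r. length ps = m \<Longrightarrow> r \<le> N \<Longrightarrow> \<exists>xs y. F ps = xs @ [y] \<and> xs \<in> tuples k bits \<and> y \<in> bits \<and> \<delta> 0 r xs y 0) \<Longrightarrow>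
    finite {ps. length ps = m \<and> F ps \<noteq> zeros} \<Longrightarrow>
    reach m (la, 0, r) (fun_tree m F) (if m = 0 then F [] else zeros, 0, m)"
proof (induction m arbitrary: la r F)
  case 0
  obtain xs y where "F [] = xs @ [y]" "xs \<in> tuples k bits" "y \<in> bits" "\<delta> 0 r xs y 0"
    using 0(4)[of "[]" r] 0(3) by auto
  then show ?case using reach_0[of la 0 r xs y 0] 0(2,3) by (auto simp: reach_def)
next
  case (Suc m)
  let ?S = "{ps. length ps = Suc m \<and> F ps \<noteq> zeros}"
  have "finite (hd ` ?S)" using Suc.prems(5) by (rule finite_imageI)
  then obtain K where K: "\<forall>l\<in>hd ` ?S. l < K" unfolding finite_nat_set_iff_bounded ..
  have zero: "F (l # ps) = zeros" if "l \<ge> K" "length ps = m" for l ps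
  proof (rule ccontr)
    assume "F (l # ps) \<noteq> zeros"
    then have "l # ps \<in> ?S" using that(2) by simp
    from bspec[OF K imageI[OF this, of hd]] that(1) show False by simp
  qed
  let ?l = "\<lambda>l. if m = 0 then F [l] else zeros"
  let ?s = "\<lambda>l. case l of 0 \<Rightarrow> (la, 0, r) | Suc j \<Rightarrow> (?l j, 0, m)"
  have tup: "F ps \<in> tuples (Suc k) bits" if ps: "length ps = Suc m" for ps
  proof -
    obtain xs y where "F ps = xs @ [y]" "xs \<in> tuples k bits" "y \<in> bits"
      using Suc.prems(4)[OF ps, of 0] by auto
    then show ?thesis by (simp add: snoc_in_tuples)
  qed
  have step: "reach m (la', 0, r') (fun_tree m (\<lambda>ps. F (l # ps))) (?l l, 0, m)"
    if "la' \<in> tuples (Suc k) bits" "r' \<le> N" for l la' r'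
  proof (rule Suc.IH)
    show "\<exists>xs y. F (l # ps) = xs @ [y] \<and> xs \<in> tuples k bits \<and> y \<in> bits \<and> \<delta> 0 r xs y 0"
      if "length ps = m" "r \<le> N" for ps r
      by (rule Suc.prems(4)) (use that in simp_all)
    show "m \<le> N" using Suc.prems(1) by simp
    show "la' \<in> tuples (Suc k) bits" "r' \<le> N" by fact+
    show "finite {ps. length ps = m \<and> F (l # ps) \<noteq> zeros}"
    proof (rule finite_imageD[of "Cons l"])
      show "finite (Cons l ` {ps. length ps = m \<and> F (l # ps) \<noteq> zeros})"
        by (rule finite_subset[OF _ Suc.prems(5)]) auto
    qed simp
  qed
  have l: "?l j \<in> tuples (Suc k) bits" for j using tup[of "[j]"] zeros_in_tuples[of "Suc k"] by (simp del: replicate_Suc)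
  have "reach (Suc m) (?s 0) (Node (\<lambda>l. fun_tree m (\<lambda>ps. F (l # ps)))) (zeros, 0, Suc m)"
  proof (rule reach_Node[where K = "Suc K" and s = ?s])
    fix i
    show "reach m (?s i) (fun_tree m (\<lambda>ps. F (i # ps))) (?s (Suc i))"
      using step[OF Suc.prems(2,3)] step[OF l, of m] Suc.prems(1) by (cases i) simp_all
  next
    show "?s (Suc K) = (zeros, 0, m)" using zero[of K "[]"] by (simp del: replicate_Suc)
  next
    show "fun_tree m (\<lambda>ps. F (i # ps)) = zero_tree m" if "i \<ge> Suc K" for i
      unfolding fun_tree_eq_iff using zero that by simp
  qed (use Suc.prems(1) idle in auto)
  then show ?case by (simp del: replicate_Suc)
qed

end

text \<open>
  Let \<open>\<beta>\<close> be the first position at which the input is \<open>1\<close>.  The control states are: before \<open>\<beta>\<close>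
  included; after \<open>\<beta>\<close>, waiting for the next multiple of \<open>\<omega>\<^sup>j\<close>, which is \<open>\<beta> + \<omega>\<^sup>j\<close>;
  and after that.
\<close>

definition shift_step :: "nat \<Rightarrow> nat \<Rightarrow> nat \<Rightarrow> nat list \<Rightarrow> nat \<Rightarrow> nat \<Rightarrow> bool" where
  "shift_step j c r xs y c' \<longleftrightarrow>
     c = 0 \<and> y = 0 \<and> c' = xs ! 0 \<or>
     c = 1 \<and> r < j \<and> y = 0 \<and> c' = 1 \<or>
     c = 1 \<and> j \<le> r \<and> y = 1 \<and> c' = 2 \<or>
     c = 2 \<and> y = 0 \<and> c' = 2"

lemma deterministic_shift_step: "deterministic (shift_step j)"
  by (auto simp: deterministic_def shift_step_def)

lemma idle_shift_step:
  "idle 1 (shift_step j) 0 r" "r < j \<Longrightarrow> idle 1 (shift_step j) 1 r" "idle 1 (shift_step j) 2 r"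
  by (auto simp: idle_def shift_step_def)

text \<open>
  Inside a block of length at most \<open>\<omega>\<^sup>j\<close> there is no multiple of \<open>\<omega>\<^sup>j\<close> after \<open>\<beta>\<close>.
\<close>

lemma reach_shift_mark:
  assumes "m \<le> j" "m \<le> N" "length as = m" "la \<in> tuples (Suc 1) bits" "r \<le> N"
  shows "reach N 1 (shift_step j) m (la, 0, r) (fun_tree m (\<lambda>ps. [of_bool (ps = as), 0]))
    (if m = 0 then [1, 0] else [0, 0], 1, m)"
  using assms
proof (induction m arbitrary: la r as)
  case 0
  have d: "shift_step j 0 r [1] 0 1" by (simp add: shift_step_def)
  have "path 0 (transducer N 1 (shift_step j)) (la, 0, r) (Leaf ([1] @ [0])) {(la, 0, r)} ([1] @ [0], 1, 0)"
    by (rule reach_0) (use 0 d in \<open>simp_all add: tuples_def\<close>)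
  then show ?case using 0 by (auto simp: reach_def)
next
  case (Suc m)
  obtain a as' where as: "as = a # as'" "length as' = m" using Suc.prems(3) by (cases as) auto
  let ?b = "fun_tree m (\<lambda>ps. [of_bool (ps = as'), 0 :: nat])"
  let ?Z = "fun_tree m (\<lambda>_. replicate (Suc 1) (0 :: nat))"
  let ?l = "if m = 0 then [1, 0] else [0, 0 :: nat]"
  have l: "?l \<in> tuples (Suc 1) bits" "[0, 0] \<in> tuples (Suc 1) bits" by (simp_all add: tuples_def)
  have b: "reach N 1 (shift_step j) m (la', 0, r') ?b (?l, 1, m)" if "la' \<in> tuples (Suc 1) bits" "r' \<le> N" for la' r'
    using Suc.IH[of as' la' r'] Suc.prems that as(2) by simp
  have b': "reach N 1 (shift_step j) m (?l, 1, m) ?Z ([0, 0], 1, m)"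
    using reach_zero_tree[OF l(1), of 1 m N m "shift_step j"] Suc.prems idle_shift_step by simp
  have "reach N 1 (shift_step j) (Suc m) (la, 0, r)
     (Node (\<lambda>l. if l = a then ?b else if l = Suc a then ?Z else ?Z)) (replicate (Suc 1) 0, 1, Suc m)"
    by (rule reach_two_blocks[where q = "(?l, 1, m)" and ?la2.0 = "[0, 0]"])
      (use Suc.prems b b' l idle_shift_step in auto)
  moreover have "fun_tree (Suc m) (\<lambda>ps. [of_bool (ps = as), 0]) =
     Node (\<lambda>l. if l = a then ?b else if l = Suc a then ?Z else ?Z)"
    by (auto simp: fun_eq_iff fun_tree_eq_iff as)
  ultimately show ?case by simp
qed

text \<open>
  The next multiple of \<open>\<omega>\<^sup>j\<close> is the start of the next block of length \<open>\<omega>\<^sup>j\<close>.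
\<close>

lemma reach_shift_carry:
  assumes "j < N" "length as = j" "la \<in> tuples (Suc 1) bits" "r \<le> N"
  shows "reach N 1 (shift_step j) (Suc j) (la, 0, r)
    (fun_tree (Suc j) (\<lambda>ps. [of_bool (ps = a # as), of_bool (ps = Suc a # replicate j 0)])) ([0, 0], 2, Suc j)"
proof -
  let ?b = "fun_tree j (\<lambda>ps. [of_bool (ps = as), 0 :: nat])"
  let ?b' = "fun_tree j (\<lambda>ps. [0, of_bool (ps = replicate j 0) :: nat])"
  let ?Z = "fun_tree j (\<lambda>_. replicate (Suc 1) (0 :: nat))"
  let ?l = "if j = 0 then [1, 0] else [0, 0 :: nat]"
  let ?l2 = "if j = 0 then [0, 1] else [0, 0 :: nat]"
  have l: "?l \<in> tuples (Suc 1) bits" "?l2 \<in> tuples (Suc 1) bits" "[0, 0] \<in> tuples (Suc 1) bits"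
    by (simp_all add: tuples_def)
  have b: "reach N 1 (shift_step j) j (la', 0, r') ?b (?l, 1, j)" if "la' \<in> tuples (Suc 1) bits" "r' \<le> N" for la' r'
    using reach_shift_mark[of j j N as la' r'] assms that by simp
  have "reach N 1 (shift_step j) j (?l, 1, j) (fun_tree j (\<lambda>ps. replicate 1 0 @ [of_bool (ps = replicate j 0)]))
      (if j = 0 then replicate 1 0 @ [1] else replicate (Suc 1) 0, 2, j)"
  proof (rule reach_origin[OF _ _ _ _ l(1)])
    show "shift_step j 1 j (replicate 1 0) 1 2" by (simp add: shift_step_def)
  qed (use assms(1) idle_shift_step in auto)
  then have b': "reach N 1 (shift_step j) j (?l, 1, j) ?b' (?l2, 2, j)" by (cases "j = 0") simp_all
  have "reach N 1 (shift_step j) (Suc j) (la, 0, r)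
     (Node (\<lambda>l. if l = a then ?b else if l = Suc a then ?b' else ?Z)) (replicate (Suc 1) 0, 2, Suc j)"
    by (rule reach_two_blocks[where q = "(?l, 1, j)" and ?la2.0 = ?l2])
      (use assms b b' l idle_shift_step in auto)
  moreover have "fun_tree (Suc j) (\<lambda>ps. [of_bool (ps = a # as), of_bool (ps = Suc a # replicate j 0)]) =
     Node (\<lambda>l. if l = a then ?b else if l = Suc a then ?b' else ?Z)"
    by (auto simp: fun_eq_iff fun_tree_eq_iff)
  ultimately show ?thesis by simp
qed

lemma reach_shift:
  assumes "length pre + Suc j \<le> N" "length as = j" "la \<in> tuples (Suc 1) bits" "r \<le> N"
  shows "reach N 1 (shift_step j) (length pre + Suc j) (la, 0, r)
    (fun_tree (length pre + Suc j)
       (\<lambda>ps. [of_bool (ps = pre @ a # as), of_bool (ps = pre @ Suc a # replicate j 0)]))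
    ([0, 0], 2, length pre + Suc j)"
  using assms
proof (induction pre arbitrary: la r)
  case Nil
  then show ?case using reach_shift_carry[of j N as la r a] by simp
next
  case (Cons p pre)
  let ?m = "length pre + Suc j"
  let ?b = "fun_tree ?m (\<lambda>ps. [of_bool (ps = pre @ a # as), of_bool (ps = pre @ Suc a # replicate j 0) :: nat])"
  let ?Z = "fun_tree ?m (\<lambda>_. replicate (Suc 1) (0 :: nat))"
  have l: "[0, 0] \<in> tuples (Suc 1) bits" by (simp add: tuples_def)
  have b: "reach N 1 (shift_step j) ?m (la', 0, r') ?b ([0, 0], 2, ?m)" if "la' \<in> tuples (Suc 1) bits" "r' \<le> N" for la' r'
    using Cons that by simp
  have b': "reach N 1 (shift_step j) ?m ([0, 0], 2, ?m) ?Z ([0, 0], 2, ?m)"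
    using reach_zero_tree[OF l, of 2 ?m N ?m "shift_step j"] Cons.prems idle_shift_step by simp
  have "reach N 1 (shift_step j) (Suc ?m) (la, 0, r)
     (Node (\<lambda>l. if l = p then ?b else if l = Suc p then ?Z else ?Z)) (replicate (Suc 1) 0, 2, Suc ?m)"
    by (rule reach_two_blocks[where q = "([0, 0], 2, ?m)" and ?la2.0 = "[0, 0]"])
      (use Cons.prems b b' l idle_shift_step in auto)
  moreover have "fun_tree (Suc ?m) (\<lambda>ps. [of_bool (ps = (p # pre) @ a # as), of_bool (ps = (p # pre) @ Suc a # replicate j 0)]) =
     Node (\<lambda>l. if l = p then ?b else if l = Suc p then ?Z else ?Z)"
    by (auto simp: fun_eq_iff fun_tree_eq_iff)
  ultimately show ?case by simp
qed

section \<open>Finite sets of ordinals below \<open>\<omega>\<^sup>N\<close>\<close>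

definition origin_step :: "nat \<Rightarrow> nat \<Rightarrow> nat list \<Rightarrow> nat \<Rightarrow> nat \<Rightarrow> bool" where
  "origin_step c r xs y c' \<longleftrightarrow> c = 0 \<and> y = 1 \<and> c' = 1 \<or> c = 1 \<and> y = 0 \<and> c' = 1"

definition union_step :: "nat \<Rightarrow> nat \<Rightarrow> nat list \<Rightarrow> nat \<Rightarrow> nat \<Rightarrow> bool" where
  "union_step c r xs y c' \<longleftrightarrow> c = 0 \<and> c' = 0 \<and> y = max (xs ! 0) (xs ! 1)"

definition power_automata :: "nat \<Rightarrow> (nat \<times> (nat list, nat list \<times> nat \<times> nat) automaton) list" where
  "power_automata N = (1, transducer N 0 origin_step) # (3, transducer N 2 union_step) #
     map (\<lambda>j. (2, transducer N 1 (shift_step j))) [0..<N]"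

text \<open>
  Finite sets are represented by their characteristic words.
\<close>

definition power_structure :: "nat \<Rightarrow> nat wtree rel_structure" where
  "power_structure N = tree_structure N finite_support (power_automata N)"

lemma power_automata_cases:
  assumes "(k, B) \<in> set (power_automata N)"
  obtains k' \<delta> where "k = Suc k'" "B = transducer N k' \<delta>" "deterministic \<delta>"
proof -
  have o: "deterministic origin_step" by (auto simp: deterministic_def origin_step_def)
  have u: "deterministic union_step" by (auto simp: deterministic_def union_step_def)
  have "(k, B) = (1, transducer N 0 origin_step) \<or> (k, B) = (3, transducer N 2 union_step) \<or>
      (\<exists>j. (k, B) = (2, transducer N 1 (shift_step j)))"
    using assms unfolding power_automata_def by auto
  then show thesis
    using that[of 0 origin_step] that[of 2 union_step] that[of 1 "shift_step _"] o u deterministic_shift_step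
    by (elim disjE exE) simp_all
qed

lemma power_automata_ok:
  "\<forall>(k, B) \<in> set (power_automata N). ordinal_automaton B \<and> alphabet B = tuples k (alphabet finite_support)"
proof (rule ballI, clarify)
  fix k B assume "(k, B) \<in> set (power_automata N)"
  then obtain k' \<delta> where "k = Suc k'" "B = transducer N k' \<delta>" by (rule power_automata_cases)
  then show "ordinal_automaton B \<and> alphabet B = tuples k (alphabet finite_support)"
    by (simp_all add: ordinal_automaton_transducer)
qed

lemma is_structure_power_structure: "is_structure (power_structure N)"
  unfolding power_structure_def is_structure_tree_structure_iff
proof safe
  fix k B v assume kB: "(k, B) \<in> set (power_automata N)" and v: "v \<in> tree_language N B"
  obtain k' \<delta> where "k = Suc k'" "B = transducer N k' \<delta>" using kB by (rule power_automata_cases)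
  then show "unzip k v \<in> tuples k (tree_language N finite_support)"
    using transducer_in_finite_support[of k' N N \<delta>] v by blast
qed

lemma isomorphism_refl: "isomorphism id M M"
  by (simp add: isomorphism_def)

lemma power_structure_automatic: "power_structure N \<in> injectively_automatic N"
  by (rule injectively_automaticI[OF ordinal_automaton_finite_support power_automata_ok _ _ is_structure_power_structure])
    (use is_structure_power_structure isomorphism_refl in \<open>auto simp: power_structure_def\<close>)

lemma countable_power_structure: "countable (universe (power_structure N))"
  by (simp add: power_structure_def tree_structure_def countable_tree_language_finite_support)

lemma power_structure_relation:
  assumes "(k, B) \<in> set (power_automata N)"
  shows "(k, unzip k ` tree_language N B) \<in> set (relations (power_structure N))" "functional (unzip k ` tree_language N B)"
proof -
  have "(\<lambda>(k, B). (k, unzip k ` tree_language N B)) (k, B) \<in> (\<lambda>(k, B). (k, unzip k ` tree_language N B)) ` set (power_automata N)"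
    using assms by (rule imageI)
  then show "(k, unzip k ` tree_language N B) \<in> set (relations (power_structure N))"
    by (simp add: power_structure_def tree_structure_def)
  obtain k' \<delta> where "k = Suc k'" "B = transducer N k' \<delta>" "deterministic \<delta>"
    using assms by (rule power_automata_cases)
  then show "functional (unzip k ` tree_language N B)" by (simp add: transducer_functional)
qed

definition set_tree :: "nat \<Rightarrow> nat list set \<Rightarrow> nat wtree" where
  "set_tree N X = fun_tree N (\<lambda>ps. of_bool (ps \<in> X))"

lemma set_tree_inj:
  assumes "set_tree N X = set_tree N Y" "\<forall>ps\<in>X \<union> Y. length ps = N"
  shows "X = Y"
proof -
  have *: "\<forall>ps. length ps = N \<longrightarrow> (of_bool (ps \<in> X) :: nat) = of_bool (ps \<in> Y)"
    using assms(1) unfolding set_tree_def fun_tree_eq_iff .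
  have "ps \<in> X \<longleftrightarrow> ps \<in> Y" if "length ps = N" for ps
    using *[rule_format, OF that] by (simp only: of_bool_eq_iff)
  then show ?thesis using assms(2) by blast
qed

lemma reach_tree_language:
  assumes "reach N k \<delta> N (replicate (Suc k) 0, 0, N) t q"
  shows "t \<in> tree_language N (transducer N k \<delta>)"
proof -
  obtain V where p: "path N (transducer N k \<delta>) (replicate (Suc k) 0, 0, N) t V q"
    using assms unfolding reach_def by blast
  have "q \<in> final (transducer N k \<delta>)"
    using path_states[OF ordinal_automaton_transducer p] by (simp add: transducer_def)
  then show ?thesis using p unfolding tree_language_def transducer_simps mem_Collect_eq by blast
qed

lemma origin_related: "[] @ [set_tree N {replicate N 0}] \<in> unzip 1 ` tree_language N (transducer N 0 origin_step)"
proof -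
  have "reach N 0 origin_step N (replicate (Suc 0) 0, 0, N)
    (fun_tree N (\<lambda>ps. replicate 0 0 @ [of_bool (ps = replicate N 0)]))
    (if N = 0 then replicate 0 0 @ [1] else replicate (Suc 0) 0, 1, N)"
  proof (rule reach_origin)
    show "replicate (Suc 0) 0 \<in> tuples (Suc 0) bits" by (rule zeros_in_tuples)
  qed (simp_all add: idle_def origin_step_def)
  from imageI[OF reach_tree_language[OF this], of "unzip 1"] show ?thesis
    by (simp add: unzip_fun_tree set_tree_def)
qed

lemma union_related:
  assumes "finite X" "finite Y"
  shows "[set_tree N X, set_tree N Y] @ [set_tree N (X \<union> Y)] \<in> unzip 3 ` tree_language N (transducer N 2 union_step)"
proof -
  let ?F = "\<lambda>ps. [of_bool (ps \<in> X), of_bool (ps \<in> Y)] @ [of_bool (ps \<in> X \<union> Y) :: nat]"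
  have "reach N 2 union_step N (replicate (Suc 2) 0, 0, N) (fun_tree N ?F)
      (if N = 0 then ?F [] else replicate (Suc 2) 0, 0, N)"
  proof (rule reach_finite_support)
    show "replicate (Suc 2) 0 \<in> tuples (Suc 2) bits" by (rule zeros_in_tuples)
    show "\<exists>xs y. ?F ps = xs @ [y] \<and> xs \<in> tuples 2 bits \<and> y \<in> bits \<and> union_step 0 r xs y 0" for ps r
      by (intro exI conjI, rule refl) (simp_all add: tuples_def union_step_def)
    show "finite {ps. length ps = N \<and> ?F ps \<noteq> replicate (Suc 2) 0}"
      by (rule finite_subset[of _ "X \<union> Y"]) (use assms in \<open>auto simp: numeral_2_eq_2\<close>)
  qed (simp_all add: idle_def union_step_def numeral_2_eq_2)
  from imageI[OF reach_tree_language[OF this], of "unzip 3"] show ?thesis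
    by (simp add: unzip_fun_tree set_tree_def upt_rec numeral_3_eq_3)
qed

text \<open>
  Adding \<open>\<omega>\<^sup>j\<close> increases the coefficient of \<open>\<omega>\<^sup>j\<close> and deletes the smaller terms.
\<close>

lemma shift_related:
  assumes "length pre + Suc (length as) = N"
  shows "[set_tree N {pre @ a # as}] @ [set_tree N {pre @ Suc a # replicate (length as) 0}]
    \<in> unzip 2 ` tree_language N (transducer N 1 (shift_step (length as)))"
proof -
  have "reach N 1 (shift_step (length as)) N (replicate (Suc 1) 0, 0, N)
    (fun_tree N (\<lambda>ps. [of_bool (ps = pre @ a # as), of_bool (ps = pre @ Suc a # replicate (length as) 0)]))
    ([0, 0], 2, N)"
    by (rule reach_shift[where pre = pre and j = "length as" and N = N, unfolded assms])
      (use zeros_in_tuples[of "Suc 1"] in \<open>simp_all del: replicate_Suc\<close>)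
  from imageI[OF reach_tree_language[OF this], of "unzip 2"] show ?thesis
    by (simp add: unzip_fun_tree set_tree_def upt_rec numeral_2_eq_2)
qed

context
  fixes N c :: nat and size :: "nat wtree \<Rightarrow> nat"
  assumes size: "\<And>k B xs y m. (k, B) \<in> set (power_automata N) \<Longrightarrow> xs @ [y] \<in> unzip k ` tree_language N B \<Longrightarrow>
    (\<forall>x\<in>set xs. size x \<le> m) \<Longrightarrow> size y \<le> m + c"
begin

text \<open>
  The last nonzero coefficient of \<open>\<beta>\<close>, that of \<open>\<omega>\<^sup>j\<close> say, can be produced by adding \<open>\<omega>\<^sup>j\<close>.
\<close>

lemma size_singleton: "length as = N \<Longrightarrow> size (set_tree N {as}) \<le> c * Suc (sum_list as)"
proof (induction "sum_list as" arbitrary: as rule: less_induct)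
  case less
  show ?case
  proof (cases "\<exists>x\<in>set as. x \<noteq> 0")
    case False
    then have "as = replicate N 0" using less.prems by (simp add: list_eq_iff_nth_eq)
    moreover have "(1, transducer N 0 origin_step) \<in> set (power_automata N)" by (simp add: power_automata_def)
    from size[OF this origin_related, of 0] have "size (set_tree N {replicate N 0}) \<le> c" by simp
    ultimately show ?thesis by simp
  next
    case True
    then obtain pre x zs where as: "as = pre @ x # zs" "x \<noteq> 0" "\<forall>z\<in>set zs. \<not> z \<noteq> 0"
      using split_list_last_prop[of as "\<lambda>x. x \<noteq> 0"] by blast
    obtain b where b: "x = Suc b" using as(2) by (cases x) auto
    have zs: "zs = replicate (length zs) 0" using as(3) by (simp add: list_eq_iff_nth_eq)
    have len: "length pre + Suc (length zs) = N" using less.prems as(1) by simp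
    let ?bs = "pre @ b # zs"
    have "size (set_tree N {?bs}) \<le> c * Suc (sum_list ?bs)"
      using less.hyps[of ?bs] as(1) b len by simp
    moreover have "(2, transducer N 1 (shift_step (length zs))) \<in> set (power_automata N)"
      using len by (auto simp: power_automata_def)
    from size[OF this shift_related[OF len, of b]]
    have "size (set_tree N {?bs}) \<le> m \<Longrightarrow> size (set_tree N {as}) \<le> m + c" for m
      using zs as(1) b by simp
    ultimately have "size (set_tree N {as}) \<le> c * Suc (sum_list ?bs) + c" by blast
    also have "\<dots> = c * Suc (sum_list as)" using as(1) b by simp
    finally show ?thesis .
  qed
qed

text \<open>
  Sets are split into halves, so that the number of steps grows with the logarithm of their size.
\<close>

lemma size_union:
  assumes "\<forall>as\<in>X. size (set_tree N {as}) \<le> m"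
  shows "finite X \<Longrightarrow> X \<noteq> {} \<Longrightarrow> card X \<le> 2 ^ e \<Longrightarrow> size (set_tree N X) \<le> m + c * e"
  using assms
proof (induction e arbitrary: X)
  case 0
  then obtain as where "X = {as}" by (metis card_1_singletonE card_gt_0_iff le_antisym less_eq_Suc_le One_nat_def power_0)
  then show ?case using 0 by simp
next
  case (Suc e)
  show ?case
  proof (cases "card X \<le> 2 ^ e")
    case True
    have "size (set_tree N X) \<le> m + c * e" by (rule Suc.IH) (use Suc.prems True in auto)
    then show ?thesis by simp
  next
    case False
    then obtain Y where Y: "Y \<subseteq> X" "card Y = 2 ^ e" "finite Y"
      using obtain_subset_with_card_n[of "2 ^ e" X] by auto
    have "card (X - Y) = card X - 2 ^ e" using Y by (simp add: card_Diff_subset)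
    then have XY: "card (X - Y) \<le> 2 ^ e" "X - Y \<noteq> {}"
      using Suc.prems(3) False card_mono[OF Y(3), of X] Y(2) by auto
    have "size (set_tree N Y) \<le> m + c * e"
      by (rule Suc.IH) (use Suc.prems Y in auto)
    moreover have "size (set_tree N (X - Y)) \<le> m + c * e"
      by (rule Suc.IH) (use Suc.prems XY in auto)
    moreover have "(3, transducer N 2 union_step) \<in> set (power_automata N)" by (simp add: power_automata_def)
    from size[OF this union_related[OF Y(3) finite_Diff[OF Suc.prems(1), of Y]]]
    have "size (set_tree N Y) \<le> j \<Longrightarrow> size (set_tree N (X - Y)) \<le> j \<Longrightarrow> size (set_tree N (Y \<union> (X - Y))) \<le> j + c" for j
      by simp
    ultimately have "size (set_tree N (Y \<union> (X - Y))) \<le> m + c * e + c" by blast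
    moreover have "Y \<union> (X - Y) = X" using Y(1) by blast
    ultimately show ?thesis by simp
  qed
qed

lemma size_box_subset:
  assumes X: "X \<noteq> {}" "X \<subseteq> {as. set as \<subseteq> {..<(2::nat) ^ d} \<and> length as = N}"
  shows "size (set_tree N X) \<le> c * (1 + 2 * N) * 2 ^ d"
proof -
  let ?B = "{as. set as \<subseteq> {..<(2::nat) ^ d} \<and> length as = N}"
  have fin: "finite ?B" by (rule finite_lists_length_eq) simp
  have "card X \<le> card ?B" using X(2) fin by (rule card_mono[rotated])
  also have "\<dots> = 2 ^ (d * N)" by (simp add: card_lists_length_eq power_mult)
  finally have card: "card X \<le> 2 ^ (d * N)" .
  have "size (set_tree N {as}) \<le> c * Suc (N * 2 ^ d)" if as: "as \<in> X" for as
  proof -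
    have l: "length as = N" "set as \<subseteq> {..<(2::nat) ^ d}" using as X(2) by auto
    have "sum_list as \<le> (\<Sum>a\<leftarrow>as. 2 ^ d)"
      using l(2) sum_list_mono[of as "\<lambda>a. a" "\<lambda>_. 2 ^ d"] by (simp add: subset_iff less_imp_le)
    also have "\<dots> = N * 2 ^ d" by (simp add: l(1) sum_list_triv)
    finally have "c * Suc (sum_list as) \<le> c * Suc (N * 2 ^ d)" by simp
    then show ?thesis using size_singleton[OF l(1)] by linarith
  qed
  then have "size (set_tree N X) \<le> c * Suc (N * 2 ^ d) + c * (d * N)"
    using finite_subset[OF X(2) fin] X(1) card by (intro size_union) auto
  also have "\<dots> = c * (1 + N * 2 ^ d + d * N)" by (simp add: algebra_simps)
  also have "\<dots> \<le> c * (2 ^ d + N * 2 ^ d + 2 ^ d * N)"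
    by (intro mult_le_mono add_mono) auto
  also have "\<dots> = c * (1 + 2 * N) * 2 ^ d" by (simp add: algebra_simps)
  finally show ?thesis .
qed

end

text \<open>
  With \<open>m = 2\<^sup>d\<close>, all nonempty sets of ordinals with coefficients below \<open>m\<close> have size \<open>O(m)\<close>.  Their number
  is \<open>2\<close> to the power \<open>m\<^bsup>n+1\<^esup>\<close>, minus 1, but the number of elements of that size is only \<open>2\<close> to the power
  \<open>O(m\<^sup>n)\<close>.
\<close>

lemma power_structure_not_automatic: "power_structure (Suc n) \<notin> injectively_automatic n"
proof
  let ?N = "Suc n" and ?M = "power_structure (Suc n)"
  assume "?M \<in> injectively_automatic n"
  from automatic_growth[OF this countable_power_structure]
  obtain size c K where fin: "\<forall>m. finite {x \<in> universe ?M. size x \<le> m} \<and>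
      card {x \<in> universe ?M. size x \<le> m} \<le> K ^ ((m + 1) ^ n)"
    and rel: "\<forall>k R xs y m. (k, R) \<in> set (relations ?M) \<longrightarrow> functional R \<longrightarrow> xs @ [y] \<in> R \<longrightarrow>
       (\<forall>x\<in>set xs. size x \<le> m) \<longrightarrow> size y \<le> m + c" by (elim exE conjE)
  have size: "size y \<le> m + c" if kB: "(k, B) \<in> set (power_automata ?N)" and "xs @ [y] \<in> unzip k ` tree_language ?N B"
    "\<forall>x\<in>set xs. size x \<le> m" for k B xs y m
    using rel power_structure_relation[OF kB] that(2,3) by blast
  define D where "D = c * (1 + 2 * ?N) + 1"
  \<comment> \<open>The comparison of both counts below yields \<open>2\<^sup>d \<le> K * D\<^sup>n + 1\<close>, which this choice refutes.\<close>
  define d where "d = Suc (K * D ^ n)"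
  let ?B = "{as. set as \<subseteq> {..<(2::nat) ^ d} \<and> length as = ?N}"
  let ?m = "c * (1 + 2 * ?N) * 2 ^ d"
  have finB: "finite ?B" by (rule finite_lists_length_eq) simp
  have cardB: "card ?B = 2 ^ (d * ?N)"
    by (simp only: card_lists_length_eq[OF finite_lessThan] card_lessThan power_mult)
  have sub: "set_tree ?N ` (Pow ?B - {{}}) \<subseteq> {x \<in> universe ?M. size x \<le> ?m}"
  proof (rule image_subsetI)
    fix X assume "X \<in> Pow ?B - {{}}"
    then have X: "X \<noteq> {}" "X \<subseteq> ?B" by auto
    have finX: "finite X" using X(2) finB by (rule finite_subset)
    have "(3, transducer ?N 2 union_step) \<in> set (power_automata ?N)" by (simp add: power_automata_def)
    from power_structure_relation(1)[OF this] is_structure_power_structure[of ?N]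
    have "unzip 3 ` tree_language ?N (transducer ?N 2 union_step) \<subseteq> tuples 3 (universe ?M)"
      unfolding is_structure_def by blast
    then have "[set_tree ?N X, set_tree ?N X] @ [set_tree ?N (X \<union> X)] \<in> tuples 3 (universe ?M)"
      using union_related[OF finX finX, of ?N] by blast
    then have "set_tree ?N X \<in> universe ?M" by (simp add: tuples_def)
    moreover have "size (set_tree ?N X) \<le> ?m"
      by (rule size_box_subset[where size = size, OF size X])
    ultimately show "set_tree ?N X \<in> {x \<in> universe ?M. size x \<le> ?m}" by blast
  qed
  have inj: "inj_on (set_tree ?N) (Pow ?B - {{}})"
    by (rule inj_onI) (rule set_tree_inj, auto)
  have "2 ^ (2 ^ (d * ?N)) - 1 = card (Pow ?B - {{}})"
    using finB cardB by (simp add: card_Pow)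
  also have "\<dots> \<le> card {x \<in> universe ?M. size x \<le> ?m}"
    using card_inj_on_le[OF inj sub] fin by blast
  also have "\<dots> \<le> K ^ ((?m + 1) ^ n)" using fin by blast
  also have "\<dots> \<le> (2 ^ K) ^ ((?m + 1) ^ n)"
    by (rule power_mono) auto
  also have "\<dots> = 2 ^ (K * (?m + 1) ^ n)" by (simp add: power_mult)
  also have "\<dots> \<le> 2 ^ (K * (D * 2 ^ d) ^ n)"
  proof (rule power_increasing)
    have "?m + 1 \<le> D * 2 ^ d" by (simp add: D_def algebra_simps)
    then show "K * (?m + 1) ^ n \<le> K * (D * 2 ^ d) ^ n" by (intro mult_le_mono power_mono) auto
  qed simp
  finally have "2 ^ (2 ^ (d * ?N)) \<le> (2::nat) ^ (K * (D * 2 ^ d) ^ n) + 1" by simp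
  also have "\<dots> \<le> 2 ^ (K * (D * 2 ^ d) ^ n + 1)" by simp
  finally have "2 ^ (d * ?N) \<le> K * (D * 2 ^ d) ^ n + 1"
    by (rule power_le_imp_le_exp[rotated]) simp
  also have "\<dots> \<le> (K * D ^ n + 1) * (2 ^ d) ^ n" by (simp add: power_mult_distrib algebra_simps)
  finally have "(2 ^ d) ^ n * 2 ^ d \<le> (2 ^ d) ^ n * (K * D ^ n + 1)"
    by (simp add: power_mult power_add algebra_simps)
  then have "2 ^ d \<le> K * D ^ n + 1" by (rule mult_left_le_imp_le) simp
  then show False using less_exp[of d] by (simp add: d_def)
qed

lemma injectively_automatic_isomorphic:
  assumes "M \<in> injectively_automatic n" "isomorphism g M M'" "is_structure M'"
  shows "M' \<in> injectively_automatic n"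
proof -
  obtain A :: "(nat, nat) automaton" and Bs :: "(nat \<times> (nat list, nat) automaton) list" and h
    where A: "ordinal_automaton A"
    and Bs: "\<forall>(k, B) \<in> set Bs. ordinal_automaton B \<and> alphabet B = tuples k (alphabet A)"
    and S: "is_structure (tree_structure n A Bs)" and h: "isomorphism h (tree_structure n A Bs) M"
    using assms(1) by (rule injectively_automaticE)
  show ?thesis by (rule injectively_automaticI[OF A Bs S isomorphism_trans[OF h assms(2)] assms(3)])
qed

theorem corollary4p7:
  fixes n :: nat
  assumes "n \<ge> 1"
  shows "(injectively_automatic n :: 'm rel_structure set) \<subseteq> injectively_automatic (n + 1) \<and>
         (injectively_automatic n :: nat set rel_structure set) \<subset> injectively_automatic (n + 1)"
proof -
  obtain M :: "nat set rel_structure" and g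
    where M: "M \<in> injectively_automatic (Suc n)" "isomorphism g M (power_structure (Suc n))"
    using power_structure_automatic by (rule injectively_automatic_copy)
  have "M \<notin> injectively_automatic n"
    using injectively_automatic_isomorphic[OF _ M(2) is_structure_power_structure] power_structure_not_automatic
    by blast
  then have "(injectively_automatic n :: nat set rel_structure set) \<noteq> injectively_automatic (n + 1)"
    using M(1) by auto
  then show ?thesis
    by (simp add: psubset_eq injectively_automatic_Suc)
qed

end
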